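(* Let $0<p<1-1/e^2$ be a constant and let $b=\frac{1}{1-p}$. There exist a strictly increasing sequence of positive integers $(n_j)_{j\ge 1}$ and an integer $j_0\ge 1$ such that: (a) for all $j\ge j_0$, $j$ divides $n_j$; (b) letting $\gamma_j=2\log_b n_j-2\log_b\log_b n_j-2\log_b 2$, we have $\gamma_j=j+o(1)$ as $j\to\infty$; (c) letting $G\sim\mathcal{G}(n_j,m_j)$ with $m_j=\left\lfloor p\binom{n_j}{2}\right\rfloor$, with high probability as $j\to\infty$, \[\chi_=(G)=\frac{n_j}{j}.\]
   Context: $\mathcal{G}(n,m)$ denotes the uniform random graph, chosen uniformly at random among all graphs on $n$ labelled vertices with exactly $m$ edges. An equitable colouring of a graph is a proper vertex colouring in which any two colour classes differ in size by at most $1$; the equitable chromatic number $\chi_=(G)$ is the least number of colours in an equitable colouring of $G$. An event holds with high probability (whp) as $j\to\infty$ if its probability tends to $1$ as $j\to\infty$. *)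

theory Defs
  imports "HOL-Probability.Probability"
begin

text \<open>Simple graphs on the labelled vertex set {0..<n}, given by their edge sets
  (edges are 2-element subsets of {0..<n}).\<close>

definition all_edges :: "nat \<Rightarrow> nat set set" where
  "all_edges n = {e. e \<subseteq> {0..<n} \<and> card e = 2}"

definition graphs_nm :: "nat \<Rightarrow> nat \<Rightarrow> nat set set set" where
  "graphs_nm n m = {E. E \<subseteq> all_edges n \<and> card E = m}"

definition prob_Gnm :: "nat \<Rightarrow> nat \<Rightarrow> (nat set set \<Rightarrow> bool) \<Rightarrow> real" where
  "prob_Gnm n m P = measure_pmf.prob (pmf_of_set (graphs_nm n m)) {E. P E}"

definition equitable_colouring :: "nat \<Rightarrow> nat set set \<Rightarrow> nat \<Rightarrow> (nat \<Rightarrow> nat) \<Rightarrow> bool" where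
  "equitable_colouring n E k f \<longleftrightarrow>
     (\<forall>v\<in>{0..<n}. f v < k) \<and>
     (\<forall>u v. {u, v} \<in> E \<longrightarrow> f u \<noteq> f v) \<and>
     (\<forall>i<k. \<forall>j<k. card {v\<in>{0..<n}. f v = i} \<le> card {v\<in>{0..<n}. f v = j} + 1)"

definition eq_chromatic :: "nat \<Rightarrow> nat set set \<Rightarrow> nat" where
  "eq_chromatic n E = (LEAST k. \<exists>f. equitable_colouring n E k f)"

end

theory Submission
  imports Defs
begin

text \<open>
  Let \<open>n = j k\<close> and let \<open>X\<close> be the number of ordered partitions of the vertex set into \<open>k\<close> independent
  sets of size \<open>j\<close>. For each \<open>j\<close> we take the least \<open>k\<close> for which the expected number of unordered such partitions
  exceeds roughly \<open>sqrt j ^ j\<close>; then \<open>k\<close> is asymptotic to \<open>b powr (j/2)\<close>, which is the claim on \<open>\<gamma>\<close>.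

  Fewer than \<open>k\<close> colours: every class of an equitable colouring with \<open>k - e\<close> colours has at least \<open>j\<close>
  vertices, and comparing the number of such colourings and of the edges they forbid with the case
  \<open>e = 0\<close> shows that the expectation drops by a factor of about \<open>j ^ (- e j)\<close>. The first moment method applies.

  Exactly \<open>k\<close> colours: fix a partition \<open>f\<close> and sum over all partitions \<open>g\<close>, with \<open>x\<^sub>i\<^sub>l\<close> the size of the
  intersection of the \<open>i\<close>-th class of \<open>f\<close> and the \<open>l\<close>-th class of \<open>g\<close>. The pair \<open>(f, g)\<close> shares
  \<open>s = \<Sum> x\<^sub>i\<^sub>l choose 2\<close> forbidden pairs and contributes about \<open>b ^ s\<close> relative to independence. Call \<open>x\<^sub>i\<^sub>l\<close>
  large if it exceeds \<open>2j/3\<close>. If few classes have a large intersection, \<open>b ^ (x choose 2)\<close> is expanded into a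
  sum over subsets of the cells, which turns the sum over \<open>g\<close> into joint factorial moments that factorise over the
  cells. Cells of size two contribute exactly the factor by which fixing the number of edges lowers the
  probability of avoiding both sets of forbidden pairs, and all other cells are negligible; for entire classes this needs
  \<open>ln b < 2\<close>. If many classes have a large intersection, \<open>g\<close> is encoded by the matching of these classes, the
  vertices exchanged by matched classes, and the rest, and the resulting sum is bounded by a constant
  divided by the expected number of unordered partitions. Hence \<open>E X\<^sup>2 / (E X)\<^sup>2\<close> tends to 1.
\<close>

section \<open>Functions with prescribed fibres and random graphs\<close>

text \<open>Fixing the number of edges is essential for the second moment. In the binomial model the
  cells of size two alone would make the ratio of the second moment to the squared mean grow
  exponentially in \<open>j ^ 2\<close>, which only reflects fluctuations of the number of edges.
  The condition \<open>ln b < 2\<close> concerns one shared class: there are \<open>k ^ 2\<close>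
  pairs of classes, two of them coincide with probability about \<open>fact j / n ^ j\<close>, and
  this gains \<open>b ^ (j choose 2)\<close>. With \<open>k\<close> near \<open>b powr (j/2)\<close>
  the product is \<open>(sqrt b / exp 1) ^ j\<close> up to a factor polynomial in \<open>j\<close>.
  One method does not serve all \<open>g\<close>. The expansion over cells replaces the probability
  that \<open>M\<close> vertices are placed as prescribed, which involves
  \<open>1 / (n * (n - 1) * ...)\<close>, by powers of \<open>1 / n\<close>. When \<open>M\<close>
  is a large part of \<open>n\<close> this loses a factor exponential in \<open>M\<close>, so
  partitions that nearly coincide with \<open>f\<close> are counted directly. There the bound is
  sharp up to a constant: the \<open>fact k\<close> relabellings of \<open>f\<close> alone
  contribute the reciprocal of the expected number of unordered partitions, so that this number has
  to tend to infinity.\<close>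

lemma sum_Pow_card:
  fixes \<phi> :: "nat \<Rightarrow> real"
  assumes "finite Y"
  shows "(\<Sum>X\<in>Pow Y. \<phi> (card X)) = (\<Sum>x\<le>card Y. real (card Y choose x) * \<phi> x)"
proof -
  have "(\<Sum>X\<in>Pow Y. \<phi> (card X)) = (\<Sum>x\<in>{..card Y}. \<Sum>X\<in>{X\<in>Pow Y. card X = x}. \<phi> (card X))"
    using assms by (intro sum.group[symmetric]) (auto intro: card_mono)
  also have "\<dots> = (\<Sum>x\<le>card Y. real (card Y choose x) * \<phi> x)"
  proof (rule sum.cong[OF refl])
    fix x
    have "(\<Sum>X\<in>{X\<in>Pow Y. card X = x}. \<phi> (card X)) = (\<Sum>X\<in>{X\<in>Pow Y. card X = x}. \<phi> x)"
      by (intro sum.cong) auto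
    also have "\<dots> = real (card {X. X \<subseteq> Y \<and> card X = x}) * \<phi> x" by (simp add: Pow_def)
    finally show "(\<Sum>X\<in>{X\<in>Pow Y. card X = x}. \<phi> (card X)) = real (card Y choose x) * \<phi> x"
      by (simp add: n_subsets[OF assms])
  qed
  finally show ?thesis .
qed

lemma choose_two_add: "(x + y :: nat) choose 2 = (x choose 2) + (y choose 2) + x * y"
  by (induction x) (auto simp: numeral_2_eq_2 algebra_simps)

lemma twelve_choose_two: "12 * (j choose 2) = 6 * (j * (j - 1))"
proof -
  have "2 * (j choose 2) = j * (j - 1)" by (induction j) (auto simp: numeral_2_eq_2 algebra_simps)
  then show ?thesis by simp
qed

lemma sum_choose_two_le:
  assumes "finite A"
  shows "(\<Sum>a\<in>A. x a choose 2) \<le> (\<Sum>a\<in>A. x a) choose (2::nat)"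
  using assms
proof (induction A rule: finite_induct)
  case (insert a A)
  then show ?case using choose_two_add[of "x a" "sum x A"] by simp
qed simp

text \<open>Ordered partitions as extensional functions, so that distinct functions differ on
  \<open>V\<close>. Variable fibre sizes serve twice: for the slightly unequal classes of an
  equitable colouring, and for the places left free after some vertices have been
  prescribed.\<close>

definition fibre_functions :: "'a set \<Rightarrow> 'b set \<Rightarrow> ('b \<Rightarrow> nat) \<Rightarrow> ('a \<Rightarrow> 'b) set" where
  "fibre_functions V L d = {f \<in> V \<rightarrow>\<^sub>E L. \<forall>l\<in>L. card {v\<in>V. f v = l} = d l}"

lemma finite_fibre_functions:
  "finite V \<Longrightarrow> finite L \<Longrightarrow> finite (fibre_functions V L d)"
  unfolding fibre_functions_def by (rule finite_subset[of _ "V \<rightarrow>\<^sub>E L"]) (auto intro: finite_PiE)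

text \<open>The multinomial coefficient, multiplied out to stay within the naturals: choose the
  fibre of one label, then what is left is a function on the complement.\<close>

lemma card_fibre_functions_nat:
  assumes "finite L" "finite V" "(\<Sum>l\<in>L. d l) = card V"
  shows "card (fibre_functions V L d) * (\<Prod>l\<in>L. fact (d l)) = (fact (card V) :: nat)"
  using assms
proof (induction L arbitrary: V rule: finite_induct)
  case empty
  then show ?case by (simp add: fibre_functions_def)
next
  case (insert l L)
  let ?As = "{A. A \<subseteq> V \<and> card A = d l}"
  let ?to = "\<lambda>f. ({v\<in>V. f v = l}, restrict f (V - {v\<in>V. f v = l}))"
  let ?from = "\<lambda>(A, g) v. if v \<in> A then l else g v"
  have dl: "d l \<le> card V" using insert by simp
  have bij: "bij_betw ?to (fibre_functions V (insert l L) d) (SIGMA A:?As. fibre_functions (V - A) L d)"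
  proof (rule bij_betw_byWitness[where f' = ?from])
    show "\<forall>f\<in>fibre_functions V (insert l L) d. ?from (?to f) = f"
      by (auto simp: fibre_functions_def fun_eq_iff PiE_iff extensional_def)
    show "\<forall>a\<in>SIGMA A:?As. fibre_functions (V - A) L d. ?to (?from a) = a"
    proof (rule ballI)
      fix x assume x: "x \<in> (SIGMA A:?As. fibre_functions (V - A) L d)"
      obtain A g where xe: "x = (A, g)" by (cases x)
      have A: "A \<subseteq> V" "card A = d l" and g: "g \<in> fibre_functions (V - A) L d"
        using x xe by auto
      have "{v\<in>V. ?from (A, g) v = l} = A"
        using A g insert.hyps by (auto simp: fibre_functions_def PiE_iff)
      then show "?to (?from x) = x" unfolding xe
        using g by (auto simp: fun_eq_iff fibre_functions_def PiE_iff extensional_def)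
    qed
    show "?to ` fibre_functions V (insert l L) d \<subseteq> (SIGMA A:?As. fibre_functions (V - A) L d)"
    proof (intro image_subsetI)
      fix f assume f: "f \<in> fibre_functions V (insert l L) d"
      let ?A = "{v\<in>V. f v = l}"
      have "card {v \<in> V - ?A. restrict f (V - ?A) v = l'} = d l'" if "l' \<in> L" for l'
      proof -
        have "{v \<in> V - ?A. restrict f (V - ?A) v = l'} = {v\<in>V. f v = l'}"
          using that insert.hyps by auto
        thus ?thesis using f that by (simp add: fibre_functions_def)
      qed
      then show "?to f \<in> (SIGMA A:?As. fibre_functions (V - A) L d)"
        using f by (auto simp: fibre_functions_def PiE_iff)
    qed
    show "?from ` (SIGMA A:?As. fibre_functions (V - A) L d) \<subseteq> fibre_functions V (insert l L) d"
    proof (rule image_subsetI)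
      fix x assume x: "x \<in> (SIGMA A:?As. fibre_functions (V - A) L d)"
      obtain A g where xe: "x = (A, g)" by (cases x)
      have A: "A \<subseteq> V" "card A = d l" and g: "g \<in> fibre_functions (V - A) L d"
        using x xe by auto
      have 1: "{v\<in>V. ?from (A, g) v = l} = A"
        using A g insert.hyps by (auto simp: fibre_functions_def PiE_iff)
      have 2: "{v\<in>V. ?from (A, g) v = l'} = {v \<in> V - A. g v = l'}" if "l' \<in> L" for l'
        using that A insert.hyps by auto
      show "?from x \<in> fibre_functions V (insert l L) d"
        unfolding fibre_functions_def xe
      proof (intro CollectI conjI ballI)
        show "?from (A, g) \<in> V \<rightarrow>\<^sub>E insert l L"
          using A g by (auto simp: fibre_functions_def PiE_iff extensional_def)
        fix l' assume "l' \<in> insert l L"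
        then show "card {v\<in>V. ?from (A, g) v = l'} = d l'"
          using 1 2 A g by (cases "l' = l") (auto simp: fibre_functions_def)
      qed
    qed
  qed
  have fin: "finite ?As" using insert by simp
  have inner: "card (fibre_functions (V - A) L d) * (\<Prod>l\<in>L. fact (d l)) = fact (card V - d l)"
    if "A \<in> ?As" for A
  proof -
    have "(\<Sum>l\<in>L. d l) = card (V - A)"
      using that insert by (auto simp: card_Diff_subset finite_subset)
    then show ?thesis
      using insert.IH[of "V - A"] that insert.prems by (auto simp: card_Diff_subset finite_subset)
  qed
  have "card (fibre_functions V (insert l L) d) = (\<Sum>A\<in>?As. card (fibre_functions (V - A) L d))"
    using bij_betw_same_card[OF bij] fin insert by (simp add: card_SigmaI finite_fibre_functions)
  then have "card (fibre_functions V (insert l L) d) * (\<Prod>l\<in>L. fact (d l))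
      = (\<Sum>A\<in>?As. fact (card V - d l))"
    using inner by (simp add: sum_distrib_right)
  also have "\<dots> = (card V choose d l) * fact (card V - d l)"
    using insert by (simp add: n_subsets)
  finally have "card (fibre_functions V (insert l L) d) * (\<Prod>l\<in>insert l L. fact (d l))
      = fact (d l) * fact (card V - d l) * (card V choose d l)"
    using insert.hyps by (simp add: algebra_simps)
  also have "\<dots> = fact (card V)" by (rule binomial_fact_lemma[OF dl])
  finally show ?case .
qed

lemma card_fibre_functions:
  assumes "finite L" "finite V" "(\<Sum>l\<in>L. d l) = card V"
  shows "real (card (fibre_functions V L d)) = fact (card V) / (\<Prod>l\<in>L. fact (d l))"
proof -
  have "real (card (fibre_functions V L d)) * (\<Prod>l\<in>L. fact (d l)) = fact (card V)"
    using arg_cong[OF card_fibre_functions_nat[OF assms], of real] by (simp add: of_nat_prod)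
  moreover have "(\<Prod>l\<in>L. fact (d l) :: real) \<noteq> 0" using assms(1) by simp
  ultimately show ?thesis by (metis nonzero_mult_div_cancel_right)
qed

text \<open>The pairs that a proper colouring forbids as edges. The codomain is arbitrary so that
  the pairs forbidden by both \<open>f\<close> and \<open>g\<close> are again of this form, for the
  colouring \<open>\<lambda>v. (g v, f v)\<close>.\<close>

definition mono_edges :: "nat \<Rightarrow> (nat \<Rightarrow> 'c) \<Rightarrow> nat set set" where
  "mono_edges n h = {e \<in> all_edges n. \<forall>u\<in>e. \<forall>v\<in>e. h u = h v}"

lemma finite_all_edges [simp]: "finite (all_edges n)"
  unfolding all_edges_def by (rule finite_subset[of _ "Pow {0..<n}"]) auto

lemma card_all_edges: "card (all_edges n) = n choose 2"
  unfolding all_edges_def using n_subsets[of "{0..<n}" 2] by simp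

lemma mono_edges_subset: "mono_edges n h \<subseteq> all_edges n"
  by (auto simp: mono_edges_def)

lemma card_mono_edges:
  assumes "finite L" "\<And>v. v < n \<Longrightarrow> h v \<in> L"
  shows "card (mono_edges n h) = (\<Sum>l\<in>L. card {v\<in>{0..<n}. h v = l} choose 2)"
proof -
  let ?P = "\<lambda>l. {e. e \<subseteq> {v\<in>{0..<n}. h v = l} \<and> card e = 2}"
  have "mono_edges n h = (\<Union>l\<in>L. ?P l)"
  proof (intro equalityI subsetI)
    fix e assume e: "e \<in> mono_edges n h"
    then have sub: "e \<subseteq> {0..<n}" and c: "card e = 2" and eq: "\<And>u v. u \<in> e \<Longrightarrow> v \<in> e \<Longrightarrow> h u = h v"
      unfolding mono_edges_def all_edges_def by blast+
    obtain u where u: "u \<in> e" using c by fastforce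
    have "e \<in> ?P (h u)" using sub c eq u by blast
    moreover have "h u \<in> L" using assms(2) sub u by auto
    ultimately show "e \<in> (\<Union>l\<in>L. ?P l)" by blast
  next
    fix e assume "e \<in> (\<Union>l\<in>L. ?P l)"
    then obtain l where "e \<subseteq> {v\<in>{0..<n}. h v = l}" "card e = 2" by blast
    then show "e \<in> mono_edges n h" unfolding mono_edges_def all_edges_def by blast
  qed
  moreover have "card (\<Union>l\<in>L. ?P l) = (\<Sum>l\<in>L. card (?P l))"
  proof (rule card_UN_disjoint)
    show "\<forall>i\<in>L. \<forall>j\<in>L. i \<noteq> j \<longrightarrow> ?P i \<inter> ?P j = {}"
    proof (intro ballI impI equals0I)
      fix i j e assume "i \<noteq> j" and e: "e \<in> ?P i \<inter> ?P j"
      then obtain u where "u \<in> e" by (auto simp: card_2_iff)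
      with e \<open>i \<noteq> j\<close> show False by auto
    qed
    show "\<forall>i\<in>L. finite (?P i)"
      by (auto intro: finite_subset[of _ "Pow {0..<n}"])
  qed fact
  ultimately show ?thesis by (simp add: n_subsets)
qed

lemma card_graphs_nm: "card (graphs_nm n m) = (n choose 2) choose m"
  unfolding graphs_nm_def by (simp add: n_subsets card_all_edges)

lemma finite_graphs_nm [simp]: "finite (graphs_nm n m)"
  unfolding graphs_nm_def by (rule finite_subset[of _ "Pow (all_edges n)"]) auto

lemma card_graphs_avoiding:
  assumes "S \<subseteq> all_edges n"
  shows "card {E \<in> graphs_nm n m. E \<inter> S = {}} = ((n choose 2) - card S) choose m"
proof -
  have "{E \<in> graphs_nm n m. E \<inter> S = {}} = {E. E \<subseteq> all_edges n - S \<and> card E = m}"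
    by (auto simp: graphs_nm_def)
  moreover have "card (all_edges n - S) = (n choose 2) - card S"
    using assms by (simp add: card_Diff_subset finite_subset card_all_edges)
  ultimately show ?thesis by (simp add: n_subsets)
qed

lemma proper_iff_avoids_mono:
  assumes "E \<in> graphs_nm n m"
  shows "(\<forall>u v. {u, v} \<in> E \<longrightarrow> f u \<noteq> f v) \<longleftrightarrow> E \<inter> mono_edges n f = {}"
proof (intro iffI allI impI equals0I notI)
  fix e assume P: "\<forall>u v. {u, v} \<in> E \<longrightarrow> f u \<noteq> f v" and e: "e \<in> E \<inter> mono_edges n f"
  then have "card e = 2" by (simp add: mono_edges_def all_edges_def)
  then obtain u v where uv: "e = {u, v}" by (auto simp: card_2_iff)
  then have "f u = f v" using e unfolding mono_edges_def by blast
  with P e uv show False by blast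
next
  fix u v assume dis: "E \<inter> mono_edges n f = {}" and uv: "{u, v} \<in> E" and eq: "f u = f v"
  have "{u, v} \<in> all_edges n" using uv assms unfolding graphs_nm_def by blast
  then have "{u, v} \<in> mono_edges n f" unfolding mono_edges_def using eq by simp
  with dis uv show False by blast
qed

lemma prob_Gnm_eq:
  assumes "m \<le> n choose 2"
  shows "prob_Gnm n m P = real (card {E \<in> graphs_nm n m. P E}) / real ((n choose 2) choose m)"
proof -
  have "card (graphs_nm n m) > 0" using assms by (simp add: card_graphs_nm)
  then have "graphs_nm n m \<noteq> {}" by auto
  then show ?thesis unfolding prob_Gnm_def
    by (subst measure_pmf_of_set) (auto simp: card_graphs_nm Int_def)
qed

text \<open>Cauchy-Schwarz on the support of \<open>X\<close>. Divided by the square of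
  \<open>card A\<close>, it bounds the probability of \<open>X \<noteq> 0\<close> from below by the
  squared mean over the second moment.\<close>

lemma second_moment:
  fixes X :: "'a \<Rightarrow> real"
  assumes "finite A"
  shows "(\<Sum>a\<in>A. X a)\<^sup>2 \<le> real (card {a\<in>A. X a \<noteq> 0}) * (\<Sum>a\<in>A. (X a)\<^sup>2)"
proof -
  let ?B = "{a\<in>A. X a \<noteq> 0}"
  have 1: "(\<Sum>a\<in>A. X a) = (\<Sum>a\<in>?B. 1 * X a)"
    using assms by (intro sum.mono_neutral_cong_right) auto
  have 2: "(\<Sum>a\<in>A. (X a)\<^sup>2) = (\<Sum>a\<in>?B. (X a)\<^sup>2)"
    using assms by (intro sum.mono_neutral_cong_right) auto
  show ?thesis unfolding 1 2
    using Cauchy_Schwarz_ineq_sum[of "\<lambda>_. 1" X ?B] by simp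
qed

section \<open>Colourings with many large cells\<close>

text \<open>For the whole vertex set this is the number of pairs forbidden by both colourings
  (\<open>card_mono_Int\<close>). Vertices \<open>Q\<close> and columns \<open>C\<close> are
  parameters because, once the matched classes are taken away, only part of the vertices and the
  unmatched columns remain, whereas the rows are still all classes of \<open>f\<close>.\<close>

definition cell_pairs :: "'r set \<Rightarrow> 'c set \<Rightarrow> ('a \<Rightarrow> 'r) \<Rightarrow> ('a \<Rightarrow> 'c) \<Rightarrow> 'a set \<Rightarrow> nat" where
  "cell_pairs R C f h Q = (\<Sum>l\<in>C. \<Sum>i\<in>R. card {v\<in>Q. f v = i \<and> h v = l} choose 2)"

definition bounded_cells :: "'r set \<Rightarrow> 'c set \<Rightarrow> ('a \<Rightarrow> 'r) \<Rightarrow> nat \<Rightarrow> 'a set \<Rightarrow> ('a \<Rightarrow> 'c) set" where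
  "bounded_cells R C f c Q =
     {h \<in> Q \<rightarrow>\<^sub>E C. \<forall>i\<in>R. \<forall>l\<in>C. card {v\<in>Q. f v = i \<and> h v = l} \<le> c}"

lemma finite_bounded_cells:
  "finite Q \<Longrightarrow> finite C \<Longrightarrow> finite (bounded_cells R C f c Q)"
  unfolding bounded_cells_def by (rule finite_subset[of _ "Q \<rightarrow>\<^sub>E C"]) (auto intro: finite_PiE)

lemma sum_small_subsets_le:
  fixes \<phi> :: "nat \<Rightarrow> real"
  assumes "finite Y" "card Y \<le> j" "\<And>x. 0 \<le> \<phi> x"
  shows "(\<Sum>X | X \<subseteq> Y \<and> card X < c. \<phi> (card X)) \<le> (\<Sum>x<c. real (j choose x) * \<phi> x)"
proof -
  let ?\<psi> = "\<lambda>x. if x < c then \<phi> x else 0"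
  have "(\<Sum>X | X \<subseteq> Y \<and> card X < c. \<phi> (card X)) = (\<Sum>X\<in>Pow Y. ?\<psi> (card X))"
    using assms(1) by (intro sum.mono_neutral_cong_left) auto
  also have "\<dots> = (\<Sum>x\<le>card Y. real (card Y choose x) * ?\<psi> x)"
    by (rule sum_Pow_card[OF assms(1)])
  also have "\<dots> = (\<Sum>x\<in>{..card Y} \<inter> {..<c}. real (card Y choose x) * \<phi> x)"
    by (intro sum.mono_neutral_cong_right) auto
  also have "\<dots> \<le> (\<Sum>x<c. real (card Y choose x) * \<phi> x)"
    using assms(3) by (intro sum_mono2) auto
  also have "\<dots> \<le> (\<Sum>x<c. real (j choose x) * \<phi> x)"
    using assms by (intro sum_mono mult_right_mono) (auto intro: binomial_right_mono)
  finally show ?thesis .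
qed

text \<open>Induction on \<^term>\<open>Q\<close>: remove one vertex together with the rest of its cell.\<close>
lemma bounded_cell_sum:
  fixes b K :: real and f :: "'a \<Rightarrow> 'r" and C :: "'c set"
  assumes "finite Q" and fR: "finite R" and fC: "finite C" and b: "b \<ge> 0" and K: "K > 0"
    and fQ: "f ` Q \<subseteq> R" and rows: "\<And>i. card {v\<in>Q. f v = i} \<le> j"
    and cond: "real (card C) * (\<Sum>x<c. real (j choose x) * (b ^ (Suc x choose 2) / K ^ x)) \<le> K"
  shows "(\<Sum>h\<in>bounded_cells R C f c Q. b ^ cell_pairs R C f h Q) \<le> K ^ card Q"
  using assms(1) fQ rows
proof (induction Q rule: finite_psubset_induct)
  case (psubset Q)
  show ?case
  proof (cases "Q = {}")
    case True
    have "bounded_cells R C f c Q \<subseteq> {\<lambda>_. undefined}" using True by (auto simp: bounded_cells_def)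
    then have "(\<Sum>h\<in>bounded_cells R C f c Q. b ^ cell_pairs R C f h Q)
        \<le> (\<Sum>h\<in>{\<lambda>_. undefined}. b ^ cell_pairs R C f h Q)"
      using b by (intro sum_mono2) auto
    also have "\<dots> = 1" using True by (simp add: cell_pairs_def binomial_eq_0)
    finally show ?thesis using True by simp
  next
    case False
    then obtain v where v: "v \<in> Q" by auto
    define Y where "Y = {w\<in>Q - {v}. f w = f v}"
    define Xs where "Xs = {X. X \<subseteq> Y \<and> card X < c}"
    define X where "X h = {w\<in>Q - {v}. f w = f v \<and> h w = h v}" for h :: "'a \<Rightarrow> 'c"
    define Q' where "Q' X = Q - insert v X" for X
    define T where "T = (SIGMA l:C. SIGMA X:Xs. bounded_cells R C f c (Q' X))"
    define \<Phi> where "\<Phi> h = (h v, X h, restrict h (Q' (X h)))" for h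
    define w where "w = (\<lambda>(l::'c, X, h'). b ^ (Suc (card X) choose 2) * b ^ cell_pairs R C f h' (Q' X))"
    have finQ: "finite Q" by fact
    have finY: "finite Y" using finQ by (simp add: Y_def)
    have finXs: "finite Xs" unfolding Xs_def using finY by simp
    have finX: "finite (X h)" for h using finQ by (simp add: X_def)
    have vX: "v \<notin> X h" for h by (simp add: X_def)
    have cell_v: "{w\<in>Q. f w = f v \<and> h w = h v} = insert v (X h)" for h
      using v by (auto simp: X_def)
    have cell_v': "{w\<in>Q' (X h). f w = f v \<and> restrict h (Q' (X h)) w = h v} = {}" for h
      by (auto simp: X_def Q'_def)
    have cell_other: "{w\<in>Q' (X h). f w = i \<and> restrict h (Q' (X h)) w = l} = {w\<in>Q. f w = i \<and> h w = l}"
      if "(l, i) \<noteq> (h v, f v)" for h i l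
      using that by (auto simp: X_def Q'_def)
    have hvC: "h v \<in> C" if "h \<in> bounded_cells R C f c Q" for h
      using that v by (auto simp: bounded_cells_def)
    have fvR: "f v \<in> R" using psubset.prems v by auto
    have weight: "cell_pairs R C f h Q = (Suc (card (X h)) choose 2)
        + cell_pairs R C f (restrict h (Q' (X h))) (Q' (X h))" if "h \<in> bounded_cells R C f c Q" for h
    proof -
      let ?x = "\<lambda>(l, i). card {w\<in>Q. f w = i \<and> h w = l} choose 2"
      let ?x' = "\<lambda>(l, i). card {w\<in>Q' (X h). f w = i \<and> restrict h (Q' (X h)) w = l} choose 2"
      have m: "(h v, f v) \<in> C \<times> R" using hvC[OF that] fvR by simp
      have "cell_pairs R C f h Q = sum ?x (C \<times> R)"
        by (simp add: cell_pairs_def sum.cartesian_product)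
      also have "\<dots> = ?x (h v, f v) + sum ?x (C \<times> R - {(h v, f v)})"
        using m fR fC by (intro sum.remove) auto
      also have "sum ?x (C \<times> R - {(h v, f v)}) = sum ?x' (C \<times> R - {(h v, f v)})"
      proof (rule sum.cong[OF refl])
        fix y assume y: "y \<in> C \<times> R - {(h v, f v)}"
        obtain l i where li: "y = (l, i)" by (cases y)
        then have "(l, i) \<noteq> (h v, f v)" using y by simp
        from cell_other[where h = h and l = l and i = i, OF this] show "?x y = ?x' y" unfolding li by (simp only: prod.case)
      qed
      also have "\<dots> = sum ?x' (C \<times> R)"
      proof -
        have "?x' (h v, f v) = 0" using cell_v'[of h] by (simp only: prod.case card.empty) simp
        then show ?thesis using sum.remove[of "C \<times> R" "(h v, f v)" ?x'] m fR fC by simp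
      qed
      also have "\<dots> = cell_pairs R C f (restrict h (Q' (X h))) (Q' (X h))"
        by (simp add: cell_pairs_def sum.cartesian_product)
      also have "?x (h v, f v) = Suc (card (X h)) choose 2"
        using cell_v[of h] finX vX by simp
      finally show ?thesis .
    qed
    have into: "\<Phi> ` bounded_cells R C f c Q \<subseteq> T"
    proof (rule image_subsetI)
      fix h assume h: "h \<in> bounded_cells R C f c Q"
      have "card (X h) < c"
      proof -
        have "card {w\<in>Q. f w = f v \<and> h w = h v} \<le> c"
          using h hvC[OF h] fvR unfolding bounded_cells_def by blast
        then have "card (insert v (X h)) \<le> c" by (simp only: cell_v)
        then show ?thesis using finX vX by simp
      qed
      then have 1: "X h \<in> Xs" by (auto simp: Xs_def X_def Y_def)
      have 2: "card {w\<in>Q' (X h). f w = i \<and> restrict h (Q' (X h)) w = l} \<le> c"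
        if "i \<in> R" "l \<in> C" for i l
      proof -
        have "card {w\<in>Q' (X h). f w = i \<and> restrict h (Q' (X h)) w = l}
            \<le> card {w\<in>Q. f w = i \<and> h w = l}"
          using finQ by (intro card_mono) (auto simp: Q'_def)
        then show ?thesis using h that unfolding bounded_cells_def by fastforce
      qed
      have "restrict h (Q' (X h)) \<in> Q' (X h) \<rightarrow>\<^sub>E C"
        using h by (auto simp: bounded_cells_def Q'_def)
      with 2 have "restrict h (Q' (X h)) \<in> bounded_cells R C f c (Q' (X h))"
        by (simp only: bounded_cells_def mem_Collect_eq) blast
      with 1 hvC[OF h] show "\<Phi> h \<in> T" by (simp add: T_def \<Phi>_def)
    qed
    have inj: "inj_on \<Phi> (bounded_cells R C f c Q)"
    proof (rule inj_onI)
      fix h g assume h: "h \<in> bounded_cells R C f c Q" and g: "g \<in> bounded_cells R C f c Q"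
        and eq: "\<Phi> h = \<Phi> g"
      have e1: "h v = g v" and e2: "X h = X g" and e3: "restrict h (Q' (X h)) = restrict g (Q' (X h))"
        using eq by (auto simp: \<Phi>_def)
      show "h = g"
      proof
        fix u
        consider "u \<notin> Q" | "u = v" | "u \<in> X h" | "u \<in> Q' (X h)" by (auto simp: Q'_def)
        then show "h u = g u"
        proof cases
          case 1 then show ?thesis using h g by (auto simp: bounded_cells_def PiE_iff extensional_def)
        next
          case 3
          then have "h u = h v" by (simp add: X_def)
          moreover have "g u = g v" using 3 unfolding e2 by (simp add: X_def)
          ultimately show ?thesis by (simp only: e1)
        next
          case 4 then show ?thesis using fun_cong[OF e3, of u] by simp
        qed (use e1 in auto)
      qed
    qed
    have finT: "finite T"
      unfolding T_def using fC finXs finQ by (intro finite_SigmaI finite_bounded_cells) (auto simp: Q'_def)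
    have "(\<Sum>h\<in>bounded_cells R C f c Q. b ^ cell_pairs R C f h Q) = (\<Sum>h\<in>bounded_cells R C f c Q. w (\<Phi> h))"
      by (intro sum.cong refl) (simp add: weight w_def \<Phi>_def power_add)
    also have "\<dots> = sum w (\<Phi> ` bounded_cells R C f c Q)"
      by (simp add: sum.reindex[OF inj])
    also have "\<dots> \<le> sum w T"
      using into finT b by (intro sum_mono2) (auto simp: w_def)
    also have "\<dots> = (\<Sum>l\<in>C. \<Sum>X\<in>Xs. b ^ (Suc (card X) choose 2) *
        (\<Sum>h'\<in>bounded_cells R C f c (Q' X). b ^ cell_pairs R C f h' (Q' X)))"
    proof -
      have "sum w T = (\<Sum>l\<in>C. \<Sum>y\<in>(SIGMA X:Xs. bounded_cells R C f c (Q' X)). w (l, y))"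
        unfolding T_def using fC finXs finQ
        by (subst sum.Sigma) (auto intro!: finite_SigmaI finite_bounded_cells simp: Q'_def)
      also have "\<dots> = (\<Sum>l\<in>C. \<Sum>X\<in>Xs. \<Sum>h'\<in>bounded_cells R C f c (Q' X). w (l, X, h'))"
        using fC finXs finQ
        by (intro sum.cong refl) (subst sum.Sigma, auto intro!: finite_bounded_cells simp: Q'_def)
      finally show ?thesis by (simp add: w_def sum_distrib_left)
    qed
    also have "\<dots> \<le> (\<Sum>l\<in>C. \<Sum>X\<in>Xs. b ^ (Suc (card X) choose 2) * (K ^ (card Q - 1) / K ^ card X))"
    proof (intro sum_mono mult_left_mono)
      fix l X assume X: "X \<in> Xs"
      then have XQ: "X \<subseteq> Q - {v}" by (auto simp: Xs_def Y_def)
      have sub: "Q' X \<subset> Q" using v by (auto simp: Q'_def)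
      have "card (insert v X) \<le> card Q" using XQ v finQ by (intro card_mono) auto
      moreover have "card (insert v X) = Suc (card X)"
        using XQ finQ by (subst card_insert_disjoint) (auto intro: finite_subset)
      ultimately have le: "Suc (card X) \<le> card Q" by simp
      have cQ: "card (Q' X) = card Q - Suc (card X)"
        unfolding Q'_def using XQ v finQ \<open>card (insert v X) = Suc (card X)\<close>
        by (subst card_Diff_subset) (auto intro: finite_subset)
      have "(\<Sum>h'\<in>bounded_cells R C f c (Q' X). b ^ cell_pairs R C f h' (Q' X)) \<le> K ^ card (Q' X)"
      proof (rule psubset.IH[OF sub])
        show "f ` Q' X \<subseteq> R" using psubset.prems sub by auto
        show "card {v \<in> Q' X. f v = i} \<le> j" for i
          using sub finQ by (intro order_trans[OF card_mono psubset.prems(2)[of i]]) auto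
      qed
      also have "K ^ card (Q' X) = K ^ (card Q - 1) / K ^ card X"
        using K le unfolding cQ by (simp add: power_diff[symmetric])
      finally show "(\<Sum>h'\<in>bounded_cells R C f c (Q' X). b ^ cell_pairs R C f h' (Q' X))
          \<le> K ^ (card Q - 1) / K ^ card X" .
    qed (use b in auto)
    \<comment> \<open>The induction hypothesis accounts for \<open>v\<close> and its cell mates with
      \<open>Suc (card X)\<close> factors \<open>K\<close> too few. The assumption
      \<open>cond\<close> says precisely that the sum over the label of \<open>v\<close> and the set
      \<open>X\<close> of its mates makes up for them.\<close>
    also have "\<dots> = K ^ (card Q - 1) * (real (card C) * (\<Sum>X\<in>Xs. b ^ (Suc (card X) choose 2) / K ^ card X))"
      by (simp add: sum_distrib_left mult_ac)
    also have "\<dots> \<le> K ^ (card Q - 1) * (real (card C) * (\<Sum>x<c. real (j choose x) * (b ^ (Suc x choose 2) / K ^ x)))"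
    proof (intro mult_left_mono)
      have "card Y \<le> j"
        unfolding Y_def using finQ
        by (intro order_trans[OF card_mono psubset.prems(2)[of "f v"]]) auto
      then show "(\<Sum>X\<in>Xs. b ^ (Suc (card X) choose 2) / K ^ card X)
          \<le> (\<Sum>x<c. real (j choose x) * (b ^ (Suc x choose 2) / K ^ x))"
        unfolding Xs_def using b K finY
        by (intro sum_small_subsets_le[where \<phi> = "\<lambda>x. b ^ (Suc x choose 2) / K ^ x"]) auto
    qed (use K in auto)
    also have "\<dots> \<le> K ^ (card Q - 1) * K"
      using cond K by (intro mult_left_mono) auto
    also have "\<dots> = K ^ card Q"
      using False finQ by (simp add: power_eq_if card_gt_0_iff)
    finally show ?thesis .
  qed
qed

text \<open>The sum over all colourings \<^term>\<open>g\<close> whose large cells are exactly the cells \<open>(i, \<tau> i)\<close>.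
  Such a \<^term>\<open>g\<close> is determined by the parts \<open>D i\<close> lost and \<open>E i\<close> gained by the matched classes
  and by its restriction to the vertices \<open>Q\<close> in unmatched classes.\<close>
lemma matched_cell_sum:
  fixes b K :: real and f :: "'a \<Rightarrow> nat"
  defines "FF V k j \<equiv> fibre_functions V {..<k} (\<lambda>_. j)"
  assumes finV: "finite V" and b: "b \<ge> 1" and K: "K > 0"
    and f: "f \<in> FF V k j" and I: "I \<subseteq> {..<k}" and tau: "\<tau> \<in> I \<rightarrow>\<^sub>E {..<k}" "inj_on \<tau> I"
    and t: "t = k - card I"
    and cond: "real t * (\<Sum>x<2 * j div 3. real (j choose x) * (b ^ (Suc x choose 2) / K ^ x)) \<le> K"
  shows "(\<Sum>g | g \<in> FF V k j \<and> (\<forall>i\<in>I. 2 * j < 3 * card {v\<in>V. f v = i \<and> g v = \<tau> i}) \<and>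
            (\<forall>i<k. \<forall>l<k. \<not> (i \<in> I \<and> l = \<tau> i) \<longrightarrow> 3 * card {v\<in>V. f v = i \<and> g v = l} \<le> 2 * j).
          b ^ cell_pairs {..<k} {..<k} f g V)
     \<le> K ^ (t * j) * (\<Sum>D\<in>Pi\<^sub>E I (\<lambda>i. {D. D \<subseteq> {v\<in>V. f v = i} \<and> 3 * card D < j}).
          (\<Prod>i\<in>I. b ^ ((j - card (D i) choose 2) + (card (D i) choose 2)))
            * real (t * j + (\<Sum>i\<in>I. card (D i))) ^ (\<Sum>i\<in>I. card (D i)))"
    (is "sum _ ?G \<le> _")
proof -
  define R where "R i = {v\<in>V. f v = i}" for i
  define S where "S g l = {v\<in>V. g v = l}" for g :: "'a \<Rightarrow> nat" and l
  define Cu where "Cu = {..<k} - \<tau> ` I"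
  define Ds where "Ds = Pi\<^sub>E I (\<lambda>i. {D. D \<subseteq> R i \<and> 3 * card D < j})"
  define \<Delta> where "\<Delta> D = V - (\<Union>i\<in>I. R i - D i)" for D :: "nat \<Rightarrow> 'a set"
  define Q where "Q D E = V - (\<Union>i\<in>I. (R i - D i) \<union> E i)" for D E :: "nat \<Rightarrow> 'a set"
  \<comment> \<open>Lost and gained parts have equal size since all classes have size
    \<open>j\<close>, and gained vertices lie in \<open>\<Delta> D\<close> because the large cells
    keep their vertices. Disjointness of the \<open>E i\<close> is recorded only through the size of
    \<open>Q D E\<close>, which makes \<open>K ^ (t * j)\<close> a bound for the remaining sum
    whatever \<open>D\<close> and \<open>E\<close> are.\<close>
  define Es where "Es D = {E \<in> Pi\<^sub>E I (\<lambda>i. {E. E \<subseteq> \<Delta> D \<and> card E = card (D i)}). card (Q D E) = t * j}" for D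
  define Hs where "Hs = bounded_cells {..<k} Cu f (2 * j div 3)"
  define T where "T = (SIGMA D:Ds. SIGMA E:Es D. Hs (Q D E))"
  define dD where "dD g = (\<lambda>i\<in>I. R i - S g (\<tau> i))" for g
  define dE where "dE g = (\<lambda>i\<in>I. S g (\<tau> i) - R i)" for g
  define \<Phi> where "\<Phi> g = (dD g, dE g, restrict g (Q (dD g) (dE g)))" for g
  define p where "p D = (\<Prod>i\<in>I. b ^ ((j - card (D i) choose 2) + (card (D i) choose 2)))" for D :: "nat \<Rightarrow> 'a set"
  define w where "w = (\<lambda>(D, E, h). p D * b ^ cell_pairs {..<k} Cu f h (Q D E))"
  have finI: "finite I" using I finite_subset by blast
  have tauI: "\<tau> i < k" if "i \<in> I" for i using tau that by auto
  have finCu: "finite Cu" by (simp add: Cu_def)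
  have cCu: "card Cu = t"
  proof -
    have "card (\<tau> ` I) = card I" by (rule card_image[OF tau(2)])
    then show ?thesis unfolding Cu_def t using tauI finI by (subst card_Diff_subset) auto
  qed
  have fk: "f v < k" if "v \<in> V" for v using f that by (auto simp: FF_def fibre_functions_def)
  have cR: "card (R i) = j" if "i < k" for i using f that by (simp add: FF_def fibre_functions_def R_def)
  have finR: "finite (R i)" for i using finV by (simp add: R_def)
  have finS: "finite (S g i)" for g i using finV by (simp add: S_def)
  have cV: "card V = k * j"
  proof -
    have "V = (\<Union>i<k. R i)" using fk by (auto simp: R_def)
    also have "card \<dots> = (\<Sum>i<k. card (R i))" using finR by (intro card_UN_disjoint) (auto simp: R_def)
    finally show ?thesis using cR by simp
  qed
  have p0: "0 \<le> p D" for D using b by (auto simp: p_def intro!: prod_nonneg)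
  have c\<Delta>: "card (\<Delta> D) = t * j + (\<Sum>i\<in>I. card (D i))" if D: "D \<in> Ds" for D
  proof -
    have DR: "D i \<subseteq> R i" "card (D i) \<le> j" if "i \<in> I" for i
      using PiE_mem[OF D[unfolded Ds_def] that] by auto
    have "card (\<Union>i\<in>I. R i - D i) = (\<Sum>i\<in>I. card (R i - D i))"
      using finI finR by (intro card_UN_disjoint) (auto simp: R_def)
    also have "\<dots> = (\<Sum>i\<in>I. j - card (D i))"
    proof (intro sum.cong refl)
      fix i assume i: "i \<in> I"
      then have "i < k" using I by auto
      then show "card (R i - D i) = j - card (D i)"
        using card_Diff_subset[OF finite_subset[OF DR(1)[OF i] finR] DR(1)[OF i]] cR by simp
    qed
    finally have 1: "card (\<Union>i\<in>I. R i - D i) = (\<Sum>i\<in>I. j - card (D i))" .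
    have "(\<Sum>i\<in>I. j - card (D i)) + (\<Sum>i\<in>I. card (D i)) = (\<Sum>i\<in>I. j)"
      unfolding sum.distrib[symmetric] using DR by (intro sum.cong) auto
    then have 2: "(\<Sum>i\<in>I. j - card (D i)) + (\<Sum>i\<in>I. card (D i)) = card I * j" by simp
    have "card (\<Delta> D) = k * j - card (\<Union>i\<in>I. R i - D i)"
      unfolding \<Delta>_def using finI finR cV by (subst card_Diff_subset) (auto simp: R_def)
    moreover have "card I \<le> k" using card_mono[OF _ I] by simp
    then have "t * j + card I * j = k * j" unfolding t by (simp add: algebra_simps)
    ultimately show ?thesis using 1 2 by linarith
  qed
  have Qg: "Q (dD g) (dE g) = {v\<in>V. g v \<in> Cu}" if "g \<in> ?G" for g
  proof -
    have "(\<Union>i\<in>I. (R i - dD g i) \<union> dE g i) = (\<Union>i\<in>I. S g (\<tau> i))"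
      by (auto simp: dD_def dE_def R_def S_def)
    moreover have "g v < k" if "v \<in> V" for v
      using \<open>g \<in> ?G\<close> that by (auto simp: FF_def fibre_functions_def)
    ultimately show ?thesis by (auto simp: Q_def S_def Cu_def)
  qed
  have cS: "card (S g l) = j" if "g \<in> ?G" "l < k" for g l
    using that by (simp add: S_def FF_def fibre_functions_def)
  have cell: "card (R i \<inter> S g l) = card {v\<in>V. f v = i \<and> g v = l}" for i l g
    by (rule arg_cong[of _ _ card]) (auto simp: R_def S_def)
  have cD: "card (dD g i) = j - card (R i \<inter> S g (\<tau> i))" and cE: "card (dE g i) = j - card (R i \<inter> S g (\<tau> i))"
    if "g \<in> ?G" "i \<in> I" for g i
  proof -
    have "dD g i = R i - R i \<inter> S g (\<tau> i)" "dE g i = S g (\<tau> i) - R i \<inter> S g (\<tau> i)"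
      using that by (auto simp: dD_def dE_def)
    then show "card (dD g i) = j - card (R i \<inter> S g (\<tau> i))" "card (dE g i) = j - card (R i \<inter> S g (\<tau> i))"
      using that I tauI[of i] cR[of i] cS[of g "\<tau> i"] finR finS by (auto simp: card_Diff_subset)
  qed
  have big: "2 * j < 3 * card (R i \<inter> S g (\<tau> i))" if "g \<in> ?G" "i \<in> I" for g i
    using that cell by auto
  have cell_le: "card (R i \<inter> S g (\<tau> i)) \<le> j" if "i \<in> I" for g i
    using card_mono[of "R i" "R i \<inter> S g (\<tau> i)"] finR cR[of i] I that by auto
  have into: "\<Phi> ` ?G \<subseteq> T"
  proof (rule image_subsetI)
    fix g assume g: "g \<in> ?G"
    have 1: "dD g \<in> Ds"
      unfolding Ds_def
    proof (rule PiE_I)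
      fix i assume i: "i \<in> I"
      have "3 * card (dD g i) < j" using big[OF g i] cD[OF g i] cell_le[OF i, of g] by linarith
      then show "dD g i \<in> {D. D \<subseteq> R i \<and> 3 * card D < j}" using i by (auto simp: dD_def)
    qed (simp add: dD_def)
    have "dE g i \<subseteq> \<Delta> (dD g)" if i: "i \<in> I" for i
    proof -
      have "v \<notin> R i' - dD g i'" if "v \<in> dE g i" "i' \<in> I" for v i'
        using that i inj_onD[OF tau(2), of i i'] by (auto simp: dE_def dD_def S_def)
      then show ?thesis using i by (auto simp: \<Delta>_def dE_def S_def)
    qed
    moreover have "card (dE g i) = card (dD g i)" if "i \<in> I" for i
      using cD[OF g that] cE[OF g that] by simp
    moreover have "card (Q (dD g) (dE g)) = t * j"
    proof -
      have "Q (dD g) (dE g) = (\<Union>l\<in>Cu. S g l)" using Qg[OF g] by (auto simp: S_def)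
      also have "card \<dots> = (\<Sum>l\<in>Cu. card (S g l))"
        using finCu finS by (intro card_UN_disjoint) (auto simp: S_def)
      also have "\<dots> = (\<Sum>l\<in>Cu. j)" using cS[OF g] by (intro sum.cong) (auto simp: Cu_def)
      finally show ?thesis using cCu by simp
    qed
    ultimately have 2: "dE g \<in> Es (dD g)"
      by (auto simp: Es_def dE_def)
    have 3: "restrict g (Q (dD g) (dE g)) \<in> Hs (Q (dD g) (dE g))"
      unfolding Hs_def bounded_cells_def
    proof (intro CollectI conjI ballI)
      show "restrict g (Q (dD g) (dE g)) \<in> Q (dD g) (dE g) \<rightarrow>\<^sub>E Cu"
        unfolding Qg[OF g] by auto
      fix i l assume il: "i \<in> {..<k}" "l \<in> Cu"
      have "{v \<in> Q (dD g) (dE g). f v = i \<and> restrict g (Q (dD g) (dE g)) v = l} = {v\<in>V. f v = i \<and> g v = l}"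
        unfolding Qg[OF g] using il by auto
      moreover have "3 * card {v\<in>V. f v = i \<and> g v = l} \<le> 2 * j"
        using g il by (auto simp: Cu_def)
      ultimately show "card {v \<in> Q (dD g) (dE g). f v = i \<and> restrict g (Q (dD g) (dE g)) v = l} \<le> 2 * j div 3"
        by (simp only:)
    qed
    show "\<Phi> g \<in> T" using 1 2 3 by (simp add: T_def \<Phi>_def)
  qed
  have inj: "inj_on \<Phi> ?G"
  proof (rule inj_onI)
    fix g h assume g: "g \<in> ?G" and h: "h \<in> ?G" and eq: "\<Phi> g = \<Phi> h"
    have e: "dD g = dD h" "dE g = dE h" "restrict g (Q (dD g) (dE g)) = restrict h (Q (dD g) (dE g))"
      using eq by (auto simp: \<Phi>_def)
    have Seq: "S g (\<tau> i) = S h (\<tau> i)" if "i \<in> I" for i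
    proof -
      have "S g' (\<tau> i) = (R i - dD g' i) \<union> dE g' i" for g'
        using that by (auto simp: dD_def dE_def R_def S_def)
      then show ?thesis using e by simp
    qed
    show "g = h"
    proof
      fix v
      consider "v \<notin> V" | i where "v \<in> V" "i \<in> I" "g v = \<tau> i" | "v \<in> V" "g v \<in> Cu"
        using g by (fastforce simp: Cu_def FF_def fibre_functions_def)
      then show "g v = h v"
      proof cases
        case 1 then show ?thesis using g h by (auto simp: FF_def fibre_functions_def PiE_iff extensional_def)
      next
        case (2 i) then have "v \<in> S h (\<tau> i)" using Seq[of i] by (auto simp: S_def)
        then show ?thesis using 2 by (simp add: S_def)
      next
        case 3 then show ?thesis using fun_cong[OF e(3), of v] Qg[OF g] by simp
      qed
    qed
  qed
  have weight: "b ^ cell_pairs {..<k} {..<k} f g V \<le> w (\<Phi> g)" if g: "g \<in> ?G" for g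
  proof -
    let ?x = "\<lambda>l i. card {v\<in>V. f v = i \<and> g v = l}"
    have split: "cell_pairs {..<k} {..<k} f g V
        = (\<Sum>l\<in>\<tau> ` I. \<Sum>i<k. ?x l i choose 2) + (\<Sum>l\<in>Cu. \<Sum>i<k. ?x l i choose 2)"
      unfolding cell_pairs_def Cu_def using tauI by (subst sum.subset_diff[of "\<tau> ` I"]) auto
    have 1: "(\<Sum>l\<in>\<tau> ` I. \<Sum>i<k. ?x l i choose 2)
        \<le> (\<Sum>i\<in>I. (j - card (dD g i) choose 2) + (card (dD g i) choose 2))"
    proof -
      \<comment> \<open>A matched class of \<open>g\<close> is its large cell together with the
        gained vertices; the latter share the most pairs if they all come from one class of
        \<open>f\<close>.\<close>
      have "(\<Sum>i'<k. ?x (\<tau> i) i' choose 2) \<le> (j - card (dD g i) choose 2) + (card (dD g i) choose 2)"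
        if i: "i \<in> I" for i
      proof -
        have ik: "i < k" using I i by auto
        have "(\<Sum>i'<k. ?x (\<tau> i) i' choose 2)
            = (?x (\<tau> i) i choose 2) + (\<Sum>i'\<in>{..<k} - {i}. ?x (\<tau> i) i' choose 2)"
          using ik by (intro sum.remove) auto
        also have "\<dots> \<le> (?x (\<tau> i) i choose 2) + ((\<Sum>i'\<in>{..<k} - {i}. ?x (\<tau> i) i') choose 2)"
          by (intro add_left_mono sum_choose_two_le) auto
        also have "(\<Sum>i'\<in>{..<k} - {i}. ?x (\<tau> i) i') = card (dD g i)"
        proof -
          have "dE g i = (\<Union>i'\<in>{..<k} - {i}. {v\<in>V. f v = i' \<and> g v = \<tau> i})"
            using i fk by (auto simp: dE_def R_def S_def)
          also have "card \<dots> = (\<Sum>i'\<in>{..<k} - {i}. ?x (\<tau> i) i')"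
            using finV by (intro card_UN_disjoint) auto
          finally show ?thesis using cD[OF g i] cE[OF g i] by simp
        qed
        also have "?x (\<tau> i) i = j - card (dD g i)"
          using cD[OF g i] cell_le[OF i, of g] cell[of i g "\<tau> i"] by linarith
        finally show ?thesis .
      qed
      then show ?thesis by (subst sum.reindex[OF tau(2)]) (auto intro: sum_mono)
    qed
    have 2: "(\<Sum>l\<in>Cu. \<Sum>i<k. ?x l i choose 2)
        = cell_pairs {..<k} Cu f (restrict g (Q (dD g) (dE g))) (Q (dD g) (dE g))"
      unfolding cell_pairs_def
    proof (intro sum.cong refl)
      fix l i assume l: "l \<in> Cu"
      have "{v \<in> Q (dD g) (dE g). f v = i \<and> restrict g (Q (dD g) (dE g)) v = l} = {v\<in>V. f v = i \<and> g v = l}"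
        unfolding Qg[OF g] using l by auto
      then show "?x l i choose 2 = card {v \<in> Q (dD g) (dE g). f v = i \<and> restrict g (Q (dD g) (dE g)) v = l} choose 2"
        by (simp only:)
    qed
    have "b ^ cell_pairs {..<k} {..<k} f g V
        \<le> b ^ ((\<Sum>i\<in>I. (j - card (dD g i) choose 2) + (card (dD g i) choose 2))
          + cell_pairs {..<k} Cu f (restrict g (Q (dD g) (dE g))) (Q (dD g) (dE g)))"
      using b split 1 2 by (intro power_increasing) auto
    also have "\<dots> = w (\<Phi> g)"
      by (simp only: w_def \<Phi>_def p_def prod.case power_add power_sum)
    finally show ?thesis .
  qed
  have finDs: "finite Ds"
    unfolding Ds_def using finI finR by (intro finite_PiE) auto
  have finEs: "finite (Es D)" for D
  proof -
    have "finite (\<Delta> D)" using finV by (simp add: \<Delta>_def)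
    then have "finite (Pi\<^sub>E I (\<lambda>i. {E. E \<subseteq> \<Delta> D \<and> card E = card (D i)}))"
      using finI by (intro finite_PiE) auto
    then show ?thesis by (simp add: Es_def)
  qed
  have finHs: "finite (Hs (Q D E))" for D E
    unfolding Hs_def using finCu finV by (intro finite_bounded_cells) (auto simp: Q_def)
  have finT: "finite T" unfolding T_def using finDs finEs finHs by (intro finite_SigmaI)
  have cEs: "real (card (Es D)) \<le> real (t * j + (\<Sum>i\<in>I. card (D i))) ^ (\<Sum>i\<in>I. card (D i))"
    if "D \<in> Ds" for D
  proof -
    have fin\<Delta>: "finite (\<Delta> D)" using finV by (simp add: \<Delta>_def)
    then have "card (Es D) \<le> card (Pi\<^sub>E I (\<lambda>i. {E. E \<subseteq> \<Delta> D \<and> card E = card (D i)}))"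
      unfolding Es_def using finI by (intro card_mono finite_PiE) auto
    also have "\<dots> = (\<Prod>i\<in>I. card (\<Delta> D) choose card (D i))"
      using finI fin\<Delta> by (simp add: card_PiE n_subsets)
    also have "\<dots> \<le> (\<Prod>i\<in>I. card (\<Delta> D) ^ card (D i))"
    proof (intro prod_mono conjI)
      fix i
      show "card (\<Delta> D) choose card (D i) \<le> card (\<Delta> D) ^ card (D i)"
        by (cases "card (D i) \<le> card (\<Delta> D)") (auto intro: binomial_le_pow simp: binomial_eq_0)
    qed auto
    also have "\<dots> = card (\<Delta> D) ^ (\<Sum>i\<in>I. card (D i))" by (simp add: power_sum)
    finally show ?thesis unfolding c\<Delta>[OF that] by (metis of_nat_le_iff of_nat_power)
  qed
  have "(\<Sum>g\<in>?G. b ^ cell_pairs {..<k} {..<k} f g V) \<le> (\<Sum>g\<in>?G. w (\<Phi> g))"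
    by (rule sum_mono[OF weight])
  also have "\<dots> = sum w (\<Phi> ` ?G)" by (simp only: sum.reindex[OF inj] comp_def)
  also have "\<dots> \<le> sum w T"
    using into finT b p0 by (intro sum_mono2) (auto simp: w_def)
  also have "\<dots> = (\<Sum>D\<in>Ds. \<Sum>E\<in>Es D. p D * (\<Sum>h\<in>Hs (Q D E). b ^ cell_pairs {..<k} Cu f h (Q D E)))"
  proof -
    have "sum w T = (\<Sum>D\<in>Ds. \<Sum>y\<in>(SIGMA E:Es D. Hs (Q D E)). w (D, y))"
      unfolding T_def using finDs finEs finHs by (subst sum.Sigma) auto
    also have "\<dots> = (\<Sum>D\<in>Ds. \<Sum>E\<in>Es D. \<Sum>h\<in>Hs (Q D E). w (D, E, h))"
      using finEs finHs by (intro sum.cong refl) (subst sum.Sigma, auto)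
    finally show ?thesis by (simp add: w_def sum_distrib_left)
  qed
  also have "\<dots> \<le> (\<Sum>D\<in>Ds. \<Sum>E\<in>Es D. p D * K ^ (t * j))"
  proof (intro sum_mono mult_left_mono p0)
    fix D E assume "D \<in> Ds" and E: "E \<in> Es D"
    have QV: "Q D E \<subseteq> V" by (auto simp: Q_def)
    have "(\<Sum>h\<in>Hs (Q D E). b ^ cell_pairs {..<k} Cu f h (Q D E)) \<le> K ^ card (Q D E)"
      unfolding Hs_def
    proof (rule bounded_cell_sum[where j = j])
      show "finite (Q D E)" using QV finV finite_subset by blast
      show "f ` Q D E \<subseteq> {..<k}" using QV fk by auto
      fix i
      have "card {v \<in> Q D E. f v = i} \<le> card (R i)"
        using QV finR by (intro card_mono) (auto simp: R_def)
      also have "\<dots> \<le> j"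
      proof (cases "i < k")
        case False then have "R i = {}" using fk by (auto simp: R_def)
        then show ?thesis by simp
      qed (simp add: cR)
      finally show "card {v \<in> Q D E. f v = i} \<le> j" .
    qed (use finCu b K cond cCu in auto)
    then show "(\<Sum>h\<in>Hs (Q D E). b ^ cell_pairs {..<k} Cu f h (Q D E)) \<le> K ^ (t * j)"
      using E by (simp add: Es_def)
  qed
  also have "\<dots> = K ^ (t * j) * (\<Sum>D\<in>Ds. p D * real (card (Es D)))"
    by (simp add: sum_distrib_left mult_ac)
  also have "\<dots> \<le> K ^ (t * j) * (\<Sum>D\<in>Ds. p D * real (t * j + (\<Sum>i\<in>I. card (D i))) ^ (\<Sum>i\<in>I. card (D i)))"
    using K p0 cEs by (intro mult_left_mono sum_mono) auto
  finally show ?thesis unfolding Ds_def p_def R_def .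
qed

text \<open>By \<open>choose_two_diff\<close>, a matched class that exchanges \<open>u\<close>
  vertices loses at least \<open>u * (j - u)\<close> of its \<open>j choose 2\<close> shared pairs.
  Here \<open>z\<close> stands for the number of places from which each exchanged vertex may be
  replaced; the undisturbed case \<open>u = 0\<close> is split off as a summand 1.\<close>

definition defect_sum :: "real \<Rightarrow> nat \<Rightarrow> real \<Rightarrow> real" where
  "defect_sum b j z = (\<Sum>u | 1 \<le> u \<and> 3 * u < j. real (j choose u) * (z ^ u / b ^ (u * (j - u))))"

lemma choose_two_diff:
  assumes "u \<le> (j::nat)"
  shows "(j - u choose 2) + (u choose 2) + u * (j - u) = j choose 2"
  using choose_two_add[of "j - u" u] assms by simp

lemma defect_sum_nonneg: "b \<ge> 1 \<Longrightarrow> z \<ge> 0 \<Longrightarrow> 0 \<le> defect_sum b j z"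
  unfolding defect_sum_def by (intro sum_nonneg) auto

lemma sum_defects_le:
  fixes b z :: real
  assumes b: "b \<ge> 1" and z: "z \<ge> 0" and "finite I" "card I \<le> k"
    and R: "\<And>i. i \<in> I \<Longrightarrow> finite (R i) \<and> card (R i) = j" and "j > 0"
  shows "(\<Sum>D\<in>Pi\<^sub>E I (\<lambda>i. {D. D \<subseteq> R i \<and> 3 * card D < j}).
            \<Prod>i\<in>I. z ^ card (D i) / b ^ (card (D i) * (j - card (D i))))
         \<le> exp (real k * defect_sum b j z)"
proof -
  let ?\<phi> = "\<lambda>u. z ^ u / b ^ (u * (j - u))"
  have row: "(\<Sum>D | D \<subseteq> R i \<and> 3 * card D < j. ?\<phi> (card D)) \<le> 1 + defect_sum b j z" if "i \<in> I" for i
  proof -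
    let ?c = "(j + 2) div 3"
    have c: "3 * x < j \<longleftrightarrow> x < ?c" for x by linarith
    have "(\<Sum>D | D \<subseteq> R i \<and> 3 * card D < j. ?\<phi> (card D)) \<le> (\<Sum>u<?c. real (j choose u) * ?\<phi> u)"
      unfolding c using R[OF that] b z by (intro sum_small_subsets_le[where \<phi> = ?\<phi>]) auto
    also have "{..<?c} = insert 0 {u. 1 \<le> u \<and> 3 * u < j}" using \<open>j > 0\<close> by (auto simp: c)
    also have "(\<Sum>u\<in>\<dots>. real (j choose u) * ?\<phi> u) = 1 + defect_sum b j z"
    proof -
      have "finite {u. 1 \<le> u \<and> 3 * u < j}" by (rule finite_subset[of _ "{..j}"]) auto
      then show ?thesis unfolding defect_sum_def by simp
    qed
    finally show ?thesis .
  qed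
  have "(\<Sum>D\<in>Pi\<^sub>E I (\<lambda>i. {D. D \<subseteq> R i \<and> 3 * card D < j}). \<Prod>i\<in>I. ?\<phi> (card (D i)))
      = (\<Prod>i\<in>I. \<Sum>D | D \<subseteq> R i \<and> 3 * card D < j. ?\<phi> (card D))"
    using assms by (intro prod_sum_PiE[symmetric]) auto
  also have "\<dots> \<le> (\<Prod>i\<in>I. 1 + defect_sum b j z)"
    using row b z by (intro prod_mono conjI sum_nonneg) auto
  also have "\<dots> \<le> (\<Prod>i\<in>I. exp (defect_sum b j z))"
    using defect_sum_nonneg[OF b z, of j] by (intro prod_mono) (auto intro: exp_ge_add_one_self)
  also have "\<dots> = exp (real (card I) * defect_sum b j z)" by (simp add: exp_of_nat_mult)
  also have "\<dots> \<le> exp (real k * defect_sum b j z)"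
    using assms defect_sum_nonneg[OF b z, of j] by (auto intro: mult_right_mono)
  finally show ?thesis .
qed

text \<open>With \<open>v\<close> the total number of exchanged vertices,
  \<open>(t * j + v) ^ v\<close> does not factorise over the classes. If
  \<open>t * j + v \<le> W\<close> it is at most \<open>W ^ v\<close>; otherwise it is at most
  \<open>(k * j) ^ v * y ^ (t * j + v) / y ^ W\<close>, the inserted power of \<open>y\<close> being
  at least 1. Both bounds are products over the classes. Later \<open>W = j ^ 4\<close>: the first
  sum is then bounded, and in the second \<open>y ^ W\<close> beats the exponential.\<close>

lemma sum_defects_weighted_le:
  fixes b y :: real
  assumes b: "b \<ge> 1" and y: "y \<ge> 1" and finI: "finite I" and t: "t + card I = k"
    and R: "\<And>i. i \<in> I \<Longrightarrow> finite (R i) \<and> card (R i) = j" and j: "j > 0"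
  shows "(\<Sum>D\<in>Pi\<^sub>E I (\<lambda>i. {D. D \<subseteq> R i \<and> 3 * card D < j}).
           (\<Prod>i\<in>I. b ^ ((j - card (D i) choose 2) + (card (D i) choose 2)))
             * real (t * j + (\<Sum>i\<in>I. card (D i))) ^ (\<Sum>i\<in>I. card (D i)))
         \<le> b ^ ((k - t) * (j choose 2)) * (exp (real k * defect_sum b j (real W))
             + y ^ (t * j) / y ^ W * exp (real k * defect_sum b j (y * real (k * j))))"
proof -
  let ?Ds = "Pi\<^sub>E I (\<lambda>i. {D. D \<subseteq> R i \<and> 3 * card D < j})"
  let ?u = "\<lambda>D i. card (D i) :: nat"
  let ?q = "\<lambda>z D. \<Prod>i\<in>I. z ^ ?u D i / b ^ (?u D i * (j - ?u D i))"
  have summand: "(\<Prod>i\<in>I. b ^ ((j - ?u D i choose 2) + (?u D i choose 2)))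
        * real (t * j + (\<Sum>i\<in>I. ?u D i)) ^ (\<Sum>i\<in>I. ?u D i)
      \<le> b ^ ((k - t) * (j choose 2)) * (?q (real W) D + y ^ (t * j) / y ^ W * ?q (y * real (k * j)) D)"
    if D: "D \<in> ?Ds" for D
  proof -
    define v where "v = (\<Sum>i\<in>I. ?u D i)"
    have uj: "?u D i \<le> j" if "i \<in> I" for i using PiE_mem[OF D that] by auto
    have pr: "(\<Prod>i\<in>I. b ^ ((j - ?u D i choose 2) + (?u D i choose 2)))
        = b ^ ((k - t) * (j choose 2)) * (\<Prod>i\<in>I. 1 / b ^ (?u D i * (j - ?u D i)))"
    proof -
      have "b ^ ((j - ?u D i choose 2) + (?u D i choose 2)) = b ^ (j choose 2) * (1 / b ^ (?u D i * (j - ?u D i)))"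
        if "i \<in> I" for i
        using choose_two_diff[OF uj[OF that]] b by (simp add: power_add[symmetric] field_simps)
      then have "(\<Prod>i\<in>I. b ^ ((j - ?u D i choose 2) + (?u D i choose 2)))
          = (\<Prod>i\<in>I. b ^ (j choose 2) * (1 / b ^ (?u D i * (j - ?u D i))))" by (intro prod.cong) auto
      also have "\<dots> = b ^ ((j choose 2) * card I) * (\<Prod>i\<in>I. 1 / b ^ (?u D i * (j - ?u D i)))"
        by (simp only: prod.distrib prod_constant power_mult)
      moreover have "card I = k - t" using t by simp
      ultimately show ?thesis by (simp only: mult.commute[of "j choose 2"])
    qed
    have zq: "z ^ v * (\<Prod>i\<in>I. 1 / b ^ (?u D i * (j - ?u D i))) = ?q z D" for z :: real
      unfolding v_def power_sum prod.distrib[symmetric] by simp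
    have "v \<le> (\<Sum>i\<in>I. j)" unfolding v_def using uj by (rule sum_mono)
    then have "t * j + v \<le> (t + card I) * j" by (simp add: algebra_simps)
    then have n: "t * j + v \<le> k * j" unfolding t .
    have "real (t * j + v) ^ v \<le> real W ^ v + y ^ (t * j) / y ^ W * (y * real (k * j)) ^ v"
    proof (cases "t * j + v \<le> W")
      case True
      then have "real (t * j + v) ^ v \<le> real W ^ v" by (intro power_mono of_nat_mono) auto
      moreover have "0 \<le> y ^ (t * j) / y ^ W * (y * real (k * j)) ^ v" using y by auto
      ultimately show ?thesis by linarith
    next
      case False
      have "y ^ W \<le> y ^ (t * j + v)" using False y by (intro power_increasing) auto
      then have "1 \<le> y ^ (t * j + v) / y ^ W" using y by simp
      then have "real (k * j) ^ v * 1 \<le> real (k * j) ^ v * (y ^ (t * j + v) / y ^ W)"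
        by (intro mult_left_mono) auto
      moreover have "real (t * j + v) ^ v \<le> real (k * j) ^ v" using n by (intro power_mono of_nat_mono) auto
      moreover have "real (k * j) ^ v * (y ^ (t * j + v) / y ^ W) = y ^ (t * j) / y ^ W * (y * real (k * j)) ^ v"
        by (simp add: power_add power_mult_distrib)
      moreover have "0 \<le> real W ^ v" by simp
      ultimately show ?thesis by linarith
    qed
    then have "(\<Prod>i\<in>I. 1 / b ^ (?u D i * (j - ?u D i))) * real (t * j + v) ^ v
        \<le> (\<Prod>i\<in>I. 1 / b ^ (?u D i * (j - ?u D i))) * (real W ^ v + y ^ (t * j) / y ^ W * (y * real (k * j)) ^ v)"
      using b by (intro mult_left_mono prod_nonneg) auto
    also have "\<dots> = real W ^ v * (\<Prod>i\<in>I. 1 / b ^ (?u D i * (j - ?u D i)))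
        + y ^ (t * j) / y ^ W * ((y * real (k * j)) ^ v * (\<Prod>i\<in>I. 1 / b ^ (?u D i * (j - ?u D i))))"
      by (simp add: algebra_simps)
    also have "\<dots> = ?q (real W) D + y ^ (t * j) / y ^ W * ?q (y * real (k * j)) D"
      by (simp only: zq)
    finally have *: "b ^ ((k - t) * (j choose 2)) * ((\<Prod>i\<in>I. 1 / b ^ (?u D i * (j - ?u D i))) * real (t * j + v) ^ v)
        \<le> b ^ ((k - t) * (j choose 2)) * (?q (real W) D + y ^ (t * j) / y ^ W * ?q (y * real (k * j)) D)"
      using b by (intro mult_left_mono) auto
    then show ?thesis unfolding pr v_def[symmetric] by (simp only: mult.assoc)
  qed
  have ck: "card I \<le> k" using t by simp
  have y0: "0 \<le> y * real (k * j)" using y by simp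
  have "(\<Sum>D\<in>?Ds. (\<Prod>i\<in>I. b ^ ((j - ?u D i choose 2) + (?u D i choose 2)))
        * real (t * j + (\<Sum>i\<in>I. ?u D i)) ^ (\<Sum>i\<in>I. ?u D i))
      \<le> (\<Sum>D\<in>?Ds. b ^ ((k - t) * (j choose 2)) * (?q (real W) D + y ^ (t * j) / y ^ W * ?q (y * real (k * j)) D))"
    by (rule sum_mono[OF summand])
  also have "\<dots> = b ^ ((k - t) * (j choose 2)) * ((\<Sum>D\<in>?Ds. ?q (real W) D)
      + y ^ (t * j) / y ^ W * (\<Sum>D\<in>?Ds. ?q (y * real (k * j)) D))"
    by (simp only: sum_distrib_left[symmetric] sum.distrib)
  also have "\<dots> \<le> b ^ ((k - t) * (j choose 2)) * (exp (real k * defect_sum b j (real W))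
             + y ^ (t * j) / y ^ W * exp (real k * defect_sum b j (y * real (k * j))))"
    using b y sum_defects_le[OF b _ finI ck R j, of "real W"] sum_defects_le[OF b y0 finI ck R j]
    by (intro mult_left_mono add_mono) auto
  finally show ?thesis .
qed

text \<open>With threshold \<open>2/3\<close> a row or column contains at most one large cell, and a matched class differs
  from its partner in fewer than \<open>j/3\<close> vertices, few enough for the crude count of these in
  \<open>matched_cell_sum\<close>.\<close>
definition matched_rows :: "'a set \<Rightarrow> nat \<Rightarrow> nat \<Rightarrow> ('a \<Rightarrow> nat) \<Rightarrow> ('a \<Rightarrow> nat) \<Rightarrow> nat set" where
  "matched_rows V k j f g = {i. i < k \<and> (\<exists>l<k. 2 * j < 3 * card {v\<in>V. f v = i \<and> g v = l})}"

text \<open>The predicate \<open>P\<close> is general because the lemma is applied to the classes of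
  \<open>f\<close>, making the partner of a class unique, and to those of \<open>g\<close>, making
  the matching injective.\<close>

lemma large_cell_unique:
  fixes j :: nat
  assumes "finite V" "card {v\<in>V. P v} \<le> j"
    and "2 * j < 3 * card {v\<in>V. P v \<and> g v = l}" "2 * j < 3 * card {v\<in>V. P v \<and> g v = l'}"
  shows "l = l'"
proof (rule ccontr)
  assume "l \<noteq> l'"
  then have "card {v\<in>V. P v \<and> g v = l} + card {v\<in>V. P v \<and> g v = l'}
      = card ({v\<in>V. P v \<and> g v = l} \<union> {v\<in>V. P v \<and> g v = l'})"
    using assms(1) by (intro card_Un_disjoint[symmetric]) auto
  also have "\<dots> \<le> card {v\<in>V. P v}" using assms(1) by (intro card_mono) auto
  finally show False using assms by linarith
qed

text \<open>Each \<open>g\<close> determines the set \<open>I\<close> of its matched rows and an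
  injection \<open>\<tau>\<close> into the columns. For \<open>card I = k - t\<close> there are
  \<open>k choose t\<close> sets and \<open>fact k / fact t\<close> injections, and
  \<open>matched_cell_sum\<close> bounds the contribution of each pair by a quantity depending only
  on \<open>t\<close>.\<close>

lemma many_matched_sum:
  fixes b y :: real and K :: "nat \<Rightarrow> real" and f :: "'a \<Rightarrow> nat"
  defines "FF V k j \<equiv> fibre_functions V {..<k} (\<lambda>_. j)"
  assumes finV: "finite V" and b: "b \<ge> 1" and y: "y \<ge> 1" and j: "j > 0" and t1: "t1 \<le> k"
    and f: "f \<in> FF V k j" and K: "\<And>t. t \<le> t1 \<Longrightarrow> K t > 0"
    and cond: "\<And>t. t \<le> t1 \<Longrightarrow>
       real t * (\<Sum>x<2 * j div 3. real (j choose x) * (b ^ (Suc x choose 2) / K t ^ x)) \<le> K t"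
  shows "(\<Sum>g | g \<in> FF V k j \<and> k - card (matched_rows V k j f g) \<le> t1. b ^ cell_pairs {..<k} {..<k} f g V)
     \<le> (\<Sum>t\<le>t1. real (k choose t) * (fact k / fact t) * (K t ^ (t * j) * (b ^ ((k - t) * (j choose 2)) *
          (exp (real k * defect_sum b j (real W))
             + y ^ (t * j) / y ^ W * exp (real k * defect_sum b j (y * real (k * j)))))))"
    (is "sum ?s ?A \<le> _")
proof -
  define G where "G = (\<lambda>(I, \<tau>). {g. g \<in> FF V k j \<and> (\<forall>i\<in>I. 2 * j < 3 * card {v\<in>V. f v = i \<and> g v = \<tau> i}) \<and>
            (\<forall>i<k. \<forall>l<k. \<not> (i \<in> I \<and> l = \<tau> i) \<longrightarrow> 3 * card {v\<in>V. f v = i \<and> g v = l} \<le> 2 * j)})"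
  define Is where "Is = {I. I \<subseteq> {..<k} \<and> k - card I \<le> t1}"
  define Ts where "Ts I = {\<tau> \<in> I \<rightarrow>\<^sub>E {..<k}. inj_on \<tau> I}" for I :: "nat set"
  define Idx where "Idx = (SIGMA I:Is. Ts I)"
  define \<tau> where "\<tau> g = (\<lambda>i\<in>matched_rows V k j f g. SOME l. l < k \<and> 2 * j < 3 * card {v\<in>V. f v = i \<and> g v = l})" for g
  define \<phi> where "\<phi> g = (matched_rows V k j f g, \<tau> g)" for g
  define B where "B t = K t ^ (t * j) * (b ^ ((k - t) * (j choose 2)) *
          (exp (real k * defect_sum b j (real W))
             + y ^ (t * j) / y ^ W * exp (real k * defect_sum b j (y * real (k * j)))))" for t
  have finFF: "finite (FF V k j)" unfolding FF_def using finV by (simp add: finite_fibre_functions)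
  have finA: "finite ?A" using finFF by simp
  have finIs: "finite Is" by (auto simp: Is_def)
  have finTs: "finite (Ts I)" if "I \<in> Is" for I
  proof -
    have "I \<subseteq> {..<k}" using that by (simp add: Is_def)
    then have "finite (I \<rightarrow>\<^sub>E {..<k})" by (intro finite_PiE) (auto intro: finite_subset)
    then show ?thesis by (simp add: Ts_def)
  qed
  have finIdx: "finite Idx" unfolding Idx_def using finIs finTs by auto
  have cR: "card {v\<in>V. f v = i} = j" if "i < k" for i
    using f that by (simp add: FF_def fibre_functions_def)
  have \<tau>: "\<tau> g i < k \<and> 2 * j < 3 * card {v\<in>V. f v = i \<and> g v = \<tau> g i}" if "i \<in> matched_rows V k j f g" for g i
  proof -
    have "\<exists>l. l < k \<and> 2 * j < 3 * card {v\<in>V. f v = i \<and> g v = l}" using that by (auto simp: matched_rows_def)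
    from someI_ex[OF this] show ?thesis using that by (simp add: \<tau>_def)
  qed
  have \<phi>: "\<phi> g \<in> Idx \<and> g \<in> G (\<phi> g)" if g: "g \<in> ?A" for g
  proof -
    let ?M = "matched_rows V k j f g"
    have cg: "card {v\<in>V. g v = l} = j" if "l < k" for l
      using g that by (simp add: FF_def fibre_functions_def)
    have "\<tau> g \<in> ?M \<rightarrow>\<^sub>E {..<k}" using \<tau>[of _ g] by (auto simp: \<tau>_def)
    moreover have "inj_on (\<tau> g) ?M"
    proof (rule inj_onI)
      fix i i' assume i: "i \<in> ?M" "i' \<in> ?M" "\<tau> g i = \<tau> g i'"
      have "2 * j < 3 * card {v\<in>V. g v = \<tau> g i \<and> f v = i}" "2 * j < 3 * card {v\<in>V. g v = \<tau> g i \<and> f v = i'}"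
        using \<tau>[OF i(1)] \<tau>[OF i(2)] i(3) by (simp_all add: conj_commute)
      from large_cell_unique[OF finV _ this] show "i = i'" using cg[of "\<tau> g i"] \<tau>[OF i(1)] by simp
    qed
    moreover have "?M \<in> Is" using g by (auto simp: Is_def matched_rows_def)
    ultimately have 1: "\<phi> g \<in> Idx" by (simp add: \<phi>_def Idx_def Ts_def)
    have "3 * card {v\<in>V. f v = i \<and> g v = l} \<le> 2 * j" if il: "i < k" "l < k" "\<not> (i \<in> ?M \<and> l = \<tau> g i)" for i l
    proof (rule ccontr)
      assume "\<not> ?thesis"
      then have big: "2 * j < 3 * card {v\<in>V. f v = i \<and> g v = l}" by simp
      then have M: "i \<in> ?M" using il by (auto simp: matched_rows_def)
      have "l = \<tau> g i" using large_cell_unique[OF finV _ big, of "\<tau> g i"] \<tau>[OF M] cR[OF il(1)] by simp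
      with M il show False by simp
    qed
    then have "g \<in> G (\<phi> g)" unfolding G_def \<phi>_def using g \<tau>[of _ g] by (simp only: prod.case) blast
    with 1 show ?thesis by simp
  qed
  have s0: "0 \<le> ?s g" for g using b by simp
  have "sum ?s ?A = (\<Sum>x\<in>Idx. sum ?s {g\<in>?A. \<phi> g = x})"
    using finA finIdx \<phi> by (intro sum.group[symmetric]) blast+
  also have "\<dots> \<le> (\<Sum>x\<in>Idx. sum ?s (G x))"
  proof (intro sum_mono sum_mono2 s0)
    fix x show "finite (G x)" using finFF by (cases x) (auto simp: G_def)
    show "{g\<in>?A. \<phi> g = x} \<subseteq> G x" using \<phi> by blast
  qed
  also have "\<dots> \<le> (\<Sum>x\<in>Idx. B (k - card (fst x)))"
  proof (rule sum_mono)
    fix x assume "x \<in> Idx"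
    then obtain I \<sigma> where x: "x = (I, \<sigma>)" and I: "I \<subseteq> {..<k}" "k - card I \<le> t1" and \<sigma>: "\<sigma> \<in> I \<rightarrow>\<^sub>E {..<k}" "inj_on \<sigma> I"
      by (auto simp: Idx_def Is_def Ts_def)
    define t where "t = k - card I"
    have tt1: "t \<le> t1" using I t_def by simp
    have cI: "card I \<le> k" using card_mono[OF _ I(1)] by simp
    have finI: "finite I" using I finite_subset by blast
    have "sum ?s (G x) \<le> K t ^ (t * j) * (\<Sum>D\<in>Pi\<^sub>E I (\<lambda>i. {D. D \<subseteq> {v\<in>V. f v = i} \<and> 3 * card D < j}).
          (\<Prod>i\<in>I. b ^ ((j - card (D i) choose 2) + (card (D i) choose 2)))
            * real (t * j + (\<Sum>i\<in>I. card (D i))) ^ (\<Sum>i\<in>I. card (D i)))"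
      unfolding x G_def prod.case FF_def
      using matched_cell_sum[OF finV b K[OF tt1] f[unfolded FF_def] I(1) \<sigma> t_def cond[OF tt1]] by simp
    also have "\<dots> \<le> B t"
      unfolding B_def
    proof (intro mult_left_mono sum_defects_weighted_le b y finI j)
      show "t + card I = k" using cI t_def by simp
      show "finite {v\<in>V. f v = i} \<and> card {v\<in>V. f v = i} = j" if "i \<in> I" for i
        using that I finV cR[of i] by auto
    qed (use K[OF tt1] in auto)
    finally show "sum ?s (G x) \<le> B (k - card (fst x))" by (simp add: x t_def)
  qed
  also have "\<dots> = (\<Sum>I\<in>Is. \<Sum>\<tau>\<in>Ts I. B (k - card I))"
    unfolding Idx_def using finIs finTs by (subst sum.Sigma) (auto simp: case_prod_beta)
  also have "\<dots> = (\<Sum>I\<in>Is. fact k / fact (k - card I) * B (k - card I))"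
  proof (rule sum.cong[OF refl])
    fix I assume "I \<in> Is"
    then have I: "I \<subseteq> {..<k}" by (simp add: Is_def)
    then have cI: "card I \<le> k" and "finite I" using card_mono[of "{..<k}" I] finite_subset[of I "{..<k}"] by auto
    have "card (Ts I) = (\<Prod>x = 0..<card I. k - x)"
      unfolding Ts_def using card_inj_on_subset_funcset[of I "{..<k}" I] \<open>finite I\<close> by simp
    moreover have "(\<Prod>x = 0..<a. k - x) * fact (k - a) = fact k" if "a \<le> k" for a
      using that
    proof (induction a)
      case (Suc a)
      have "fact (k - a) = (k - a) * fact (k - Suc a)"
        using Suc.prems by (metis Suc_diff_Suc Suc_le_lessD fact_Suc of_nat_id)
      then show ?case using Suc by (simp add: algebra_simps)
    qed simp
    ultimately have "card (Ts I) * fact (k - card I) = fact k" using cI by simp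
    then have "real (card (Ts I)) * fact (k - card I) = fact k" by (metis of_nat_fact of_nat_mult)
    then have "real (card (Ts I)) = fact k / fact (k - card I)" by (simp add: field_simps)
    then show "(\<Sum>\<tau>\<in>Ts I. B (k - card I)) = fact k / fact (k - card I) * B (k - card I)" by simp
  qed
  also have "\<dots> = (\<Sum>I\<in>Pow {..<k}. if k - card I \<le> t1 then fact k / fact (k - card I) * B (k - card I) else 0)"
    unfolding Is_def by (intro sum.mono_neutral_cong_left) auto
  also have "\<dots> = (\<Sum>x\<le>k. real (k choose x) * (if k - x \<le> t1 then fact k / fact (k - x) * B (k - x) else 0))"
    using sum_Pow_card[of "{..<k}" "\<lambda>x. if k - x \<le> t1 then fact k / fact (k - x) * B (k - x) else 0"] by simp
  also have "\<dots> = (\<Sum>t\<le>k. real (k choose t) * (if t \<le> t1 then fact k / fact t * B t else 0))"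
    by (rule sum.reindex_bij_witness[of _ "\<lambda>x. k - x" "\<lambda>x. k - x"]) (auto simp: binomial_symmetric[symmetric])
  also have "\<dots> = (\<Sum>t\<le>t1. real (k choose t) * (fact k / fact t) * B t)"
    using t1 by (intro sum.mono_neutral_cong_right) auto
  finally show ?thesis unfolding B_def .
qed

section \<open>Colourings with few large cells\<close>

definition ffact :: "nat \<Rightarrow> nat \<Rightarrow> real" where
  "ffact n y = (\<Prod>x<y. real (n - x))"

lemma ffact_nonneg [simp]: "0 \<le> ffact n y"
  unfolding ffact_def by (intro prod_nonneg) auto

lemma ffact_0 [simp]: "ffact n 0 = 1"
  by (simp add: ffact_def)

lemma ffact_mult_fact: "y \<le> n \<Longrightarrow> ffact n y * fact (n - y) = fact n"
proof (induction y)
  case (Suc y)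
  have "fact (n - y) = real (n - y) * fact (n - Suc y)"
    using Suc.prems by (metis Suc_diff_Suc Suc_le_lessD fact_Suc)
  moreover have "ffact n (Suc y) = ffact n y * real (n - y)" by (simp add: ffact_def)
  moreover have "ffact n y * fact (n - y) = fact n" using Suc by simp
  ultimately show ?case by (simp only: mult.assoc)
qed simp

lemma ffact_pos: "y \<le> n \<Longrightarrow> 0 < ffact n y"
  unfolding ffact_def by (intro prod_pos) auto

lemma ffact_add: "ffact n (a + c) = ffact n a * ffact (n - a) c"
proof (induction c)
  case (Suc c)
  then show ?case by (simp add: ffact_def)
qed simp

lemma ffact_mono: "m \<le> n \<Longrightarrow> ffact m y \<le> ffact n y"
  unfolding ffact_def by (intro prod_mono) auto

text \<open>Cells in one class of \<open>g\<close> compete for its \<open>j\<close> places. Ignoring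
  this competition only increases the count, and it is what makes the weights of different cells
  independent.\<close>

lemma ffact_sum_le: "finite A \<Longrightarrow> ffact j (sum y A) \<le> (\<Prod>a\<in>A. ffact j (y a))"
proof (induction A rule: finite_induct)
  case (insert a A)
  have "ffact j (sum y (insert a A)) = ffact j (y a) * ffact (j - y a) (sum y A)"
    using insert by (simp add: ffact_add)
  also have "\<dots> \<le> ffact j (y a) * ffact j (sum y A)"
    by (intro mult_left_mono ffact_mono) auto
  also have "\<dots> \<le> ffact j (y a) * (\<Prod>a\<in>A. ffact j (y a))"
    using insert by (intro mult_left_mono) auto
  finally show ?case using insert by simp
qed simp

text \<open>The term of the whole cell alone gives \<open>cell_weight_le_cores\<close> for cells of size at least 3; only the
  weight of pairs has to be exact, since pairs make up the main term of the second moment.\<close>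
definition core_weight :: "real \<Rightarrow> nat \<Rightarrow> real" where
  "core_weight B y = (if y = 0 then 1 else if y = 1 then 0 else if y = 2 then B - 1 else B ^ (y choose 2))"

lemma core_weight_nonneg: "B \<ge> 1 \<Longrightarrow> 0 \<le> core_weight B y"
  by (simp add: core_weight_def)

lemma cell_weight_le_cores:
  fixes S :: "'a set"
  assumes B: "B \<ge> 1" and S: "finite S"
  shows "B ^ (card S choose 2) \<le> (\<Sum>X\<in>Pow S. core_weight B (card X))"
proof -
  have *: "(\<Sum>X\<in>{{}, S}. core_weight B (card X)) \<le> (\<Sum>X\<in>Pow S. core_weight B (card X))"
    using S core_weight_nonneg[OF B] by (intro sum_mono2) auto
  consider "card S \<le> 1" | "card S = 2" | "card S \<ge> 3" by linarith
  then show ?thesis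
  proof cases
    case 1
    have "(\<Sum>X\<in>{{} :: 'a set}. core_weight B (card X)) \<le> (\<Sum>X\<in>Pow S. core_weight B (card X))"
      using S core_weight_nonneg[OF B] by (intro sum_mono2) auto
    then show ?thesis using 1 by (simp add: core_weight_def binomial_eq_0)
  next
    case 2
    then have "S \<noteq> {}" by auto
    then show ?thesis using * 2 by (simp add: core_weight_def)
  next
    case 3
    then have "S \<noteq> {}" by auto
    then show ?thesis using * 3 by (simp add: core_weight_def)
  qed
qed

text \<open>The function \<open>g0\<close> witnesses that the sets \<open>T l\<close> are disjoint
  and have at most \<open>j\<close> elements. Restriction to the free vertices is then injective,
  and the quotient of the two multinomial coefficients is the ratio of falling factorials.\<close>

lemma card_prescribed_le:
  fixes T :: "nat \<Rightarrow> 'a set"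
  defines "FF V k j \<equiv> fibre_functions V {..<k} (\<lambda>_. j)"
  assumes finV: "finite V" and g0: "g0 \<in> FF V k j" and T: "\<And>l. l < k \<Longrightarrow> T l \<subseteq> {v\<in>V. g0 v = l}"
  shows "real (card {g \<in> FF V k j. \<forall>l<k. \<forall>v\<in>T l. g v = l})
    \<le> real (card (FF V k j)) * ((\<Prod>l<k. ffact j (card (T l))) / ffact (card V) (\<Sum>l<k. card (T l)))"
proof -
  define U where "U = (\<Union>l<k. T l)"
  define d where "d l = j - card (T l)" for l
  let ?M = "\<Sum>l<k. card (T l)"
  have UV: "U \<subseteq> V" using T by (auto simp: U_def)
  have finT: "finite (T l)" if "l < k" for l using T[OF that] finV finite_subset by fastforce
  have cT: "card (T l) \<le> j" if "l < k" for l
  proof -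
    have "card (T l) \<le> card {v\<in>V. g0 v = l}" using T[OF that] finV by (intro card_mono) auto
    then show ?thesis using g0 that by (simp add: FF_def fibre_functions_def)
  qed
  have cV: "card V = (\<Sum>l<k. j)"
  proof -
    have "V = (\<Union>l<k. {v\<in>V. g0 v = l})" using g0 by (auto simp: FF_def fibre_functions_def)
    also have "card \<dots> = (\<Sum>l<k. card {v\<in>V. g0 v = l})" using finV by (intro card_UN_disjoint) auto
    also have "\<dots> = (\<Sum>l<k. j)" using g0 by (intro sum.cong) (auto simp: FF_def fibre_functions_def)
    finally show ?thesis .
  qed
  have cU: "card U = ?M"
    unfolding U_def using finT
  proof (intro card_UN_disjoint)
    show "\<forall>l\<in>{..<k}. \<forall>l'\<in>{..<k}. l \<noteq> l' \<longrightarrow> T l \<inter> T l' = {}" using T by blast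
  qed auto
  have MV: "?M \<le> card V" using cU UV finV card_mono by metis
  have sumd: "(\<Sum>l<k. d l) = card (V - U)"
  proof -
    have "(\<Sum>l<k. d l) + ?M = (\<Sum>l<k. j)" unfolding sum.distrib[symmetric] d_def using cT by (intro sum.cong) auto
    then show ?thesis using cU UV finV cV by (subst card_Diff_subset) (auto intro: finite_subset)
  qed
  let ?G = "{g \<in> FF V k j. \<forall>l<k. \<forall>v\<in>T l. g v = l}"
  have "card ?G \<le> card (fibre_functions (V - U) {..<k} d)"
  proof (rule card_inj_on_le[of "\<lambda>g. restrict g (V - U)"])
    show "inj_on (\<lambda>g. restrict g (V - U)) ?G"
    proof (rule inj_onI)
      fix g h assume g: "g \<in> ?G" and h: "h \<in> ?G" and eq: "restrict g (V - U) = restrict h (V - U)"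
      show "g = h"
      proof
        fix v
        consider "v \<notin> V" | l where "l < k" "v \<in> T l" | "v \<in> V - U" by (auto simp: U_def)
        then show "g v = h v"
        proof cases
          case 1 then show ?thesis using g h by (auto simp: FF_def fibre_functions_def PiE_iff extensional_def)
        next
          case (2 l)
          have "g v = l" "h v = l" using g h 2 by blast+
          then show ?thesis by simp
        next
          case 3 then show ?thesis using fun_cong[OF eq, of v] by simp
        qed
      qed
    qed
    show "(\<lambda>g. restrict g (V - U)) ` ?G \<subseteq> fibre_functions (V - U) {..<k} d"
    proof (rule image_subsetI)
      fix g assume g: "g \<in> ?G"
      have "card {v \<in> V - U. restrict g (V - U) v = l} = d l" if l: "l < k" for l
      proof -
        have "{v \<in> V - U. restrict g (V - U) v = l} = {v\<in>V. g v = l} - T l"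
          using g l by (auto simp: U_def)
        moreover have "T l \<subseteq> {v\<in>V. g v = l}" using g l T[OF l] by auto
        moreover have "card {v\<in>V. g v = l} = j" using g l by (simp add: FF_def fibre_functions_def)
        ultimately show ?thesis using finT[OF l] by (simp only: card_Diff_subset d_def)
      qed
      then show "restrict g (V - U) \<in> fibre_functions (V - U) {..<k} d"
        using g by (auto simp: fibre_functions_def FF_def PiE_iff)
    qed
    show "finite (fibre_functions (V - U) {..<k} d)" using finV by (simp add: finite_fibre_functions)
  qed
  then have "real (card ?G) \<le> real (card (fibre_functions (V - U) {..<k} d))" by simp
  also have "\<dots> = fact (card (V - U)) / (\<Prod>l<k. fact (d l))"
    using finV sumd by (intro card_fibre_functions) auto
  also have "card (V - U) = card V - ?M" using UV finV cU by (subst card_Diff_subset) (auto intro: finite_subset)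
  also have "fact (card V - ?M) / (\<Prod>l<k. fact (d l))
      = real (card (FF V k j)) * ((\<Prod>l<k. ffact j (card (T l))) / ffact (card V) ?M)"
  proof -
    have "real (card (FF V k j)) = fact (card V) / (\<Prod>l<k. fact j)"
      unfolding FF_def using finV cV by (intro card_fibre_functions) auto
    also have "fact (card V) = ffact (card V) ?M * fact (card V - ?M)" using ffact_mult_fact[OF MV] by simp
    also have "(\<Prod>l<k. fact j :: real) = (\<Prod>l<k. ffact j (card (T l))) * (\<Prod>l<k. fact (d l))"
      unfolding prod.distrib[symmetric] d_def using cT by (intro prod.cong) (auto simp: ffact_mult_fact)
    finally show ?thesis using ffact_pos[OF MV] ffact_pos[OF cT] by (simp add: prod_pos less_imp_neq[symmetric])
  qed
  finally show ?thesis .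
qed

text \<open>The reciprocal falling factorial of the total core size does not factorise over the
  cells, so \<open>bound\<close> majorises it by two functions that do: a factor
  \<open>\<alpha>\<close> for each vertex in a large core, and \<open>\<beta>\<close> or
  \<open>\<gamma>\<close> for each vertex in a small one. That few rows are matched enters as the
  bound \<open>M1\<close> on the number \<open>Mb\<close> of vertices in large cores. After
  exchanging the two sums, the sum over all families of cores is a product over the
  \<open>k ^ 2\<close> cells.\<close>

lemma few_matched_sum:
  fixes B \<alpha> \<beta> \<gamma> e1 e2 :: real and f :: "'a \<Rightarrow> nat"
  defines "FF V k j \<equiv> fibre_functions V {..<k} (\<lambda>_. j)"
  defines "S \<delta> j \<equiv> (\<Sum>y=2..j. real (j choose y) * (core_weight B y * ffact j y * (if 2 * j < 3 * y then \<alpha> else \<delta>) ^ y))"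
  assumes finV: "finite V" and B: "B \<ge> 1" and f: "f \<in> FF V k j"
    and nonneg: "0 \<le> \<alpha>" "0 \<le> \<beta>" "0 \<le> \<gamma>" "0 \<le> e1" "0 \<le> e2"
    and bound: "\<And>Mb Ms. Mb \<le> M1 \<Longrightarrow> Mb + Ms \<le> card V \<Longrightarrow>
          1 / ffact (card V) (Mb + Ms) \<le> e1 * (\<alpha> ^ Mb * \<beta> ^ Ms) + e2 * (\<alpha> ^ Mb * \<gamma> ^ Ms)"
  shows "(\<Sum>g | g \<in> FF V k j \<and> card (matched_rows V k j f g) * j \<le> M1. B ^ cell_pairs {..<k} {..<k} f g V)
     \<le> real (card (FF V k j)) * (e1 * exp (real k ^ 2 * S \<beta> j) + e2 * exp (real k ^ 2 * S \<gamma> j))"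
    (is "sum _ ?A \<le> _")
proof -
  define R where "R i = {v\<in>V. f v = i}" for i
  define P where "P = {..<k} \<times> {..<k}"
  define cell where "cell g = (\<lambda>(l, i). {v\<in>V. f v = i \<and> g v = l})" for g :: "'a \<Rightarrow> nat"
  define \<Omega> where "\<Omega> = Pi\<^sub>E P (\<lambda>(l, i). Pow (R i))"
  define compat where "compat g X \<longleftrightarrow> (\<forall>p\<in>P. X p \<subseteq> cell g p)" for g and X :: "nat \<times> nat \<Rightarrow> 'a set"
  define c where "c X = (\<Prod>p\<in>P. core_weight B (card (X p)))" for X :: "nat \<times> nat \<Rightarrow> 'a set"
  define w where "w \<delta> y = core_weight B y * ffact j y * (if 2 * j < 3 * y then \<alpha> else \<delta>) ^ y" for \<delta> y
  have finP: "finite P" by (simp add: P_def)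
  have finR: "finite (R i)" for i using finV by (simp add: R_def)
  have cR: "card (R i) = j" if "i < k" for i using f that by (simp add: FF_def fibre_functions_def R_def)
  have fk: "f v < k" if "v \<in> V" for v using f that by (auto simp: FF_def fibre_functions_def)
  have fincell: "finite (cell g p)" for g p using finV by (cases p) (simp add: cell_def)
  have fin\<Omega>: "finite \<Omega>" unfolding \<Omega>_def using finP finR by (intro finite_PiE) auto
  have finA: "finite ?A" unfolding FF_def using finV by (simp add: finite_fibre_functions)
  have c0: "0 \<le> c X" for X unfolding c_def using core_weight_nonneg[OF B] by (intro prod_nonneg) auto
  have expand: "B ^ cell_pairs {..<k} {..<k} f g V \<le> (\<Sum>X | X \<in> \<Omega> \<and> compat g X. c X)" for g
  proof -
    have "B ^ cell_pairs {..<k} {..<k} f g V = (\<Prod>p\<in>P. B ^ (card (cell g p) choose 2))"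
      unfolding cell_pairs_def P_def cell_def
      by (simp add: sum.cartesian_product power_sum case_prod_beta)
    also have "\<dots> \<le> (\<Prod>p\<in>P. \<Sum>X\<in>Pow (cell g p). core_weight B (card X))"
      using B fincell by (intro prod_mono conjI cell_weight_le_cores) auto
    also have "\<dots> = (\<Sum>X\<in>Pi\<^sub>E P (\<lambda>p. Pow (cell g p)). c X)"
      unfolding c_def using finP fincell by (intro prod_sum_PiE) auto
    also have "\<dots> \<le> (\<Sum>X | X \<in> \<Omega> \<and> compat g X. c X)"
    proof (rule sum_mono2)
      show "finite {X. X \<in> \<Omega> \<and> compat g X}" using fin\<Omega> by simp
      show "Pi\<^sub>E P (\<lambda>p. Pow (cell g p)) \<subseteq> {X. X \<in> \<Omega> \<and> compat g X}"
        unfolding \<Omega>_def compat_def cell_def R_def by (fastforce simp: PiE_iff)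
    qed (rule c0)
    finally show ?thesis .
  qed
  have per_core: "c X * real (card {g\<in>?A. compat g X})
      \<le> real (card (FF V k j)) * (e1 * (\<Prod>p\<in>P. w \<beta> (card (X p))) + e2 * (\<Prod>p\<in>P. w \<gamma> (card (X p))))"
    if X: "X \<in> \<Omega>" for X
  proof (cases "{g\<in>?A. compat g X} = {}")
    case True
    have "0 \<le> w \<delta> y" if "0 \<le> \<delta>" for \<delta> y
      unfolding w_def using core_weight_nonneg[OF B] nonneg that by auto
    then have "0 \<le> real (card (FF V k j)) * (e1 * (\<Prod>p\<in>P. w \<beta> (card (X p))) + e2 * (\<Prod>p\<in>P. w \<gamma> (card (X p))))"
      using nonneg by (intro mult_nonneg_nonneg add_nonneg_nonneg prod_nonneg) auto
    then show ?thesis unfolding True by simp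
  next
    case False
    \<comment> \<open>One compatible colouring suffices to see that the cores are disjoint, fit into
      the classes, and satisfy the size restrictions under which \<open>bound\<close> holds.\<close>
    then obtain g0 where g0: "g0 \<in> FF V k j" "card (matched_rows V k j f g0) * j \<le> M1" "compat g0 X" by auto
    define T where "T l = (\<Union>i<k. X (l, i))" for l
    let ?y = "\<lambda>p. card (X p)"
    define big where "big p \<longleftrightarrow> 2 * j < 3 * ?y p" for p
    define Mb where "Mb = (\<Sum>p | p \<in> P \<and> big p. ?y p)"
    define Ms where "Ms = (\<Sum>p | p \<in> P \<and> \<not> big p. ?y p)"
    have Xcell: "X (l, i) \<subseteq> {v\<in>V. f v = i \<and> g0 v = l}" if "l < k" "i < k" for l i
      using g0(3) that unfolding compat_def P_def cell_def by fastforce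
    have finX: "finite (X (l, i))" if "l < k" "i < k" for l i
      using Xcell[OF that] finV by (auto intro: finite_subset)
    have T: "T l \<subseteq> {v\<in>V. g0 v = l}" if "l < k" for l using Xcell[OF that] by (fastforce simp: T_def)
    have cT: "card (T l) = (\<Sum>i<k. ?y (l, i))" if "l < k" for l
      unfolding T_def
    proof (rule card_UN_disjoint)
      show "\<forall>i\<in>{..<k}. \<forall>i'\<in>{..<k}. i \<noteq> i' \<longrightarrow> X (l, i) \<inter> X (l, i') = {}"
        using Xcell[OF that] by blast
    qed (use finX that in auto)
    have M: "(\<Sum>l<k. card (T l)) = Mb + Ms"
    proof -
      have "(\<Sum>l<k. card (T l)) = (\<Sum>p\<in>P. ?y p)"
        unfolding P_def by (simp add: cT sum.cartesian_product)
      also have "\<dots> = Mb + Ms"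
        unfolding Mb_def Ms_def using finP
        by (subst sum.union_disjoint[symmetric]) (auto intro!: sum.cong)
      finally show ?thesis .
    qed
    have Mn: "Mb + Ms \<le> card V"
    proof -
      have "(\<Sum>l<k. card (T l)) \<le> (\<Sum>l<k. card {v\<in>V. g0 v = l})"
        using T finV by (intro sum_mono card_mono) auto
      also have "\<dots> = card (\<Union>l<k. {v\<in>V. g0 v = l})" using finV by (intro card_UN_disjoint[symmetric]) auto
      also have "\<dots> \<le> card V" using finV by (intro card_mono) auto
      finally show ?thesis unfolding M .
    qed
    have Mb: "Mb \<le> M1"
    proof -
      let ?I = "matched_rows V k j f g0"
      have finI: "finite ?I" by (auto simp: matched_rows_def)
      have le: "?y (l, i) \<le> card {v\<in>V. f v = i \<and> g0 v = l}" if "l < k" "i < k" for l i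
        using Xcell[OF that] finV by (intro card_mono) auto
      \<comment> \<open>A large core lies in a large cell, hence in a matched row, and the cores
        within one row occupy at most \<open>j\<close> vertices.\<close>
      have "Mb \<le> (\<Sum>p\<in>?I \<times> {..<k}. ?y (snd p, fst p))"
      proof -
        have "{p \<in> P. big p} \<subseteq> prod.swap ` (?I \<times> {..<k})"
        proof
          fix p assume p: "p \<in> {p \<in> P. big p}"
          obtain l i where li: "p = (l, i)" by (cases p)
          then have "l < k" "i < k" using p by (auto simp: P_def)
          moreover have "2 * j < 3 * card {v\<in>V. f v = i \<and> g0 v = l}"
            using le[of l i] p li \<open>l < k\<close> \<open>i < k\<close> unfolding big_def by auto
          ultimately have "(i, l) \<in> ?I \<times> {..<k}" by (auto simp: matched_rows_def)
          then show "p \<in> prod.swap ` (?I \<times> {..<k})" unfolding li by force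
        qed
        then have "Mb \<le> (\<Sum>p\<in>prod.swap ` (?I \<times> {..<k}). ?y p)"
          unfolding Mb_def using finI by (intro sum_mono2) auto
        also have "\<dots> = (\<Sum>p\<in>?I \<times> {..<k}. ?y (snd p, fst p))"
          by (subst sum.reindex) (auto simp: inj_on_def prod.swap_def)
        finally show ?thesis .
      qed
      also have "\<dots> = (\<Sum>i\<in>?I. \<Sum>l<k. ?y (l, i))" by (simp add: sum.cartesian_product case_prod_beta)
      also have "\<dots> \<le> (\<Sum>i\<in>?I. j)"
      proof (rule sum_mono)
        fix i assume "i \<in> ?I"
        then have ik: "i < k" by (simp add: matched_rows_def)
        have "(\<Sum>l<k. ?y (l, i)) \<le> (\<Sum>l<k. card {v\<in>V. f v = i \<and> g0 v = l})" using le ik by (intro sum_mono) auto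
        also have "\<dots> = card (\<Union>l<k. {v\<in>V. f v = i \<and> g0 v = l})" using finV by (intro card_UN_disjoint[symmetric]) auto
        also have "\<dots> \<le> card (R i)" using finR by (intro card_mono) (auto simp: R_def)
        finally show "(\<Sum>l<k. ?y (l, i)) \<le> j" using cR[OF ik] by simp
      qed
      finally show ?thesis using g0(2) by simp
    qed
    have "{g\<in>?A. compat g X} \<subseteq> {g \<in> FF V k j. \<forall>l<k. \<forall>v\<in>T l. g v = l}"
      unfolding compat_def P_def cell_def T_def by fastforce
    then have "real (card {g\<in>?A. compat g X}) \<le> real (card {g \<in> FF V k j. \<forall>l<k. \<forall>v\<in>T l. g v = l})"
      unfolding FF_def using finV by (intro of_nat_mono card_mono) (auto simp: finite_fibre_functions)
    also have "\<dots> \<le> real (card (FF V k j)) * ((\<Prod>l<k. ffact j (card (T l))) / ffact (card V) (Mb + Ms))"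
      using card_prescribed_le[OF finV g0(1)[unfolded FF_def] T] unfolding M FF_def by simp
    also have "\<dots> \<le> real (card (FF V k j)) * ((\<Prod>p\<in>P. ffact j (?y p))
        * (e1 * (\<alpha> ^ Mb * \<beta> ^ Ms) + e2 * (\<alpha> ^ Mb * \<gamma> ^ Ms)))"
    proof (intro mult_left_mono)
      have "(\<Prod>l<k. ffact j (card (T l))) \<le> (\<Prod>l<k. \<Prod>i<k. ffact j (?y (l, i)))"
        using cT by (intro prod_mono conjI) (auto intro: ffact_sum_le)
      also have "\<dots> = (\<Prod>p\<in>P. ffact j (?y p))" unfolding P_def by (simp add: prod.cartesian_product)
      finally have 1: "(\<Prod>l<k. ffact j (card (T l))) \<le> (\<Prod>p\<in>P. ffact j (?y p))" .
      have "(\<Prod>l<k. ffact j (card (T l))) * (1 / ffact (card V) (Mb + Ms))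
          \<le> (\<Prod>p\<in>P. ffact j (?y p)) * (e1 * (\<alpha> ^ Mb * \<beta> ^ Ms) + e2 * (\<alpha> ^ Mb * \<gamma> ^ Ms))"
        by (intro mult_mono 1 bound[OF Mb Mn] prod_nonneg) auto
      then show "(\<Prod>l<k. ffact j (card (T l))) / ffact (card V) (Mb + Ms)
          \<le> (\<Prod>p\<in>P. ffact j (?y p)) * (e1 * (\<alpha> ^ Mb * \<beta> ^ Ms) + e2 * (\<alpha> ^ Mb * \<gamma> ^ Ms))" by simp
    qed auto
    finally have card_le: "real (card {g\<in>?A. compat g X}) \<le> real (card (FF V k j)) * ((\<Prod>p\<in>P. ffact j (?y p))
        * (e1 * (\<alpha> ^ Mb * \<beta> ^ Ms) + e2 * (\<alpha> ^ Mb * \<gamma> ^ Ms)))" .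
    have pw: "(\<Prod>p\<in>P. (if big p then \<alpha> else \<delta>) ^ ?y p) = \<alpha> ^ Mb * \<delta> ^ Ms" for \<delta> :: real
    proof -
      have "(\<Prod>p\<in>P. (if big p then \<alpha> else \<delta>) ^ ?y p)
          = (\<Prod>p | p \<in> P \<and> big p. \<alpha> ^ ?y p) * (\<Prod>p | p \<in> P \<and> \<not> big p. \<delta> ^ ?y p)"
      proof -
        have "P = {p. p \<in> P \<and> big p} \<union> {p. p \<in> P \<and> \<not> big p}" by auto
        then have "(\<Prod>p\<in>P. (if big p then \<alpha> else \<delta>) ^ ?y p)
          = (\<Prod>p\<in>{p. p \<in> P \<and> big p} \<union> {p. p \<in> P \<and> \<not> big p}. (if big p then \<alpha> else \<delta>) ^ ?y p)" by simp
        also have "\<dots> = (\<Prod>p | p \<in> P \<and> big p. (if big p then \<alpha> else \<delta>) ^ ?y p)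
            * (\<Prod>p | p \<in> P \<and> \<not> big p. (if big p then \<alpha> else \<delta>) ^ ?y p)"
          using finP by (intro prod.union_disjoint) auto
        finally show ?thesis by simp
      qed
      then show ?thesis unfolding Mb_def Ms_def by (simp add: power_sum)
    qed
    have wp: "c X * ((\<Prod>p\<in>P. ffact j (?y p)) * (\<alpha> ^ Mb * \<delta> ^ Ms)) = (\<Prod>p\<in>P. w \<delta> (?y p))" for \<delta>
      unfolding c_def w_def pw[symmetric] big_def by (simp add: prod.distrib mult.assoc)
    have "c X * real (card {g\<in>?A. compat g X}) \<le> c X * (real (card (FF V k j)) * ((\<Prod>p\<in>P. ffact j (?y p))
        * (e1 * (\<alpha> ^ Mb * \<beta> ^ Ms) + e2 * (\<alpha> ^ Mb * \<gamma> ^ Ms))))"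
      by (intro mult_left_mono card_le c0)
    also have "\<dots> = real (card (FF V k j)) * (e1 * (c X * ((\<Prod>p\<in>P. ffact j (?y p)) * (\<alpha> ^ Mb * \<beta> ^ Ms)))
        + e2 * (c X * ((\<Prod>p\<in>P. ffact j (?y p)) * (\<alpha> ^ Mb * \<gamma> ^ Ms))))"
      by (simp add: algebra_simps)
    finally show ?thesis unfolding wp .
  qed
  have factor: "(\<Sum>X\<in>\<Omega>. \<Prod>p\<in>P. w \<delta> (card (X p))) \<le> exp (real k ^ 2 * S \<delta> j)" if "0 \<le> \<delta>" for \<delta>
  proof -
    have w0: "0 \<le> w \<delta> y" for y
      unfolding w_def using core_weight_nonneg[OF B] nonneg that by auto
    have S: "S \<delta> j = (\<Sum>y=2..j. real (j choose y) * w \<delta> y)" by (simp add: S_def w_def)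
    have S0: "0 \<le> S \<delta> j" unfolding S using w0 by (intro sum_nonneg) auto
    have row: "(\<Sum>X\<in>Pow (R i). w \<delta> (card X)) \<le> exp (S \<delta> j)" if "i < k" for i
    proof -
      have "(\<Sum>X\<in>Pow (R i). w \<delta> (card X)) = (\<Sum>y\<le>j. real (j choose y) * w \<delta> y)"
        using sum_Pow_card[OF finR, of "w \<delta>" i] cR[OF that] by simp
      \<comment> \<open>The empty core contributes 1 and cores of size one have weight 0, so
        \<open>S\<close> starts at size two.\<close>
      also have "\<dots> \<le> (\<Sum>y\<in>insert 0 (insert 1 {2..j}). real (j choose y) * w \<delta> y)"
        using w0 by (intro sum_mono2) auto
      also have "\<dots> = 1 + S \<delta> j" unfolding S by (simp add: w_def core_weight_def)
      also have "\<dots> \<le> exp (S \<delta> j)" by (rule exp_ge_add_one_self)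
      finally show ?thesis .
    qed
    have "(\<Sum>X\<in>\<Omega>. \<Prod>p\<in>P. w \<delta> (card (X p))) = (\<Prod>p\<in>P. \<Sum>X\<in>(\<lambda>(l, i). Pow (R i)) p. w \<delta> (card X))"
      unfolding \<Omega>_def using finP finR by (intro prod_sum_PiE[symmetric]) auto
    also have "\<dots> \<le> (\<Prod>p\<in>P. exp (S \<delta> j))"
      using w0 row by (intro prod_mono conjI sum_nonneg) (auto simp: P_def)
    also have "\<dots> = exp (real (card P) * S \<delta> j)" by (simp add: exp_of_nat_mult)
    finally show ?thesis by (simp add: P_def power2_eq_square)
  qed
  have "(\<Sum>g\<in>?A. B ^ cell_pairs {..<k} {..<k} f g V) \<le> (\<Sum>g\<in>?A. \<Sum>X | X \<in> \<Omega> \<and> compat g X. c X)"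
    by (intro sum_mono expand)
  also have "\<dots> = (\<Sum>X\<in>\<Omega>. \<Sum>g | g \<in> ?A \<and> compat g X. c X)"
    by (rule sum.swap_restrict[OF finA fin\<Omega>])
  also have "\<dots> = (\<Sum>X\<in>\<Omega>. c X * real (card {g\<in>?A. compat g X}))" by (simp add: mult.commute)
  also have "\<dots> \<le> (\<Sum>X\<in>\<Omega>. real (card (FF V k j)) * (e1 * (\<Prod>p\<in>P. w \<beta> (card (X p))) + e2 * (\<Prod>p\<in>P. w \<gamma> (card (X p)))))"
    by (rule sum_mono[OF per_core])
  also have "\<dots> = real (card (FF V k j)) * (e1 * (\<Sum>X\<in>\<Omega>. \<Prod>p\<in>P. w \<beta> (card (X p)))
      + e2 * (\<Sum>X\<in>\<Omega>. \<Prod>p\<in>P. w \<gamma> (card (X p))))"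
    by (simp only: sum_distrib_left[symmetric] sum.distrib)
  also have "\<dots> \<le> real (card (FF V k j)) * (e1 * exp (real k ^ 2 * S \<beta> j) + e2 * exp (real k ^ 2 * S \<gamma> j))"
    using nonneg factor by (intro mult_left_mono add_mono) auto
  finally show ?thesis .
qed

section \<open>First and second moments\<close>

definition avoid_prob :: "nat \<Rightarrow> nat \<Rightarrow> nat \<Rightarrow> real" where
  "avoid_prob N m i = real ((N - i) choose m) / real (N choose m)"

lemma avoid_prob_nonneg: "0 \<le> avoid_prob N m i"
  by (simp add: avoid_prob_def)

lemma avoid_prob_pos: "i + m \<le> N \<Longrightarrow> 0 < avoid_prob N m i"
  by (simp add: avoid_prob_def)

lemma avoid_prob_0: "m \<le> N \<Longrightarrow> avoid_prob N m 0 = 1"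
  by (simp add: avoid_prob_def)

lemma avoid_prob_antimono: "i \<le> i' \<Longrightarrow> avoid_prob N m i' \<le> avoid_prob N m i"
  unfolding avoid_prob_def by (intro divide_right_mono of_nat_mono binomial_right_mono) auto

lemma avoid_prob_Suc:
  assumes "i < N"
  shows "avoid_prob N m (Suc i) = avoid_prob N m i * (real (N - i - m) / real (N - i))"
proof -
  have "(N - i - m) * ((N - i) choose m) = (N - i) * ((N - Suc i) choose m)"
    using binomial_absorb_comp[of "N - i" m] assms by simp
  then have "real (N - i - m) * real ((N - i) choose m) = real (N - i) * real ((N - Suc i) choose m)"
    by (metis of_nat_mult)
  then have "real ((N - Suc i) choose m) = real ((N - i) choose m) * (real (N - i - m) / real (N - i))"
    using assms by (simp add: field_simps)
  then show ?thesis by (simp add: avoid_prob_def)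
qed

text \<open>The conditional chance \<open>(N - i - m) / (N - i)\<close> of avoiding one more pair
  decreases in \<open>i\<close>, so a bound at \<open>i = F\<close> serves for all later steps.
  Starting at \<open>F\<close> instead of 0 matters: the edge number will be rounded down, so that
  \<open>q\<close> need not be a bound at 0.\<close>

lemma avoid_prob_add_le:
  fixes q :: real
  assumes q: "0 \<le> q" and m: "m > 0" and F: "real N - real F - real m \<le> q * (real N - real F)" and q1: "q \<le> 1"
  shows "avoid_prob N m (F + x) \<le> avoid_prob N m F * q ^ x"
proof (induction x)
  case (Suc x)
  have "avoid_prob N m (F + Suc x) \<le> avoid_prob N m (F + x) * q"
  proof (cases "F + x + m < N")
    case True
    have "real (N - (F + x) - m) / real (N - (F + x)) \<le> q"
    proof -
      have "real N - real F - real m - real x \<le> q * (real N - real F) - q * real x"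
        using F q1 mult_right_mono[OF q1, of "real x"] by linarith
      then have "real N - (real F + real x) - real m \<le> q * (real N - (real F + real x))" by (simp add: algebra_simps)
      then show ?thesis using True by (simp add: divide_le_eq of_nat_diff)
    qed
    then have "avoid_prob N m (F + x) * (real (N - (F + x) - m) / real (N - (F + x))) \<le> avoid_prob N m (F + x) * q"
      by (intro mult_left_mono avoid_prob_nonneg)
    then show ?thesis using avoid_prob_Suc[of "F + x" N m] True by simp
  next
    case False
    then have "N - (F + Suc x) < m" using m by linarith
    then have "avoid_prob N m (F + Suc x) = 0" by (simp add: avoid_prob_def)
    then show ?thesis using q avoid_prob_nonneg[of N m "F + x"] by simp
  qed
  also have "\<dots> \<le> (avoid_prob N m F * q ^ x) * q" using Suc q by (intro mult_right_mono)
  finally show ?case by (simp add: algebra_simps)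
qed simp

abbreviation balanced :: "nat \<Rightarrow> nat \<Rightarrow> (nat \<Rightarrow> nat) set" where
  "balanced k j \<equiv> fibre_functions {0..<k * j} {..<k} (\<lambda>_. j)"

lemma card_balanced: "real (card (balanced k j)) = fact (k * j) / fact j ^ k"
  by (subst card_fibre_functions) auto

lemma card_mono_balanced: "f \<in> balanced k j \<Longrightarrow> card (mono_edges (k * j) f) = k * (j choose 2)"
  by (subst card_mono_edges[of "{..<k}"]) (auto simp: fibre_functions_def)

lemma card_mono_Int:
  assumes "f \<in> balanced k j" "g \<in> balanced k j"
  shows "card (mono_edges (k * j) f \<inter> mono_edges (k * j) g) = cell_pairs {..<k} {..<k} f g {0..<k * j}"
proof -
  have "mono_edges (k * j) f \<inter> mono_edges (k * j) g = mono_edges (k * j) (\<lambda>v. (g v, f v))"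
    by (auto simp: mono_edges_def)
  also have "card \<dots> = (\<Sum>p\<in>{..<k} \<times> {..<k}. card {v\<in>{0..<k * j}. (g v, f v) = p} choose 2)"
    using assms by (intro card_mono_edges) (auto simp: fibre_functions_def PiE_iff)
  also have "\<dots> = cell_pairs {..<k} {..<k} f g {0..<k * j}"
    unfolding cell_pairs_def sum.cartesian_product
    by (intro sum.cong refl) (auto intro!: arg_cong[of _ _ "\<lambda>A. card A choose 2"])
  finally show ?thesis .
qed

lemma cell_pairs_le:
  assumes "f \<in> balanced k j" "g \<in> balanced k j"
  shows "cell_pairs {..<k} {..<k} f g {0..<k * j} \<le> k * (j choose 2)"
proof -
  have "card (mono_edges (k * j) f \<inter> mono_edges (k * j) g) \<le> card (mono_edges (k * j) f)"
    using finite_subset[OF mono_edges_subset finite_all_edges] by (intro card_mono) auto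
  then show ?thesis using card_mono_Int[OF assms] card_mono_balanced[OF assms(1)] by simp
qed

lemma card_mono_Un:
  assumes "f \<in> balanced k j" "g \<in> balanced k j"
  shows "card (mono_edges (k * j) f \<union> mono_edges (k * j) g)
    = 2 * (k * (j choose 2)) - cell_pairs {..<k} {..<k} f g {0..<k * j}"
proof -
  have fin: "finite (mono_edges (k * j) h)" for h :: "nat \<Rightarrow> nat"
    using finite_subset[OF mono_edges_subset finite_all_edges] .
  show ?thesis
    using card_Un_Int[OF fin fin, of f g] card_mono_Int[OF assms] card_mono_balanced[OF assms(1)]
      card_mono_balanced[OF assms(2)] by simp
qed

text \<open>The square of the count is a sum over pairs \<open>(f, g)\<close> of the indicator that
  the union of both sets of forbidden pairs is avoided. Hence \<open>pairs\<close>, a bound for each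
  fixed \<open>f\<close>, says that the second moment is at most \<open>1 + \<delta>\<close> times
  the squared mean.\<close>

lemma second_moment_bound:
  fixes \<delta> :: real
  assumes m: "m \<le> (k * j) choose 2" and Fm: "k * (j choose 2) + m \<le> (k * j) choose 2" and \<delta>: "\<delta> \<ge> 0"
    and pairs: "\<And>f. f \<in> balanced k j \<Longrightarrow>
      (\<Sum>g\<in>balanced k j. avoid_prob ((k * j) choose 2) m
          (2 * (k * (j choose 2)) - cell_pairs {..<k} {..<k} f g {0..<k * j}))
       \<le> (1 + \<delta>) * real (card (balanced k j)) * (avoid_prob ((k * j) choose 2) m (k * (j choose 2)))\<^sup>2"
  shows "prob_Gnm (k * j) m (\<lambda>E. \<exists>f\<in>balanced k j. E \<inter> mono_edges (k * j) f = {}) \<ge> 1 / (1 + \<delta>)"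
proof -
  define n where "n = k * j"
  define N where "N = n choose 2"
  define F where "F = k * (j choose 2)"
  define FF where "FF = balanced k j"
  define G where "G = graphs_nm n m"
  define X where "X E = real (card {f\<in>FF. E \<inter> mono_edges n f = {}})" for E
  define M where "M = real (N choose m)"
  have M0: "M > 0" using m by (simp add: M_def N_def n_def)
  have finFF: "finite FF" unfolding FF_def by (simp add: finite_fibre_functions)
  have finG: "finite G" by (simp add: G_def)
  have cFF: "real (card FF) > 0" unfolding FF_def card_balanced by simp
  have H: "avoid_prob N m F > 0" using Fm by (intro avoid_prob_pos) (simp add: F_def N_def n_def)
  have X: "X E = (\<Sum>f\<in>FF. if E \<inter> mono_edges n f = {} then 1 else 0)" for E
    unfolding X_def using finFF by (simp add: sum.If_cases Int_def)
  have avoid: "real (card {E\<in>G. E \<inter> S = {}}) = M * avoid_prob N m (card S)" if "S \<subseteq> all_edges n" for S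
    unfolding G_def card_graphs_avoiding[OF that] avoid_prob_def using M0 by (simp add: M_def N_def)
  have first: "(\<Sum>E\<in>G. X E) = M * (real (card FF) * avoid_prob N m F)"
  proof -
    have "(\<Sum>E\<in>G. X E) = (\<Sum>f\<in>FF. \<Sum>E\<in>G. if E \<inter> mono_edges n f = {} then 1 else 0)"
      unfolding X by (rule sum.swap)
    also have "\<dots> = (\<Sum>f\<in>FF. real (card {E\<in>G. E \<inter> mono_edges n f = {}}))"
      using finG by (intro sum.cong refl) (simp add: sum.If_cases Int_def)
    also have "\<dots> = (\<Sum>f\<in>FF. M * avoid_prob N m F)"
    proof (intro sum.cong refl)
      fix f assume "f \<in> FF"
      then show "real (card {E\<in>G. E \<inter> mono_edges n f = {}}) = M * avoid_prob N m F"
        using avoid[OF mono_edges_subset[of n f]] card_mono_balanced[of f k j] by (simp add: FF_def n_def F_def)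
    qed
    finally show ?thesis by simp
  qed
  have second: "(\<Sum>E\<in>G. (X E)\<^sup>2) \<le> M * ((1 + \<delta>) * (real (card FF) * avoid_prob N m F)\<^sup>2)"
  proof -
    have sq: "(X E)\<^sup>2 = (\<Sum>f\<in>FF. \<Sum>g\<in>FF. if E \<inter> (mono_edges n f \<union> mono_edges n g) = {} then 1 else 0)" for E
      unfolding X power2_eq_square sum_product by (intro sum.cong refl) auto
    have "(\<Sum>E\<in>G. (X E)\<^sup>2)
        = (\<Sum>f\<in>FF. \<Sum>g\<in>FF. \<Sum>E\<in>G. if E \<inter> (mono_edges n f \<union> mono_edges n g) = {} then 1 else 0)"
      unfolding sq by (subst sum.swap, rule sum.cong[OF refl], rule sum.swap)
    also have "\<dots> = (\<Sum>f\<in>FF. \<Sum>g\<in>FF. M * avoid_prob N m (2 * F - cell_pairs {..<k} {..<k} f g {0..<n}))"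
    proof (intro sum.cong refl)
      fix f g assume fg: "f \<in> FF" "g \<in> FF"
      have "(\<Sum>E\<in>G. if E \<inter> (mono_edges n f \<union> mono_edges n g) = {} then 1 else 0)
          = real (card {E\<in>G. E \<inter> (mono_edges n f \<union> mono_edges n g) = {}})"
        using finG by (simp add: sum.If_cases Int_def)
      also have "\<dots> = M * avoid_prob N m (card (mono_edges n f \<union> mono_edges n g))"
        using mono_edges_subset by (intro avoid) auto
      finally show "(\<Sum>E\<in>G. if E \<inter> (mono_edges n f \<union> mono_edges n g) = {} then 1 else 0)
          = M * avoid_prob N m (2 * F - cell_pairs {..<k} {..<k} f g {0..<n})"
        using fg card_mono_Un[of f k j g] by (simp add: FF_def n_def F_def)
    qed
    also have "\<dots> \<le> (\<Sum>f\<in>FF. M * ((1 + \<delta>) * real (card FF) * (avoid_prob N m F)\<^sup>2))"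
    proof (rule sum_mono)
      fix f assume "f \<in> FF"
      then have "(\<Sum>g\<in>FF. avoid_prob N m (2 * F - cell_pairs {..<k} {..<k} f g {0..<n}))
          \<le> (1 + \<delta>) * real (card FF) * (avoid_prob N m F)\<^sup>2"
        using pairs unfolding FF_def n_def N_def F_def by blast
      then show "(\<Sum>g\<in>FF. M * avoid_prob N m (2 * F - cell_pairs {..<k} {..<k} f g {0..<n}))
          \<le> M * ((1 + \<delta>) * real (card FF) * (avoid_prob N m F)\<^sup>2)"
        using M0 unfolding sum_distrib_left[symmetric] by (intro mult_left_mono) auto
    qed
    finally show ?thesis by (simp add: power_mult_distrib power2_eq_square algebra_simps)
  qed
  let ?c = "real (card {E\<in>G. X E \<noteq> 0})"
  let ?a = "real (card FF) * avoid_prob N m F"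
  have a: "?a > 0" using cFF H by simp
  have "(M * ?a)\<^sup>2 \<le> ?c * (\<Sum>E\<in>G. (X E)\<^sup>2)" using second_moment[OF finG, of X] unfolding first .
  also have "\<dots> \<le> ?c * (M * ((1 + \<delta>) * ?a\<^sup>2))" using second by (intro mult_left_mono) auto
  finally have "M * (M * ?a\<^sup>2) \<le> (?c * (1 + \<delta>)) * (M * ?a\<^sup>2)"
    by (simp add: power2_eq_square algebra_simps)
  then have "M \<le> ?c * (1 + \<delta>)" using M0 a by (simp only: mult_le_cancel_right) (auto simp: zero_less_mult_iff)
  then have "1 / (1 + \<delta>) \<le> ?c / M" using M0 \<delta> by (simp add: field_simps)
  moreover have "{E\<in>G. X E \<noteq> 0} = {E \<in> graphs_nm n m. \<exists>f\<in>FF. E \<inter> mono_edges n f = {}}"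
    unfolding G_def X_def using finFF by auto
  ultimately show ?thesis
    using m by (simp add: prob_Gnm_eq M_def N_def n_def FF_def)
qed

section \<open>First moment of equitable colourings with fewer than \<open>k\<close> colours\<close>

lemma equitable_sizes:
  fixes j k k' :: nat
  assumes k': "0 < k'" "k' < k" and f: "equitable_colouring (k * j) E k' f"
  defines "n \<equiv> k * j"
  defines "sz l \<equiv> card {v\<in>{0..<n}. f v = l}"
  defines "A \<equiv> {l. l < k' \<and> sz l = Suc (n div k')}"
  shows "card A = n mod k'" "\<And>l. l < k' \<Longrightarrow> sz l = (if l \<in> A then Suc (n div k') else n div k')"
    "j \<le> n div k'"
proof -
  have lt: "f v < k'" if "v < n" for v using f that by (auto simp: equitable_colouring_def n_def)
  have diff: "sz l \<le> sz l' + 1" if "l < k'" "l' < k'" for l l'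
    using f that unfolding equitable_colouring_def sz_def n_def by blast
  have sum: "(\<Sum>l<k'. sz l) = n"
  proof -
    have "{0..<n} = (\<Union>l<k'. {v\<in>{0..<n}. f v = l})" using lt by auto
    also have "card \<dots> = (\<Sum>l<k'. sz l)" unfolding sz_def by (intro card_UN_disjoint) auto
    finally show ?thesis by simp
  qed
  define \<mu> where "\<mu> = Min (sz ` {..<k'})"
  have "\<mu> \<in> sz ` {..<k'}" unfolding \<mu>_def using k' by (intro Min_in) auto
  then obtain l0 where l0: "l0 < k'" "sz l0 = \<mu>" by auto
  have ge: "\<mu> \<le> sz l" if "l < k'" for l unfolding \<mu>_def using that by (intro Min_le) auto
  define A' where "A' = {l. l < k' \<and> sz l = Suc \<mu>}"
  have two: "sz l = (if l \<in> A' then Suc \<mu> else \<mu>)" if "l < k'" for l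
    using diff[OF that l0(1)] ge[OF that] l0(2) that by (auto simp: A'_def)
  have "n = (\<Sum>l<k'. \<mu> + (if l \<in> A' then 1 else 0))"
    unfolding sum[symmetric] using two by (intro sum.cong) auto
  also have "\<dots> = k' * \<mu> + card A'"
    unfolding sum.distrib by (simp add: sum.If_cases A'_def Int_def conj_commute)
  finally have n: "n = k' * \<mu> + card A'" .
  have "card A' \<le> card ({..<k'} - {l0})" using l0 by (intro card_mono) (auto simp: A'_def)
  then have c: "card A' < k'" using l0 by simp
  have d: "n div k' = \<mu>" using n c by simp
  have r: "n mod k' = card A'" using n c by simp
  have "A' = A" by (simp add: A'_def A_def d)
  then show "card A = n mod k'" "\<And>l. l < k' \<Longrightarrow> sz l = (if l \<in> A then Suc (n div k') else n div k')"
    using r two d by auto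
  have "j * k' \<le> n" using k' by (simp add: n_def)
  then show "j \<le> n div k'" using k' by (simp add: less_eq_div_iff_mult_less_eq)
qed

lemma fact_add_ge: "fact j * (real j + 1) ^ x \<le> fact (j + x)"
proof (induction x)
  case (Suc x)
  have "fact j * (real j + 1) ^ Suc x = (fact j * (real j + 1) ^ x) * (real j + 1)" by simp
  also have "\<dots> \<le> fact (j + x) * (real (j + x) + 1)" using Suc by (intro mult_mono) auto
  also have "\<dots> = fact (j + Suc x)" by (simp add: algebra_simps)
  finally show ?case .
qed simp

lemma fact_power_le: "fact j ^ e \<le> (fact (e * j) :: real)"
proof (induction e)
  case (Suc e)
  have "fact j ^ Suc e \<le> fact j * (fact (e * j) :: real)" using Suc by simp
  also have "\<dots> \<le> fact (j + e * j)"
    using fact_fact_dvd_fact[of j "e * j"] dvd_imp_le[of "fact j * fact (e * j)" "fact (j + e * j) :: nat"]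
    by (metis fact_nonzero of_nat_fact of_nat_le_iff of_nat_mult neq0_conv)
  finally show ?case by simp
qed simp

text \<open>There are two regimes. If \<open>n div k' = j\<close>, then exactly \<open>e * j\<close>
  classes have an extra vertex; choosing them costs at most
  \<open>k' ^ (e * j) / fact (e * j)\<close>, and this factorial absorbs \<open>fact j ^ e\<close>.
  Otherwise all classes have more than \<open>j\<close> vertices, which forces
  \<open>k' \<le> e * j\<close>, so that the choice costs at most \<open>2 ^ (e * j)\<close>. Adding
  the two bases gives one \<open>e\<close>-th power for both regimes.\<close>

lemma first_moment_coefficient_le:
  fixes j k k' :: nat
  assumes j: "0 < j" and k': "0 < k'" "k' < k"
  defines "n \<equiv> k * j" and "e \<equiv> k - k'"
  shows "real (k' choose (n mod k')) * (fact k / fact k') * (fact j ^ e / (real j + 1) ^ (e * j))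
    \<le> (real k ^ (j + 1) / (real j + 1) ^ j + 2 ^ j * real k) ^ e"
proof -
  have ek: "fact k / fact k' \<le> real k ^ e"
  proof -
    have "k - e = k'" using k' by (simp add: e_def)
    then have "fact k / fact k' = ffact k e" using ffact_mult_fact[of e k] by (simp add: e_def field_simps)
    also have "\<dots> \<le> (\<Prod>x<e. real k)" unfolding ffact_def by (intro prod_mono) auto
    finally show ?thesis by simp
  qed
  have exc: "n = k' * j + e * j" using k' by (simp add: n_def e_def algebra_simps)
  have ja: "j \<le> n div k'" using exc k' by (simp add: less_eq_div_iff_mult_less_eq algebra_simps)
  consider "n div k' = j" | "n div k' \<ge> j + 1" using ja by linarith
  then show ?thesis
  proof cases
    case 1
    have r: "n mod k' = e * j" using mult_div_mod_eq[of k' n] exc 1 by simp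
    have "real (k' choose (e * j)) * fact j ^ e \<le> real (k' choose (e * j)) * fact (e * j)"
      using fact_power_le[of j e] by (intro mult_left_mono) auto
    also have "\<dots> \<le> real k' ^ (e * j)"
      using binomial_fact_pow[of k' "e * j"] by (metis of_nat_fact of_nat_le_iff of_nat_mult of_nat_power)
    also have "\<dots> \<le> real k ^ (e * j)" using k' by (intro power_mono) auto
    finally have 1: "real (k' choose (e * j)) * fact j ^ e \<le> real k ^ (e * j)" .
    have "real (k' choose (e * j)) * (fact k / fact k') * (fact j ^ e / (real j + 1) ^ (e * j))
        = (real (k' choose (e * j)) * fact j ^ e) * (fact k / fact k') / (real j + 1) ^ (e * j)" by simp
    also have "\<dots> \<le> real k ^ (e * j) * real k ^ e / (real j + 1) ^ (e * j)"
      using 1 ek by (intro divide_right_mono mult_mono) auto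
    also have "\<dots> = (real k ^ (j + 1) / (real j + 1) ^ j) ^ e"
      by (simp add: power_divide power_mult[symmetric] power_add[symmetric] algebra_simps)
    also have "\<dots> \<le> (real k ^ (j + 1) / (real j + 1) ^ j + 2 ^ j * real k) ^ e"
      by (intro power_mono) auto
    finally show ?thesis unfolding r .
  next
    case 2
    then have "(j + 1) * k' \<le> n" using k' less_eq_div_iff_mult_less_eq by blast
    then have "k' \<le> e * j" using exc by (simp add: algebra_simps)
    have "k' choose (n mod k') \<le> 2 ^ k'" by (rule binomial_le_pow2)
    also have "(2::nat) ^ k' \<le> 2 ^ (e * j)" using \<open>k' \<le> e * j\<close> by (intro power_increasing) auto
    finally have 1: "real (k' choose (n mod k')) \<le> 2 ^ (e * j)"
      by (metis of_nat_le_iff of_nat_numeral of_nat_power)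
    have "fact j \<le> real j ^ j" using fact_le_power[of j, where 'a = real] by simp
    also have "\<dots> \<le> (real j + 1) ^ j" by (intro power_mono) auto
    finally have "fact j ^ e \<le> ((real j + 1) ^ j) ^ e" by (intro power_mono) auto
    then have 2: "fact j ^ e / (real j + 1) ^ (e * j) \<le> 1" by (simp add: power_mult[symmetric] mult.commute)
    have "real (k' choose (n mod k')) * (fact k / fact k') * (fact j ^ e / (real j + 1) ^ (e * j))
        \<le> 2 ^ (e * j) * real k ^ e * 1"
      using 1 2 ek by (intro mult_mono) auto
    also have "\<dots> = (2 ^ j * real k) ^ e" by (simp add: power_mult_distrib power_mult[symmetric] mult.commute)
    also have "\<dots> \<le> (real k ^ (j + 1) / (real j + 1) ^ j + 2 ^ j * real k) ^ e"
      by (intro power_mono) auto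
    finally show ?thesis .
  qed
qed

text \<open>A graph with one such colouring has at least \<open>fact k'\<close> labelled ones, so
  the labelled count may be divided by \<open>fact k'\<close>. Each of the \<open>e\<close> missing
  colours forces at least \<open>Suc j choose 2\<close> further forbidden pairs, and each of these
  costs a factor \<open>q\<close>. The result is the unordered expectation for \<open>k\<close>
  colours times an \<open>e\<close>-th power.\<close>

lemma first_moment_bound:
  fixes j k k' m :: nat and q :: real
  defines "n \<equiv> k * j" and "F \<equiv> k * (j choose 2)" and "e \<equiv> k - k'"
  defines "N \<equiv> n choose 2"
  assumes j: "0 < j" and k': "0 < k'" "k' < k" and m: "0 < m" "m \<le> N"
    and q: "0 \<le> q" "q \<le> 1" "real N - real F - real m \<le> q * (real N - real F)"
  shows "prob_Gnm n m (\<lambda>E. \<exists>f. equitable_colouring n E k' f)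
    \<le> fact n / (fact j ^ k * fact k) * avoid_prob N m F *
       ((real k ^ (j + 1) / (real j + 1) ^ j + 2 ^ j * real k) * q ^ (Suc j choose 2)) ^ e"
proof -
  define a where "a = n div k'"
  define r where "r = n mod k'"
  define d where "d A l = (if l \<in> A then Suc a else a)" for A :: "nat set" and l :: nat
  define As where "As = {A. A \<subseteq> {..<k'} \<and> card A = r}"
  define ES where "ES = (\<Union>A\<in>As. fibre_functions {0..<n} {..<k'} (d A))"
  define G where "G = graphs_nm n m"
  define G1 where "G1 = {E\<in>G. \<exists>f. equitable_colouring n E k' f}"
  define M where "M = real (N choose m)"
  have M0: "M > 0" using m by (simp add: M_def)
  have finG: "finite G" by (simp add: G_def)
  have finAs: "finite As" by (auto simp: As_def)
  have finES: "finite ES" unfolding ES_def using finAs by (auto simp: finite_fibre_functions)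
  have exc: "n = k' * j + e * j" using k' by (simp add: n_def e_def algebra_simps)
  have ja: "j \<le> a" unfolding a_def using exc k' by (simp add: less_eq_div_iff_mult_less_eq algebra_simps)
  have dj: "j \<le> d A l" for A l using ja by (simp add: d_def)
  have sumd: "(\<Sum>l<k'. d A l) = n" if "A \<in> As" for A
  proof -
    have "(\<Sum>l<k'. d A l) = (\<Sum>l<k'. a + (if l \<in> A then 1 else 0))" by (intro sum.cong) (auto simp: d_def)
    also have "\<dots> = k' * a + card ({..<k'} \<inter> A)" unfolding sum.distrib by (simp add: sum.If_cases Int_def)
    also have "{..<k'} \<inter> A = A" using that by (auto simp: As_def)
    finally show ?thesis using that by (simp add: As_def a_def r_def)
  qed
  have sumdj: "(\<Sum>l<k'. d A l - j) = e * j" if "A \<in> As" for A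
  proof -
    have "(\<Sum>l<k'. d A l - j) + (\<Sum>l<k'. j) = (\<Sum>l<k'. d A l)"
      unfolding sum.distrib[symmetric] using dj by (intro sum.cong) auto
    then show ?thesis using sumd[OF that] exc by simp
  qed
  have mono_ge: "F + e * (Suc j choose 2) \<le> card (mono_edges n f)" if "f \<in> ES" for f
  proof -
    obtain A where A: "A \<in> As" and f: "f \<in> fibre_functions {0..<n} {..<k'} (d A)" using \<open>f \<in> ES\<close> by (auto simp: ES_def)
    have "card (mono_edges n f) = (\<Sum>l<k'. d A l choose 2)"
      using f by (subst card_mono_edges[of "{..<k'}"]) (auto simp: fibre_functions_def)
    \<comment> \<open>The pairs among the surplus vertices of a class are dropped; what remains is
      linear in the surplus, so only its total \<open>e * j\<close> matters.\<close>
    also have "\<dots> \<ge> (\<Sum>l<k'. (j choose 2) + j * (d A l - j))"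
    proof (rule sum_mono)
      fix l
      show "(j choose 2) + j * (d A l - j) \<le> d A l choose 2"
        using choose_two_add[of j "d A l - j"] dj[of A l] by simp
    qed
    moreover have "(\<Sum>l<k'. (j choose 2) + j * (d A l - j)) = k' * (j choose 2) + j * (e * j)"
      unfolding sum.distrib sum_distrib_left[symmetric] sumdj[OF A] by simp
    moreover have "F + e * (Suc j choose 2) = k' * (j choose 2) + j * (e * j)"
    proof -
      have "(j choose 2) + (Suc j choose 2) = j * j"
        by (induction j) (auto simp: numeral_2_eq_2)
      then have "e * (j choose 2) + e * (Suc j choose 2) = e * (j * j)" by (simp only: distrib_left[symmetric])
      moreover have "F = k' * (j choose 2) + e * (j choose 2)"
        using k' by (simp add: F_def e_def distrib_right[symmetric])
      ultimately show ?thesis by (simp add: algebra_simps)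
    qed
    ultimately show ?thesis by linarith
  qed
  have cES: "real (card ES) \<le> real (k' choose r) * (fact n / (fact j ^ k' * (real j + 1) ^ (e * j)))"
  proof -
    have "real (card ES) \<le> real (\<Sum>A\<in>As. card (fibre_functions {0..<n} {..<k'} (d A)))"
      unfolding ES_def using finAs by (intro of_nat_mono card_UN_le)
    also have "\<dots> = (\<Sum>A\<in>As. fact n / (\<Prod>l<k'. fact (d A l)))"
      unfolding of_nat_sum
    proof (rule sum.cong[OF refl])
      fix A assume "A \<in> As"
      then show "real (card (fibre_functions {0..<n} {..<k'} (d A))) = fact n / (\<Prod>l<k'. fact (d A l))"
        using card_fibre_functions[of "{..<k'}" "{0..<n}" "d A"] sumd by simp
    qed
    also have "\<dots> \<le> (\<Sum>A\<in>As. fact n / (fact j ^ k' * (real j + 1) ^ (e * j)))"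
    proof (intro sum_mono divide_left_mono)
      fix A assume A: "A \<in> As"
      have "fact j ^ k' * (real j + 1) ^ (e * j) = (\<Prod>l<k'. fact j * (real j + 1) ^ (d A l - j))"
        unfolding sumdj[OF A, symmetric] power_sum prod.distrib by simp
      also have "\<dots> \<le> (\<Prod>l<k'. fact (d A l))"
      proof (intro prod_mono conjI)
        fix l show "fact j * (real j + 1) ^ (d A l - j) \<le> fact (d A l)"
          using fact_add_ge[of j "d A l - j"] dj[of A l] by simp
      qed auto
      finally show "fact j ^ k' * (real j + 1) ^ (e * j) \<le> (\<Prod>l<k'. fact (d A l))" .
    qed (auto intro!: mult_pos_pos prod_pos)
    also have "\<dots> = real (k' choose r) * (fact n / (fact j ^ k' * (real j + 1) ^ (e * j)))"
      by (simp add: As_def n_subsets)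
    finally show ?thesis .
  qed
  have many: "fact k' \<le> card {f\<in>ES. E \<inter> mono_edges n f = {}}" if E1: "E \<in> G1" for E
  proof -
    obtain f where E: "E \<in> graphs_nm n m" and f: "equitable_colouring n E k' f"
      using E1 by (auto simp: G1_def G_def)
    define A where "A = {l. l < k' \<and> card {v\<in>{0..<n}. f v = l} = Suc (n div k')}"
    note sizes = equitable_sizes[OF k', of j E f, folded n_def, OF f, folded A_def]
    have sz: "card {v\<in>{0..<n}. f v = l} = d A l" if "l < k'" for l
      using sizes(2)[OF that] by (simp add: d_def a_def)
    have fk: "f v < k'" if "v < n" for v using f that by (auto simp: equitable_colouring_def)
    \<comment> \<open>No class is empty, hence distinct permutations of the colours give distinct
      colourings.\<close>
    have surj: "\<exists>v<n. f v = l" if "l < k'" for l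
    proof -
      have "card {v\<in>{0..<n}. f v = l} > 0" using sz[OF that] dj[of A l] j by simp
      then show ?thesis by (auto simp: card_gt_0_iff)
    qed
    have avoid: "E \<inter> mono_edges n f = {}"
      using f proper_iff_avoids_mono[OF E, of f] by (auto simp: equitable_colouring_def)
    let ?\<Phi> = "\<lambda>\<sigma>. restrict (\<sigma> \<circ> f) {0..<n}"
    have "card {\<sigma>. \<sigma> permutes {..<k'}} \<le> card {f\<in>ES. E \<inter> mono_edges n f = {}}"
    proof (rule card_inj_on_le[of ?\<Phi>])
      show "inj_on ?\<Phi> {\<sigma>. \<sigma> permutes {..<k'}}"
      proof (rule inj_onI)
        fix \<sigma> \<sigma>' assume p: "\<sigma> \<in> {\<sigma>. \<sigma> permutes {..<k'}}" "\<sigma>' \<in> {\<sigma>. \<sigma> permutes {..<k'}}" and eq: "?\<Phi> \<sigma> = ?\<Phi> \<sigma>'"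
        show "\<sigma> = \<sigma>'"
        proof
          fix l
          show "\<sigma> l = \<sigma>' l"
          proof (cases "l < k'")
            case True
            then obtain v where "v < n" "f v = l" using surj by blast
            then show ?thesis using fun_cong[OF eq, of v] by simp
          next
            case False then show ?thesis using p by (auto simp: permutes_def)
          qed
        qed
      qed
      show "?\<Phi> ` {\<sigma>. \<sigma> permutes {..<k'}} \<subseteq> {f\<in>ES. E \<inter> mono_edges n f = {}}"
      proof (rule image_subsetI)
        fix \<sigma> assume "\<sigma> \<in> {\<sigma>. \<sigma> permutes {..<k'}}"
        then have p: "\<sigma> permutes {..<k'}" by simp
        have inj: "\<sigma> x = \<sigma> y \<longleftrightarrow> x = y" for x y using permutes_inj[OF p] by (auto dest: injD)
        have "mono_edges n (?\<Phi> \<sigma>) = mono_edges n f"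
        proof -
          have "(\<forall>u\<in>x. \<forall>v\<in>x. ?\<Phi> \<sigma> u = ?\<Phi> \<sigma> v) \<longleftrightarrow> (\<forall>u\<in>x. \<forall>v\<in>x. f u = f v)" if "x \<in> all_edges n" for x
          proof -
            have "x \<subseteq> {0..<n}" using that by (simp add: all_edges_def)
            then have "?\<Phi> \<sigma> u = ?\<Phi> \<sigma> v \<longleftrightarrow> f u = f v" if "u \<in> x" "v \<in> x" for u v
              using that inj by (auto simp: subset_iff)
            then show ?thesis by blast
          qed
          then show ?thesis unfolding mono_edges_def by blast
        qed
        moreover have "\<sigma> ` A \<in> As"
        proof -
          have "card (\<sigma> ` A) = card A" using inj by (intro card_image inj_onI) simp
          moreover have "\<sigma> ` A \<subseteq> {..<k'}" using permutes_in_image[OF p] by (auto simp: A_def)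
          ultimately show ?thesis using sizes(1) by (simp add: As_def r_def)
        qed
        moreover have "?\<Phi> \<sigma> \<in> fibre_functions {0..<n} {..<k'} (d (\<sigma> ` A))"
          unfolding fibre_functions_def
        proof (intro CollectI conjI ballI)
          show "?\<Phi> \<sigma> \<in> {0..<n} \<rightarrow>\<^sub>E {..<k'}"
            using fk permutes_in_image[OF p] by auto
          fix l assume l: "l \<in> {..<k'}"
          then obtain l' where l': "l' < k'" "l = \<sigma> l'" using permutes_image[OF p] by (metis imageE lessThan_iff)
          have "{v\<in>{0..<n}. ?\<Phi> \<sigma> v = l} = {v\<in>{0..<n}. f v = l'}" using l' inj by auto
          moreover have "d (\<sigma> ` A) l = d A l'" using l' inj by (auto simp: d_def)
          ultimately show "card {v\<in>{0..<n}. ?\<Phi> \<sigma> v = l} = d (\<sigma> ` A) l" using sz[OF l'(1)] by simp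
        qed
        ultimately show "?\<Phi> \<sigma> \<in> {f\<in>ES. E \<inter> mono_edges n f = {}}" using avoid by (auto simp: ES_def)
      qed
      show "finite {f\<in>ES. E \<inter> mono_edges n f = {}}" using finES by simp
    qed
    then show ?thesis using card_permutations[of "{..<k'}" k'] by simp
  qed
  let ?H = "avoid_prob N m F * q ^ (e * (Suc j choose 2))"
  have "real (card G1) * fact k' \<le> (\<Sum>E\<in>G1. real (card {f\<in>ES. E \<inter> mono_edges n f = {}}))"
  proof -
    have "real (card G1) * fact k' = (\<Sum>E\<in>G1. fact k')" by simp
    also have "\<dots> \<le> (\<Sum>E\<in>G1. real (card {f\<in>ES. E \<inter> mono_edges n f = {}}))"
    proof (rule sum_mono)
      fix E assume "E \<in> G1"
      from of_nat_mono[OF many[OF this], where 'a = real]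
      show "fact k' \<le> real (card {f\<in>ES. E \<inter> mono_edges n f = {}})" by simp
    qed
    finally show ?thesis .
  qed
  also have "\<dots> \<le> (\<Sum>E\<in>G. real (card {f\<in>ES. E \<inter> mono_edges n f = {}}))"
    using finG by (intro sum_mono2) (auto simp: G1_def)
  also have "\<dots> = (\<Sum>E\<in>G. \<Sum>f\<in>ES. if E \<inter> mono_edges n f = {} then 1 else 0)"
    using finES by (simp add: sum.If_cases Int_def)
  also have "\<dots> = (\<Sum>f\<in>ES. \<Sum>E\<in>G. if E \<inter> mono_edges n f = {} then 1 else 0)" by (rule sum.swap)
  also have "\<dots> = (\<Sum>f\<in>ES. real (card {E\<in>G. E \<inter> mono_edges n f = {}}))"
    using finG by (simp add: sum.If_cases Int_def)
  also have "\<dots> \<le> (\<Sum>f\<in>ES. M * ?H)"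
  proof (rule sum_mono)
    fix f assume f: "f \<in> ES"
    have "real (card {E\<in>G. E \<inter> mono_edges n f = {}}) = M * avoid_prob N m (card (mono_edges n f))"
      unfolding G_def card_graphs_avoiding[OF mono_edges_subset] avoid_prob_def
      using M0 by (simp add: M_def N_def)
    also have "avoid_prob N m (card (mono_edges n f)) \<le> avoid_prob N m (F + e * (Suc j choose 2))"
      by (intro avoid_prob_antimono mono_ge f)
    also have "\<dots> \<le> ?H" by (rule avoid_prob_add_le[OF q(1) m(1) q(3) q(2)])
    finally show "real (card {E\<in>G. E \<inter> mono_edges n f = {}}) \<le> M * ?H" using M0 by simp
  qed
  also have "\<dots> = real (card ES) * (M * ?H)" by simp
  also have "\<dots> \<le> (real (k' choose r) * (fact n / (fact j ^ k' * (real j + 1) ^ (e * j)))) * (M * ?H)"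
    using cES M0 q avoid_prob_nonneg by (intro mult_right_mono) auto
  finally have "real (card G1) / M \<le> (real (k' choose r) * (fact n / (fact j ^ k' * (real j + 1) ^ (e * j)))) * ?H / fact k'"
    using M0 by (simp add: field_simps)
  also have "\<dots> = fact n / (fact j ^ k * fact k) * avoid_prob N m F * q ^ (e * (Suc j choose 2))
      * (real (k' choose r) * (fact k / fact k') * (fact j ^ e / (real j + 1) ^ (e * j)))"
  proof -
    have "(fact j :: real) ^ k = fact j ^ k' * fact j ^ e" using k' by (simp add: e_def power_add[symmetric])
    then show ?thesis by (simp add: mult_ac)
  qed
  also have "\<dots> \<le> fact n / (fact j ^ k * fact k) * avoid_prob N m F * q ^ (e * (Suc j choose 2))
      * (real k ^ (j + 1) / (real j + 1) ^ j + 2 ^ j * real k) ^ e"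
    unfolding r_def n_def e_def
    using first_moment_coefficient_le[OF j k'] q avoid_prob_nonneg by (intro mult_left_mono) auto
  also have "\<dots> = fact n / (fact j ^ k * fact k) * avoid_prob N m F *
       ((real k ^ (j + 1) / (real j + 1) ^ j + 2 ^ j * real k) * q ^ (Suc j choose 2)) ^ e"
    by (simp add: power_mult_distrib power_mult[symmetric] mult.commute)
  finally show ?thesis
    using m unfolding prob_Gnm_eq[OF m(2)[unfolded N_def]] G1_def G_def M_def N_def by simp
qed

text \<open>Equitable colourability is not monotone in the number of colours, so a union bound over
  all \<open>k' < k\<close> is taken. If the minimum is smaller than \<open>k\<close>, it is itself
  one of these \<open>k'\<close>; the value 0 is impossible as there are vertices.\<close>

lemma prob_equitable_ge:
  fixes j k m :: nat
  assumes j: "0 < j" and k: "0 < k" and m: "m \<le> (k * j) choose 2"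
  shows "prob_Gnm (k * j) m (\<lambda>E. real (eq_chromatic (k * j) E) = real (k * j) / real j)
    \<ge> prob_Gnm (k * j) m (\<lambda>E. \<exists>f\<in>balanced k j. E \<inter> mono_edges (k * j) f = {})
      - (\<Sum>k'\<in>{1..<k}. prob_Gnm (k * j) m (\<lambda>E. \<exists>f. equitable_colouring (k * j) E k' f))"
proof -
  define n where "n = k * j"
  let ?Q = "\<lambda>E. real (eq_chromatic n E) = real n / real j"
  let ?P = "\<lambda>E. \<exists>f\<in>balanced k j. E \<inter> mono_edges n f = {}"
  let ?R = "\<lambda>k' E. \<exists>f. equitable_colouring n E k' f"
  have n: "n > 0" using j k by (simp add: n_def)
  have nj: "real n / real j = real k" using j by (simp add: n_def)
  have sub: "{E \<in> graphs_nm n m. ?P E} \<subseteq> {E \<in> graphs_nm n m. ?Q E} \<union> (\<Union>k'\<in>{1..<k}. {E \<in> graphs_nm n m. ?R k' E})"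
  proof
    fix E assume "E \<in> {E \<in> graphs_nm n m. ?P E}"
    then obtain f where E: "E \<in> graphs_nm n m" and f: "f \<in> balanced k j" "E \<inter> mono_edges n f = {}" by auto
    have "equitable_colouring n E k f"
      unfolding equitable_colouring_def proper_iff_avoids_mono[OF E]
      using f by (auto simp: fibre_functions_def n_def)
    then have ex: "\<exists>f. equitable_colouring n E k f" by blast
    show "E \<in> {E \<in> graphs_nm n m. ?Q E} \<union> (\<Union>k'\<in>{1..<k}. {E \<in> graphs_nm n m. ?R k' E})"
    proof (cases "eq_chromatic n E = k")
      case True then show ?thesis using E nj by simp
    next
      case False
      have le: "eq_chromatic n E \<le> k" unfolding eq_chromatic_def by (rule Least_le[of "\<lambda>k. \<exists>f. equitable_colouring n E k f", OF ex])
      have R: "?R (eq_chromatic n E) E"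
        unfolding eq_chromatic_def by (rule LeastI[of "\<lambda>k. \<exists>f. equitable_colouring n E k f", OF ex])
      have "eq_chromatic n E \<noteq> 0"
      proof
        assume "eq_chromatic n E = 0"
        then have "\<forall>v\<in>{0..<n}. \<exists>f :: nat \<Rightarrow> nat. f v < 0" using R by (auto simp: equitable_colouring_def)
        then show False using n by auto
      qed
      then have "eq_chromatic n E \<in> {1..<k}" using le False by auto
      then show ?thesis using R E by blast
    qed
  qed
  have "card {E \<in> graphs_nm n m. ?P E} \<le> card ({E \<in> graphs_nm n m. ?Q E} \<union> (\<Union>k'\<in>{1..<k}. {E \<in> graphs_nm n m. ?R k' E}))"
    using sub by (intro card_mono) auto
  also have "\<dots> \<le> card {E \<in> graphs_nm n m. ?Q E} + card (\<Union>k'\<in>{1..<k}. {E \<in> graphs_nm n m. ?R k' E})"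
    by (rule card_Un_le)
  also have "card (\<Union>k'\<in>{1..<k}. {E \<in> graphs_nm n m. ?R k' E}) \<le> (\<Sum>k'\<in>{1..<k}. card {E \<in> graphs_nm n m. ?R k' E})"
    by (intro card_UN_le) auto
  finally have "real (card {E \<in> graphs_nm n m. ?P E})
      \<le> real (card {E \<in> graphs_nm n m. ?Q E}) + (\<Sum>k'\<in>{1..<k}. real (card {E \<in> graphs_nm n m. ?R k' E}))"
    by (simp only: of_nat_sum[symmetric] of_nat_add[symmetric] of_nat_le_iff)
  then have "real (card {E \<in> graphs_nm n m. ?P E}) / real ((n choose 2) choose m)
      \<le> (real (card {E \<in> graphs_nm n m. ?Q E}) + (\<Sum>k'\<in>{1..<k}. real (card {E \<in> graphs_nm n m. ?R k' E}))) / real ((n choose 2) choose m)"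
    by (intro divide_right_mono) auto
  then have "prob_Gnm n m ?P \<le> prob_Gnm n m ?Q + (\<Sum>k'\<in>{1..<k}. prob_Gnm n m (?R k'))"
    unfolding prob_Gnm_eq[OF m[folded n_def]] by (simp add: add_divide_distrib sum_divide_distrib)
  then show ?thesis by (simp add: n_def)
qed

text \<open>Going back from \<open>2 * F\<close> to \<open>2 * F - s\<close> divides by
  \<open>s\<close> conditional chances \<open>(N - i - m) / (N - i)\<close>, each at least its value
  at \<open>i = 2 * F\<close>.\<close>

lemma avoid_prob_twice_minus_le:
  assumes "2 * F + m < N" "s \<le> 2 * F"
  shows "avoid_prob N m (2 * F - s) \<le> avoid_prob N m (2 * F) * (real (N - 2 * F) / real (N - 2 * F - m)) ^ s"
  using assms(2)
proof (induction s)
  case (Suc s)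
  define i where "i = 2 * F - Suc s"
  let ?B = "real (N - 2 * F) / real (N - 2 * F - m)"
  have i: "Suc i = 2 * F - s" "i < 2 * F" using Suc by (auto simp: i_def)
  have iN: "i < N" using i assms by simp
  have h: "real (N - i - m) / real (N - i) \<ge> 1 / ?B"
  proof -
    have "1 / ?B = real (N - 2 * F - m) / real (N - 2 * F)" by simp
    also have "\<dots> = 1 - real m / real (N - 2 * F)" using assms by (simp add: field_simps of_nat_diff)
    also have "\<dots> \<le> 1 - real m / real (N - i)"
      using i assms by (intro diff_left_mono divide_left_mono mult_pos_pos) auto
    also have "\<dots> = real (N - i - m) / real (N - i)" using i assms by (simp add: field_simps of_nat_diff)
    finally show ?thesis .
  qed
  have B0: "?B > 0" using assms by simp
  have "avoid_prob N m i * (1 / ?B) \<le> avoid_prob N m i * (real (N - i - m) / real (N - i))"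
    using h by (intro mult_left_mono avoid_prob_nonneg)
  also have "\<dots> = avoid_prob N m (2 * F - s)" using avoid_prob_Suc[OF iN, of m] i by simp
  also have "\<dots> \<le> avoid_prob N m (2 * F) * ?B ^ s" using Suc by simp
  finally have "avoid_prob N m i / ?B \<le> avoid_prob N m (2 * F) * ?B ^ s" by simp
  then have "avoid_prob N m i \<le> avoid_prob N m (2 * F) * ?B ^ s * ?B" using B0 pos_divide_le_eq by blast
  then show ?case by (simp add: i_def mult_ac)
qed simp

text \<open>With a fixed number of edges, avoiding one set of pairs makes avoiding a disjoint one
  less likely: after \<open>F\<close> avoided pairs every further conditional chance shrinks by a
  factor \<open>1 - c\<close> with \<open>c = m * F / (N * (N - m))\<close>. For
  \<open>x = F\<close> this is the gain that has to cancel the cells of size two.\<close>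

lemma avoid_prob_superadditive:
  assumes "F + x + m < N"
  shows "avoid_prob N m (F + x) \<le> avoid_prob N m F * avoid_prob N m x
    * exp (- (real x * (real m * real F / (real N * (real N - real m)))))"
  using assms
proof (induction x)
  case 0
  then show ?case by (simp add: avoid_prob_0)
next
  case (Suc x)
  define c where "c = real m * real F / (real N * (real N - real m))"
  let ?h = "\<lambda>i. real (N - i - m) / real (N - i)"
  define u where "u = real N - real x"
  have u: "u > real F + real m" using Suc.prems by (simp add: u_def)
  have "?h (F + x) = (u - real F - real m) / (u - real F)"
    using Suc.prems by (simp add: of_nat_diff u_def algebra_simps)
  also have "\<dots> = (u - real m) / u * (1 - real m * real F / ((u - real F) * (u - real m)))"
  proof -
    have "(u - real F) * (u - real m) - real m * real F = u * (u - real F - real m)" by (simp add: algebra_simps)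
    then have "1 - real m * real F / ((u - real F) * (u - real m))
        = u * (u - real F - real m) / ((u - real F) * (u - real m))"
      using u by (simp add: diff_divide_distrib[symmetric] divide_simps)
    then show ?thesis using u by simp
  qed
  also have "\<dots> \<le> (u - real m) / u * (1 - c)"
  proof (intro mult_left_mono diff_left_mono)
    show "c \<le> real m * real F / ((u - real F) * (u - real m))"
      unfolding c_def using u Suc.prems
      by (intro divide_left_mono mult_mono mult_pos_pos) (auto simp: u_def)
  qed (use u in auto)
  also have "\<dots> \<le> (u - real m) / u * exp (- c)"
    using u exp_ge_add_one_self[of "- c"] by (intro mult_left_mono) auto
  also have "(u - real m) / u = ?h x" using Suc.prems by (simp add: u_def of_nat_diff)
  finally have h: "?h (F + x) \<le> ?h x * exp (- c)" .
  have "avoid_prob N m (F + Suc x) = avoid_prob N m (F + x) * ?h (F + x)"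
    using avoid_prob_Suc[of "F + x" N m] Suc.prems by simp
  also have "\<dots> \<le> (avoid_prob N m F * avoid_prob N m x * exp (- (real x * c))) * (?h x * exp (- c))"
    using Suc h by (intro mult_mono) (auto simp: c_def avoid_prob_nonneg intro!: mult_nonneg_nonneg)
  also have "\<dots> = avoid_prob N m F * avoid_prob N m (Suc x) * exp (- (real (Suc x) * c))"
  proof -
    have "exp (- (real (Suc x) * c)) = exp (- (real x * c)) * exp (- c)"
      by (simp add: exp_add[symmetric] algebra_simps)
    moreover have "avoid_prob N m (Suc x) = avoid_prob N m x * ?h x"
      using avoid_prob_Suc[of x N m] Suc.prems by simp
    ultimately show ?thesis by (simp only: mult_ac)
  qed
  finally show ?case by (simp add: c_def)
qed

section \<open>Elementary Stirling bounds and falling factorials\<close>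

lemma fact_ge_power: "(real n / exp 1) ^ n \<le> fact n"
proof -
  have "real n ^ n / fact n \<le> exp (real n)"
  proof -
    have "(\<Sum>i\<in>{n}. real n ^ i / fact i) \<le> (\<Sum>i. real n ^ i / fact i)"
      using summable_exp_generic[of "real n"] by (intro sum_le_suminf) (auto simp: divide_inverse mult.commute)
    then show ?thesis by (simp add: exp_def divide_inverse mult.commute)
  qed
  then have "real n ^ n \<le> exp (real n) * fact n" by (simp add: field_simps)
  then show ?thesis by (simp add: power_divide exp_of_nat_mult[symmetric] field_simps)
qed

lemma fact_le_exp_power:
  assumes "n > 0"
  shows "fact n \<le> exp 1 * real n * (real n / exp 1) ^ n"
  using assms
proof (induction n rule: nat_induct_non_zero)
  case (Suc n)
  \<comment> \<open>With exponent \<open>n\<close> the inequality would go the other way; the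
    additional factor is what puts the linear term \<open>n\<close> into the statement.\<close>
  have "exp 1 \<le> ((real n + 1) / real n) ^ Suc n"
  proof -
    have "1 \<le> real (Suc n) * ln ((real n + 1) / real n)"
    proof -
      have "ln (real n / (real n + 1)) \<le> real n / (real n + 1) - 1" using Suc by (intro ln_le_minus_one) auto
      also have "\<dots> = - 1 / (real n + 1)" by (simp add: field_simps)
      finally have "1 / (real n + 1) \<le> - ln (real n / (real n + 1))" by simp
      also have "\<dots> = ln ((real n + 1) / real n)" using Suc by (simp add: ln_div)
      finally show ?thesis by (simp add: field_simps)
    qed
    then have "exp 1 \<le> exp (real (Suc n) * ln ((real n + 1) / real n))" by simp
    also have "\<dots> = ((real n + 1) / real n) ^ Suc n" using Suc by (simp only: exp_of_nat_mult) simp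
    finally show ?thesis .
  qed
  then have "exp 1 * real n ^ Suc n \<le> (real n + 1) ^ Suc n"
    using Suc by (simp only: power_divide) (simp add: field_simps)
  then have *: "real n * (real n / exp 1) ^ n \<le> ((real n + 1) / exp 1) ^ Suc n"
    by (simp add: power_divide field_simps)
  have "fact (Suc n) = (real n + 1) * fact n" by simp
  also have "\<dots> \<le> (real n + 1) * (exp 1 * real n * (real n / exp 1) ^ n)" using Suc by (intro mult_left_mono) auto
  also have "\<dots> = exp 1 * (real n + 1) * (real n * (real n / exp 1) ^ n)" by simp
  also have "\<dots> \<le> exp 1 * (real n + 1) * ((real n + 1) / exp 1) ^ Suc n" using * by (intro mult_left_mono) auto
  finally show ?case by (simp add: add.commute)
qed simp

lemma ffact_ge_exp: "y \<le> n \<Longrightarrow> (real n / exp 1) ^ y \<le> ffact n y"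
proof (cases "y = 0")
  case False
  assume yn: "y \<le> n"
  have "(real n / exp 1) ^ y = (real n / real y) ^ y * (real y / exp 1) ^ y"
    using False by (simp add: power_divide)
  also have "\<dots> \<le> real (n choose y) * fact y"
    using yn fact_ge_power[of y] binomial_ge_n_over_k_pow_k[of y n, where 'a = real] by (intro mult_mono) auto
  also have "\<dots> = ffact n y"
  proof -
    have "ffact n y = fact n / fact (n - y)" using ffact_mult_fact[OF yn] by (simp add: field_simps)
    then show ?thesis using binomial_fact[OF yn, where 'a = real] by simp
  qed
  finally show ?thesis .
qed simp

lemma ffact_ge_diff: "y \<le> M \<Longrightarrow> M \<le> n \<Longrightarrow> (real n - real M) ^ y \<le> ffact n y"
proof -
  assume y: "y \<le> M" "M \<le> n"
  have "(real n - real M) ^ y = (\<Prod>x<y. real n - real M)" by simp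
  also have "\<dots> \<le> ffact n y" unfolding ffact_def using y by (intro prod_mono) (auto simp: of_nat_diff)
  finally show ?thesis .
qed

text \<open>If the small cores cover at most \<open>M0\<close> vertices, replacing the falling
  factorial by powers of \<open>n\<close> costs a factor \<open>\<kappa>\<close> for each vertex in
  a large core and \<open>exp (2 * M0 ^ 2 / n)\<close> once. If they cover more, only the crude
  bound \<open>4 / n\<close> per vertex holds; doubling it to \<open>8 / n\<close> buys the factor
  \<open>(1/2) ^ M0\<close>. The sum of both bounds holds in every case.\<close>

lemma inverse_ffact_le:
  fixes \<epsilon> :: real and n M0 :: nat
  defines "\<kappa> \<equiv> exp (2 * real M0 / real n) / (1 - \<epsilon>)"
  assumes n: "n > 0" and \<epsilon>: "0 \<le> \<epsilon>" "\<epsilon> \<le> 1/4" and M0: "4 * real M0 \<le> real n" and Mb: "real Mb \<le> \<epsilon> * real n"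
    and Mn: "Mb + Ms \<le> n"
  shows "1 / ffact n (Mb + Ms) \<le> exp (2 * real M0 ^ 2 / real n) * ((\<kappa> / real n) ^ Mb * (1 / real n) ^ Ms)
      + (1/2) ^ M0 * ((\<kappa> / real n) ^ Mb * (8 / real n) ^ Ms)"
proof -
  let ?r = "real n"
  have \<kappa>1: "\<kappa> \<ge> 1 / (1 - \<epsilon>)" unfolding \<kappa>_def using \<epsilon> by (intro divide_right_mono) auto
  have \<kappa>0: "\<kappa> > 0" unfolding \<kappa>_def using \<epsilon> by auto
  have b: "((1 - \<epsilon>) * ?r) ^ Mb \<le> ffact n Mb"
  proof -
    have "((1 - \<epsilon>) * ?r) ^ Mb \<le> (?r - real Mb) ^ Mb"
      using Mb \<epsilon> mult_right_mono[of \<epsilon> 1 ?r] by (intro power_mono) (auto simp: algebra_simps)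
    also have "\<dots> \<le> ffact n Mb" using Mn by (intro ffact_ge_diff) auto
    finally show ?thesis .
  qed
  have pos: "ffact n Mb > 0" "ffact (n - Mb) Ms > 0" using Mn by (auto intro: ffact_pos)
  have split: "1 / ffact n (Mb + Ms) = (1 / ffact n Mb) * (1 / ffact (n - Mb) Ms)" by (simp add: ffact_add)
  have ib: "1 / ffact n Mb \<le> (1 / ((1 - \<epsilon>) * ?r)) ^ Mb"
  proof -
    have "1 / ffact n Mb \<le> 1 / ((1 - \<epsilon>) * ?r) ^ Mb"
      using b pos n \<epsilon> by (intro divide_left_mono mult_pos_pos) auto
    then show ?thesis by (simp add: power_divide)
  qed
  show ?thesis
  proof (cases "Ms \<le> M0")
    case True
    \<comment> \<open>The conditions \<open>\<epsilon> \<le> 1/4\<close> and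
      \<open>4 * M0 \<le> n\<close> keep \<open>x\<close> below \<open>1/2\<close>, where
      \<open>1 - x \<ge> exp (- 2 * x)\<close>.\<close>
    define x where "x = (real Mb + real M0) / ?r"
    have "real Mb + real M0 \<le> ?r / 2" using Mb M0 \<epsilon> mult_right_mono[of \<epsilon> "1/4" ?r] by linarith
    then have x: "0 \<le> x" "x \<le> 1/2" using n by (auto simp: x_def divide_simps)
    have ex: "exp (- 2 * x) \<le> 1 - x"
    proof -
      have "- x - 2 * x\<^sup>2 \<le> ln (1 - x)" using x by (intro ln_one_minus_pos_lower_bound) auto
      moreover have "2 * x\<^sup>2 \<le> x" using x mult_left_mono[of x "1/2" x] by (simp add: power2_eq_square)
      ultimately have "- 2 * x \<le> ln (1 - x)" by linarith
      then have "exp (- 2 * x) \<le> exp (ln (1 - x))" by simp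
      then show ?thesis using x by simp
    qed
    have "(?r * exp (- 2 * x)) ^ Ms \<le> (?r * (1 - x)) ^ Ms" using ex by (intro power_mono mult_left_mono) auto
    also have "?r * (1 - x) = real (n - Mb) - real M0" using n Mn by (simp add: x_def field_simps of_nat_diff)
    also have "\<dots> ^ Ms \<le> ffact (n - Mb) Ms"
    proof (rule ffact_ge_diff)
      show "M0 \<le> n - Mb" using \<open>real Mb + real M0 \<le> ?r / 2\<close> by linarith
    qed fact
    finally have "1 / ffact (n - Mb) Ms \<le> 1 / (?r * exp (- 2 * x)) ^ Ms"
      using pos n by (intro divide_left_mono mult_pos_pos) auto
    also have "\<dots> = exp (2 * x * real Ms) * (1 / ?r) ^ Ms"
      by (simp add: power_mult_distrib power_divide exp_of_nat_mult[symmetric] exp_minus field_simps)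
    also have "\<dots> \<le> exp (2 * x * real M0) * (1 / ?r) ^ Ms"
      using True x by (intro mult_right_mono) (auto intro: mult_left_mono)
    also have "2 * x * real M0 = 2 * real M0 ^ 2 / ?r + real Mb * (2 * real M0 / ?r)"
      by (simp add: x_def add_divide_distrib power2_eq_square algebra_simps)
    also have "exp (2 * real M0 ^ 2 / ?r + real Mb * (2 * real M0 / ?r))
        = exp (2 * real M0 ^ 2 / ?r) * exp (2 * real M0 / ?r) ^ Mb"
      by (simp only: exp_add exp_of_nat_mult)
    finally have sm: "1 / ffact (n - Mb) Ms \<le> exp (2 * real M0 ^ 2 / ?r) * exp (2 * real M0 / ?r) ^ Mb * (1 / ?r) ^ Ms" .
    have "1 / ffact n (Mb + Ms) \<le> (1 / ((1 - \<epsilon>) * ?r)) ^ Mb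
        * (exp (2 * real M0 ^ 2 / ?r) * exp (2 * real M0 / ?r) ^ Mb * (1 / ?r) ^ Ms)"
      unfolding split using ib sm pos \<epsilon> by (intro mult_mono) auto
    also have "\<dots> = exp (2 * real M0 ^ 2 / ?r) * ((\<kappa> / ?r) ^ Mb * (1 / ?r) ^ Ms)"
      by (simp add: \<kappa>_def power_divide power_mult_distrib)
    finally show ?thesis
      using \<kappa>0 by (smt (verit, ccfv_SIG) divide_nonneg_nonneg mult_nonneg_nonneg of_nat_0_le_iff zero_le_power)
  next
    case False
    have e4: "exp 1 \<le> 4 * (1 - \<epsilon>)"
    proof -
      have "exp 1 \<le> (3 :: real)" by (rule exp_le)
      also have "3 \<le> 4 * (1 - \<epsilon>)" using \<epsilon> by (simp add: field_simps)
      finally show ?thesis .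
    qed
    have "(?r / 4) ^ Ms \<le> (real (n - Mb) / exp 1) ^ Ms"
    proof (intro power_mono)
      have "?r / 4 = ?r * (1 - \<epsilon>) / (4 * (1 - \<epsilon>))"
      proof -
        have "1 - \<epsilon> \<noteq> 0" using \<epsilon> by simp
        then show ?thesis by (metis mult.commute mult_divide_mult_cancel_left)
      qed
      also have "\<dots> \<le> ?r * (1 - \<epsilon>) / exp 1" using e4 \<epsilon> by (intro divide_left_mono) auto
      also have "\<dots> \<le> real (n - Mb) / exp 1" using Mb Mn by (intro divide_right_mono) (auto simp: of_nat_diff algebra_simps)
      finally show "?r / 4 \<le> real (n - Mb) / exp 1" .
    qed auto
    also have "\<dots> \<le> ffact (n - Mb) Ms" using Mn by (intro ffact_ge_exp) auto
    finally have "1 / ffact (n - Mb) Ms \<le> 1 / (?r / 4) ^ Ms"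
      using pos n by (intro divide_left_mono mult_pos_pos) auto
    also have "\<dots> = (4 / ?r) ^ Ms" by (simp add: power_divide)
    also have "\<dots> = (1/2) ^ Ms * (8 / ?r) ^ Ms" by (simp add: power_mult_distrib[symmetric])
    also have "\<dots> \<le> (1/2) ^ M0 * (8 / ?r) ^ Ms"
      using False by (intro mult_right_mono power_decreasing) auto
    finally have sm: "1 / ffact (n - Mb) Ms \<le> (1/2) ^ M0 * (8 / ?r) ^ Ms" .
    have "(1 / ((1 - \<epsilon>) * ?r)) ^ Mb \<le> (\<kappa> / ?r) ^ Mb"
    proof (intro power_mono)
      have "1 / ((1 - \<epsilon>) * ?r) = (1 / (1 - \<epsilon>)) / ?r" by simp
      also have "\<dots> \<le> \<kappa> / ?r" using \<kappa>1 by (intro divide_right_mono) auto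
      finally show "1 / ((1 - \<epsilon>) * ?r) \<le> \<kappa> / ?r" .
    qed (use \<epsilon> in auto)
    with ib have "1 / ffact n Mb \<le> (\<kappa> / ?r) ^ Mb" by linarith
    then have "1 / ffact n (Mb + Ms) \<le> (\<kappa> / ?r) ^ Mb * ((1/2) ^ M0 * (8 / ?r) ^ Ms)"
      unfolding split using sm pos \<kappa>0 by (intro mult_mono) auto
    also have "\<dots> = (1/2) ^ M0 * ((\<kappa> / ?r) ^ Mb * (8 / ?r) ^ Ms)" by simp
    finally show ?thesis
      using \<kappa>0 by (smt (verit, ccfv_SIG) divide_nonneg_nonneg exp_ge_zero mult_nonneg_nonneg of_nat_0_le_iff zero_le_power)
  qed
qed

text \<open>By \<open>cover\<close> every \<open>g\<close> has few matched rows or few unmatched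
  ones. In the first case the overlap is measured against avoiding \<open>2 * F\<close> pairs, each
  shared pair gaining \<open>B\<close>; this keeps the main term exact. In the second the overlap is
  close to \<open>F\<close>, so \<open>2 * F - s\<close> is read as \<open>F + (F - s)\<close> and
  each non-shared pair costs \<open>q\<close>.\<close>

lemma pair_sum_le:
  fixes j k m M1 t1 W :: nat and q b y \<alpha> \<beta> \<gamma> e1 e2 :: real and K :: "nat \<Rightarrow> real"
  defines "n \<equiv> k * j" and "F \<equiv> k * (j choose 2)"
  defines "N \<equiv> n choose 2"
  defines "B \<equiv> real (N - 2 * F) / real (N - 2 * F - m)"
  defines "S \<delta> \<equiv> (\<Sum>y=2..j. real (j choose y) * (core_weight B y * ffact j y * (if 2 * j < 3 * y then \<alpha> else \<delta>) ^ y))"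
  assumes j: "0 < j" and Fm: "2 * F + m < N" and m: "0 < m" and b: "b \<ge> 1" and q: "q = 1 / b"
    and qF: "real N - real F - real m \<le> q * (real N - real F)" and y: "y \<ge> 1" and t1: "t1 \<le> k"
    and K: "\<And>t. t \<le> t1 \<Longrightarrow> K t > 0"
    and cond: "\<And>t. t \<le> t1 \<Longrightarrow>
       real t * (\<Sum>x<2 * j div 3. real (j choose x) * (b ^ (Suc x choose 2) / K t ^ x)) \<le> K t"
    and nonneg: "0 \<le> \<alpha>" "0 \<le> \<beta>" "0 \<le> \<gamma>" "0 \<le> e1" "0 \<le> e2"
    and bound: "\<And>Mb Ms. Mb \<le> M1 \<Longrightarrow> Mb + Ms \<le> n \<Longrightarrow>
          1 / ffact n (Mb + Ms) \<le> e1 * (\<alpha> ^ Mb * \<beta> ^ Ms) + e2 * (\<alpha> ^ Mb * \<gamma> ^ Ms)"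
    and cover: "\<And>L. L \<le> k \<Longrightarrow> L * j \<le> M1 \<or> k - L \<le> t1"
    and f: "f \<in> balanced k j"
  shows "(\<Sum>g\<in>balanced k j. avoid_prob N m (2 * F - cell_pairs {..<k} {..<k} f g {0..<n}))
    \<le> (avoid_prob N m F)\<^sup>2 * exp (- (real m / (real N - real m) * (real F ^ 2 / real N)))
        * (real (card (balanced k j)) * (e1 * exp (real k ^ 2 * S \<beta>) + e2 * exp (real k ^ 2 * S \<gamma>)))
      + avoid_prob N m F * q ^ F *
        (\<Sum>t\<le>t1. real (k choose t) * (fact k / fact t) * (K t ^ (t * j) * (b ^ ((k - t) * (j choose 2)) *
          (exp (real k * defect_sum b j (real W))
             + y ^ (t * j) / y ^ W * exp (real k * defect_sum b j (y * real n))))))"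
proof -
  define s where "s g = cell_pairs {..<k} {..<k} f g {0..<n}" for g
  define V where "V = {0..<n}"
  let ?FF = "balanced k j"
  let ?A1 = "{g. g \<in> ?FF \<and> card (matched_rows V k j f g) * j \<le> M1}"
  let ?A2 = "{g. g \<in> ?FF \<and> k - card (matched_rows V k j f g) \<le> t1}"
  have finFF: "finite ?FF" by (simp add: finite_fibre_functions)
  have B1: "B \<ge> 1" unfolding B_def using Fm by (simp add: divide_simps)
  have mN: "m < N" using Fm by simp
  have sF: "s g \<le> F" if "g \<in> ?FF" for g
    using cell_pairs_le[OF f that] by (simp add: s_def n_def F_def)
  have "(\<Sum>g\<in>?FF. avoid_prob N m (2 * F - s g)) \<le> (\<Sum>g\<in>?A1 \<union> ?A2. avoid_prob N m (2 * F - s g))"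
  proof (rule sum_mono2)
    show "?FF \<subseteq> ?A1 \<union> ?A2"
    proof
      fix g assume g: "g \<in> ?FF"
      have "card (matched_rows V k j f g) \<le> card {..<k}" by (intro card_mono) (auto simp: matched_rows_def)
      then show "g \<in> ?A1 \<union> ?A2" using cover[of "card (matched_rows V k j f g)"] g by auto
    qed
  qed (use finFF avoid_prob_nonneg in auto)
  also have "\<dots> \<le> (\<Sum>g\<in>?A1. avoid_prob N m (2 * F - s g)) + (\<Sum>g\<in>?A2. avoid_prob N m (2 * F - s g))"
    using finFF avoid_prob_nonneg by (subst sum.union_inter[symmetric]) (auto intro!: sum_nonneg)
  also have "(\<Sum>g\<in>?A1. avoid_prob N m (2 * F - s g))
      \<le> (avoid_prob N m F)\<^sup>2 * exp (- (real m / (real N - real m) * (real F ^ 2 / real N)))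
        * (real (card ?FF) * (e1 * exp (real k ^ 2 * S \<beta>) + e2 * exp (real k ^ 2 * S \<gamma>)))"
  proof -
    have "(\<Sum>g\<in>?A1. avoid_prob N m (2 * F - s g)) \<le> (\<Sum>g\<in>?A1. avoid_prob N m (2 * F) * B ^ s g)"
    proof (rule sum_mono)
      fix g assume "g \<in> ?A1"
      then have "s g \<le> 2 * F" using sF[of g] by simp
      then show "avoid_prob N m (2 * F - s g) \<le> avoid_prob N m (2 * F) * B ^ s g"
        unfolding B_def by (rule avoid_prob_twice_minus_le[OF Fm])
    qed
    also have "\<dots> = avoid_prob N m (2 * F) * (\<Sum>g\<in>?A1. B ^ s g)" by (simp add: sum_distrib_left)
    also have "\<dots> \<le> ((avoid_prob N m F)\<^sup>2 * exp (- (real m / (real N - real m) * (real F ^ 2 / real N))))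
        * (real (card ?FF) * (e1 * exp (real k ^ 2 * S \<beta>) + e2 * exp (real k ^ 2 * S \<gamma>)))"
    proof (intro mult_mono)
      have "avoid_prob N m (F + F) \<le> avoid_prob N m F * avoid_prob N m F
          * exp (- (real F * (real m * real F / (real N * (real N - real m)))))"
        using Fm by (intro avoid_prob_superadditive) simp
      then show "avoid_prob N m (2 * F) \<le> (avoid_prob N m F)\<^sup>2 * exp (- (real m / (real N - real m) * (real F ^ 2 / real N)))"
        unfolding mult_2 by (simp add: power2_eq_square mult_ac)
      show "(\<Sum>g\<in>?A1. B ^ s g) \<le> real (card ?FF) * (e1 * exp (real k ^ 2 * S \<beta>) + e2 * exp (real k ^ 2 * S \<gamma>))"
        unfolding s_def S_def
        using few_matched_sum[of V B f k j \<alpha> \<beta> \<gamma> e1 e2 M1] B1 f nonneg bound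
        by (simp add: V_def n_def)
    qed (use B1 in \<open>auto intro!: sum_nonneg\<close>)
    finally show ?thesis .
  qed
  also have "(\<Sum>g\<in>?A2. avoid_prob N m (2 * F - s g)) \<le> avoid_prob N m F * q ^ F *
        (\<Sum>t\<le>t1. real (k choose t) * (fact k / fact t) * (K t ^ (t * j) * (b ^ ((k - t) * (j choose 2)) *
          (exp (real k * defect_sum b j (real W))
             + y ^ (t * j) / y ^ W * exp (real k * defect_sum b j (y * real n))))))"
  proof -
    have "(\<Sum>g\<in>?A2. avoid_prob N m (2 * F - s g)) \<le> (\<Sum>g\<in>?A2. avoid_prob N m F * q ^ F * b ^ s g)"
    proof (rule sum_mono)
      fix g assume "g \<in> ?A2"
      then have sg: "s g \<le> F" using sF[of g] by simp
      then have "avoid_prob N m (2 * F - s g) = avoid_prob N m (F + (F - s g))" by (simp add: mult_2)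
      also have "\<dots> \<le> avoid_prob N m F * q ^ (F - s g)"
        using b q qF m by (intro avoid_prob_add_le) auto
      also have "q ^ (F - s g) = q ^ F * b ^ s g"
        using sg b unfolding q by (simp add: power_diff power_divide)
      finally show "avoid_prob N m (2 * F - s g) \<le> avoid_prob N m F * q ^ F * b ^ s g" by simp
    qed
    also have "\<dots> = avoid_prob N m F * q ^ F * (\<Sum>g\<in>?A2. b ^ s g)" by (simp add: sum_distrib_left)
    also have "\<dots> \<le> avoid_prob N m F * q ^ F *
        (\<Sum>t\<le>t1. real (k choose t) * (fact k / fact t) * (K t ^ (t * j) * (b ^ ((k - t) * (j choose 2)) *
          (exp (real k * defect_sum b j (real W))
             + y ^ (t * j) / y ^ W * exp (real k * defect_sum b j (y * real n))))))"
      unfolding s_def n_def V_def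
      using many_matched_sum[of "{0..<k * j}" b y j t1 k f K W] b q y j t1 f K cond avoid_prob_nonneg[of N m F]
      by (intro mult_left_mono) auto
    finally show ?thesis .
  qed
  finally show ?thesis unfolding s_def by simp
qed

section \<open>Asymptotics of the second moment\<close>

lemma power_mult_geometric_tendsto_0:
  fixes r :: real
  assumes "0 \<le> r" "r < 1"
  shows "(\<lambda>j. real j ^ a * r ^ j) \<longlonglongrightarrow> 0"
proof (cases "a = 0 \<or> r = 0")
  case True
  then show ?thesis
  proof
    assume "a = 0" then show ?thesis using LIMSEQ_realpow_zero[OF assms] by simp
  next
    assume r: "r = 0"
    have "eventually (\<lambda>j. real j ^ a * r ^ j = 0) sequentially"
      using eventually_gt_at_top[of 0] by eventually_elim (simp add: r)
    then show ?thesis by (rule tendsto_eventually)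
  qed
next
  case False
  then have a: "a > 0" and r: "r > 0" using assms by auto
  define s where "s = root a r"
  have s: "s ^ a = r" "0 \<le> s" "s < 1" using a r assms by (auto simp: s_def)
  have "(\<lambda>j. (real j * s ^ j) ^ a) \<longlonglongrightarrow> 0 ^ a"
    using powser_times_n_limit_0[of s] s by (intro tendsto_power) auto
  moreover have "(real j * s ^ j) ^ a = real j ^ a * r ^ j" for j
    by (simp add: power_mult_distrib power_mult[symmetric] mult.commute s(1)[symmetric])
  ultimately show ?thesis using a by (simp add: zero_power)
qed

lemma poly_le_power:
  fixes w :: real
  assumes w: "w > 1"
  shows "eventually (\<lambda>j. C * real j ^ a \<le> w ^ j) sequentially"
proof -
  have "(\<lambda>j. C * (real j ^ a * (1 / w) ^ j)) \<longlonglongrightarrow> C * 0"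
    using w by (intro tendsto_mult tendsto_const power_mult_geometric_tendsto_0) auto
  then have "eventually (\<lambda>j. C * (real j ^ a * (1 / w) ^ j) < 1) sequentially"
    by (intro order_tendstoD) auto
  then show ?thesis
  proof eventually_elim
    case (elim j)
    then show ?case using w by (simp add: power_divide field_simps)
  qed
qed

lemma power_divide_cancel: "x \<noteq> 0 \<Longrightarrow> a \<le> c \<Longrightarrow> x ^ a / x ^ c = 1 / (x :: real) ^ (c - a)"
  by (simp add: power_diff)

lemma real_choose_two: "real (n choose 2) = real n * (real n - 1) / 2"
  by (induction n) (auto simp: numeral_2_eq_2 field_simps)

text \<open>The number of colours is asymptotic to \<open>b powr (j/2)\<close>; writing everything in terms of
  \<open>w = b powr (1/12)\<close> keeps all exponents integral. The constant \<open>\<epsilon>\<close> separates few from many matched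
  classes, and \<open>y\<close> absorbs factors that are subexponential in \<open>j\<close>. The last assumption is where
  \<open>p < 1 - 1 / exp 2\<close>, that is \<open>w ^ 6 < exp 1\<close>, enters.\<close>
locale colour_sequence =
  fixes p q b w \<epsilon> y :: real and k :: "nat \<Rightarrow> nat"
  assumes p: "0 < p" "p < 1" and q: "q = 1 - p" and b: "b = 1 / q"
    and w: "w > 1" "w ^ 12 = b" and k_lim: "(\<lambda>j. real (k j) / (w ^ j) ^ 6) \<longlonglongrightarrow> 1"
    and \<epsilon>: "0 < \<epsilon>" "\<epsilon> \<le> 1/4" and y: "1 < y" "y \<le> 2"
    and y\<epsilon>: "y ^ 3 * (1 - \<epsilon>) < 1" "y\<^sup>2 * w ^ 6 / (exp 1 * (1 - \<epsilon>)) < 1"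
begin

section \<open>Sizes and edge numbers along the sequence\<close>

definition X :: "nat \<Rightarrow> real" where "X j = w ^ j"

definition n :: "nat \<Rightarrow> nat" where "n j = k j * j"
definition N :: "nat \<Rightarrow> nat" where "N j = n j choose 2"
definition F :: "nat \<Rightarrow> nat" where "F j = k j * (j choose 2)"
definition m :: "nat \<Rightarrow> nat" where "m j = nat \<lfloor>p * real (N j)\<rfloor>"

lemma X_ge_1: "X j \<ge> 1" using w by (simp add: X_def)
lemma X_pos: "X j > 0" using X_ge_1[of j] by linarith
lemma b_pow: "b ^ j = X j ^ 12"
  unfolding X_def w(2)[symmetric] by (simp add: power_mult[symmetric] mult.commute)
lemma b_gt_1: "b > 1" using w one_less_power[of w 12] by simp
lemma q_bounds: "0 < q" "q < 1" using p q by auto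

lemma poly_le_X: "eventually (\<lambda>j. C * real j ^ a \<le> X j) sequentially"
  unfolding X_def by (rule poly_le_power[OF w(1)])

lemma k_le: "c > 1 \<Longrightarrow> eventually (\<lambda>j. real (k j) \<le> c * X j ^ 6) sequentially"
proof -
  assume "c > 1"
  then have "eventually (\<lambda>j. real (k j) / X j ^ 6 < c) sequentially"
    using k_lim unfolding X_def by (intro order_tendstoD) auto
  then show ?thesis
  proof eventually_elim
    case (elim j)
    then show ?case using zero_less_power[OF X_pos, of j 6] by (simp add: pos_divide_less_eq)
  qed
qed

lemma k_ge: "c > 1 \<Longrightarrow> eventually (\<lambda>j. X j ^ 6 \<le> c * real (k j)) sequentially"
proof -
  assume c: "c > 1"
  then have "eventually (\<lambda>j. real (k j) / X j ^ 6 > 1 / c) sequentially"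
    using k_lim unfolding X_def by (intro order_tendstoD) auto
  then show ?thesis
  proof eventually_elim
    case (elim j)
    then have "1 / c * X j ^ 6 < real (k j)" using zero_less_power[OF X_pos, of j 6] by (simp add: pos_less_divide_eq)
    then show ?case using c by (simp add: field_simps)
  qed
qed

lemma k_ge_const: "eventually (\<lambda>j. real (k j) \<ge> C) sequentially"
proof -
  have "eventually (\<lambda>j. X j ^ 6 \<le> 2 * real (k j)) sequentially" by (rule k_ge) simp
  moreover have "eventually (\<lambda>j. (2 * \<bar>C\<bar>) * real j ^ 0 \<le> X j) sequentially" by (rule poly_le_X)
  ultimately show ?thesis
  proof eventually_elim
    case (elim j)
    have "X j ^ 1 \<le> X j ^ 6" using X_ge_1 by (intro power_increasing) auto
    then show ?case using elim by simp
  qed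
qed

lemma F_real: "real (F j) = real (n j) * (real j - 1) / 2"
  by (simp add: F_def n_def real_choose_two)

lemma N_real: "real (N j) = real (n j) * (real (n j) - 1) / 2"
  by (simp add: N_def real_choose_two)

text \<open>Indeed \<open>F / N = (j - 1) / (n - 1)\<close>, which is at most \<open>1 / k\<close>.
  Thus forbidden pairs are an exponentially small proportion of all pairs.\<close>

lemma F_le_N:
  assumes "real (k j) \<ge> C" "j \<ge> 1" "C \<ge> 1"
  shows "C * real (F j) \<le> real (N j)"
proof -
  have "C * (real j - 1) \<le> real (k j) * (real j - 1)" using assms by (intro mult_right_mono) auto
  also have "\<dots> \<le> real (n j) - 1" using assms by (simp add: n_def algebra_simps)
  finally have "real (n j) * (C * (real j - 1)) \<le> real (n j) * (real (n j) - 1)" by (intro mult_left_mono) auto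
  from divide_right_mono[OF this, of 2] show ?thesis unfolding F_real N_real by (simp add: mult_ac)
qed

lemma m_bounds: "p * real (N j) - 1 < real (m j)" "real (m j) \<le> p * real (N j)"
proof -
  have "0 \<le> p * real (N j)" using p by simp
  then have *: "real (m j) = real_of_int \<lfloor>p * real (N j)\<rfloor>" by (simp add: m_def)
  show "p * real (N j) - 1 < real (m j)" "real (m j) \<le> p * real (N j)"
    unfolding * by linarith+
qed

lemma F_large: "eventually (\<lambda>j. real (F j) \<ge> C) sequentially"
proof -
  have "eventually (\<lambda>j. real (k j) \<ge> \<bar>C\<bar>) sequentially" by (rule k_ge_const)
  then show ?thesis using eventually_ge_at_top[of 3]
  proof eventually_elim
    case (elim j)
    have "3 * 2 \<le> real j * (real j - 1)" using elim by (intro mult_mono) auto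
    then have "real (k j) * 1 \<le> real (k j) * real (j choose 2)"
      by (intro mult_left_mono) (auto simp: real_choose_two)
    then show ?case using elim by (simp add: F_def)
  qed
qed

text \<open>Rounding lowers \<open>m\<close> by less than 1, while after \<open>F\<close> avoided
  pairs the comparison with \<open>q\<close> has a slack of \<open>p * F \<ge> 2\<close>; this
  yields the ratio needed in \<open>avoid_prob_add_le\<close>. The lower bound \<open>8 / q\<close>
  for \<open>k\<close> makes \<open>2 * F\<close> at most a quarter of \<open>q * N\<close>.\<close>

lemma sizes_ok: "eventually (\<lambda>j. 0 < j \<and> 1 \<le> real (k j) \<and> 0 < m j \<and> 2 * F j + m j < N j \<and> real (m j) \<le> p * real (N j)
    \<and> real (N j) - real (F j) - real (m j) \<le> q * (real (N j) - real (F j))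
    \<and> real (N j) * q / 2 \<le> real (N j) - 2 * real (F j) - real (m j)) sequentially"
proof -
  have "eventually (\<lambda>j. real (k j) \<ge> max 1 (8 / q)) sequentially" by (rule k_ge_const)
  moreover have "eventually (\<lambda>j. real (F j) \<ge> 2 / p) sequentially" by (rule F_large)
  ultimately show ?thesis using eventually_gt_at_top[of 0]
  proof eventually_elim
    case (elim j)
    have 1: "8 / q * real (F j) \<le> real (N j)" using elim q_bounds by (intro F_le_N) auto
    then have 2: "8 * real (F j) \<le> real (N j) * q" using q_bounds by (simp add: field_simps)
    have 3: "1 * real (F j) \<le> real (N j)" using elim by (intro F_le_N) auto
    have 4: "p * real (F j) \<ge> 2" using elim p by (simp add: field_simps)
    have 5: "p * real (N j) \<ge> p * real (F j)" using 3 p by simp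
    have 6: "real (N j) * q = real (N j) - p * real (N j)" by (simp add: q algebra_simps)
    have "0 < real (F j)" using 4 by (cases "F j = 0") auto
    have "real (m j) > 0" using m_bounds(1)[of j] 4 5 by linarith
    moreover have "2 * real (F j) + real (m j) < real (N j)"
      using m_bounds(2)[of j] 2 6 \<open>0 < real (F j)\<close> by linarith
    moreover have "real (N j) - real (F j) - real (m j) \<le> q * (real (N j) - real (F j))"
      using m_bounds(1)[of j] 4 by (simp add: q algebra_simps)
    moreover have "real (N j) * q / 2 \<le> real (N j) - 2 * real (F j) - real (m j)"
      using m_bounds(2)[of j] 2 6 by linarith
    moreover have "2 * F j + m j < N j"
      using \<open>2 * real (F j) + real (m j) < real (N j)\<close> by linarith
    ultimately show ?case using m_bounds(2)[of j] elim by simp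
  qed
qed

text \<open>For \<open>u \<le> 3\<close> nearly the full factor \<open>b ^ j = X ^ 12\<close> is
  available per exchanged vertex, at the price of \<open>b ^ 3\<close>. For larger
  \<open>u < j/3\<close> only \<open>b powr (2 * j / 3) = X ^ 8\<close> is, but at least to the
  fourth power. Four is the right threshold: for \<open>z\<close> near \<open>n\<close>, of order
  \<open>j * X ^ 6\<close>, the weaker ratio is about \<open>X ^ (-2)\<close>, and \<open>k\<close>
  such terms, with \<open>k\<close> about \<open>X ^ 6\<close>, are negligible only from the fourth
  power on.\<close>

lemma defect_sum_le:
  assumes z: "z \<ge> 0" and x1: "real j * z * b ^ 3 / X j ^ 12 \<le> 1" and x2: "real j * z / X j ^ 8 \<le> 1"
  shows "defect_sum b j z \<le> real j * (real j * z * b ^ 3 / X j ^ 12 + (real j * z / X j ^ 8) ^ 4)"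
proof -
  let ?x1 = "real j * z * b ^ 3 / X j ^ 12" and ?x2 = "real j * z / X j ^ 8"
  have b1: "b \<ge> 1" using b_gt_1 by simp
  have x0: "0 \<le> ?x1" "0 \<le> ?x2" using z b1 X_pos[of j] by auto
  have "real (j choose u) * (z ^ u / b ^ (u * (j - u))) \<le> ?x1 + ?x2 ^ 4" if u: "1 \<le> u" "3 * u < j" for u
  proof -
    have "real (j choose u) \<le> real j ^ u"
      using of_nat_mono[OF binomial_le_pow[of u j], where 'a = real] u by simp
    then have "real (j choose u) * (z ^ u / b ^ (u * (j - u))) \<le> real j ^ u * (z ^ u / b ^ (u * (j - u)))"
      using z b1 by (intro mult_right_mono) auto
    also have "\<dots> = (real j * z / b ^ (j - u)) ^ u"
      by (simp add: power_mult_distrib power_divide power_mult[symmetric] mult.commute)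
    also have "\<dots> \<le> ?x1 + ?x2 ^ 4"
    proof (cases "u \<le> 3")
      case True
      have "b ^ j = b ^ (j - u) * b ^ u" using u by (simp add: power_add[symmetric])
      also have "\<dots> \<le> b ^ (j - u) * b ^ 3" using True b1 by (intro mult_left_mono power_increasing) auto
      finally have bj: "b ^ j / b ^ 3 \<le> b ^ (j - u)" using b1 by (simp add: field_simps)
      have "real j * z / b ^ (j - u) \<le> real j * z / (b ^ j / b ^ 3)"
        using bj z b1 by (intro divide_left_mono) auto
      also have "\<dots> = ?x1" by (simp add: b_pow)
      finally have "(real j * z / b ^ (j - u)) ^ u \<le> ?x1 ^ u" using z b1 by (intro power_mono) auto
      also have "\<dots> \<le> ?x1 ^ 1" using x1 x0 u by (intro power_decreasing) auto
      finally have "(real j * z / b ^ (j - u)) ^ u \<le> ?x1" by simp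
      then show ?thesis using zero_le_power[OF x0(2), of 4] by linarith
    next
      case False
      have "X j ^ 8 = w ^ (8 * j)" by (simp add: X_def power_mult[symmetric] mult.commute)
      also have "\<dots> \<le> w ^ (12 * (j - u))" using w u by (intro power_increasing) auto
      also have "\<dots> = b ^ (j - u)" by (simp add: power_mult w(2))
      finally have "X j ^ 8 \<le> b ^ (j - u)" .
      then have "real j * z / b ^ (j - u) \<le> ?x2"
        using z X_pos[of j] b1 by (intro divide_left_mono mult_pos_pos) auto
      then have "(real j * z / b ^ (j - u)) ^ u \<le> ?x2 ^ u" using z b1 by (intro power_mono) auto
      also have "\<dots> \<le> ?x2 ^ 4" using x2 x0 False by (intro power_decreasing) auto
      finally show ?thesis using x0 by simp
    qed
    finally show ?thesis .
  qed
  then have "defect_sum b j z \<le> (\<Sum>u | 1 \<le> u \<and> 3 * u < j. ?x1 + ?x2 ^ 4)"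
    unfolding defect_sum_def by (intro sum_mono) auto
  also have "\<dots> \<le> (\<Sum>u\<in>{1..j}. ?x1 + ?x2 ^ 4)" using x0 by (intro sum_mono2) auto
  finally show ?thesis by simp
qed

lemma defect_small: "eventually (\<lambda>j. exp (real (k j) * defect_sum b j (real (j ^ 4))) \<le> 2) sequentially"
proof -
  have "eventually (\<lambda>j. real (k j) \<le> 2 * X j ^ 6) sequentially" by (rule k_le) simp
  moreover have "eventually (\<lambda>j. (8 * b ^ 3) * real j ^ 6 \<le> X j) sequentially" by (rule poly_le_X)
  moreover have "eventually (\<lambda>j. 8 * real j ^ 21 \<le> X j) sequentially" by (rule poly_le_X)
  moreover have "eventually (\<lambda>j. j \<ge> 1) sequentially" by (rule eventually_ge_at_top)
  ultimately show ?thesis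
  proof eventually_elim
    case (elim j)
    let ?x = "X j"
    have x1: "?x \<ge> 1" by (rule X_ge_1)
    have le6: "?x \<le> ?x ^ i" if "i \<ge> 1" for i using power_increasing[OF that x1] by simp
    have b1: "b ^ 3 \<ge> 1" "b \<ge> 0" using b_gt_1 by auto
    have j1: "real j \<ge> 1" using elim by simp
    have j5: "real j ^ 5 \<le> real j ^ 6" "real j ^ 5 \<le> real j ^ 21"
      using j1 by (auto intro!: power_increasing)
    have a: "real j * real (j ^ 4) = real j ^ 5" by (simp add: power_Suc[symmetric])
    have h1: "real j ^ 5 * b ^ 3 \<le> ?x"
    proof -
      have "real j ^ 5 * b ^ 3 \<le> real j ^ 6 * b ^ 3" using j5 b1 by (intro mult_right_mono) auto
      also have "\<dots> \<le> 8 * b ^ 3 * real j ^ 6" using b1 by simp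
      finally show ?thesis using elim by linarith
    qed
    have h2: "real j ^ 5 \<le> ?x" using j5 elim by (smt (verit) zero_le_power of_nat_0_le_iff)
    have "defect_sum b j (real (j ^ 4)) \<le> real j * (real j * real (j ^ 4) * b ^ 3 / ?x ^ 12 + (real j * real (j ^ 4) / ?x ^ 8) ^ 4)"
      using h1 h2 le6[of 12] le6[of 8] X_pos[of j] by (intro defect_sum_le) (auto simp only: a divide_le_eq_1_pos zero_less_power, linarith+)
    also have "\<dots> = real j ^ 6 * b ^ 3 / ?x ^ 12 + real j ^ 21 / ?x ^ 32"
      unfolding a by (simp add: distrib_left power_divide power_mult[symmetric] power_Suc[symmetric] mult.assoc[symmetric] del: power_Suc)
    finally have "real (k j) * defect_sum b j (real (j ^ 4)) \<le> (2 * ?x ^ 6) * (real j ^ 6 * b ^ 3 / ?x ^ 12 + real j ^ 21 / ?x ^ 32)"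
      using elim defect_sum_nonneg[of b "real (j ^ 4)" j] b_gt_1 by (intro mult_mono) auto
    also have "\<dots> = 2 * b ^ 3 * real j ^ 6 / ?x ^ 6 + 2 * real j ^ 21 / ?x ^ 26"
    proof -
      have "?x ^ 6 / ?x ^ 12 = 1 / ?x ^ 6" "?x ^ 6 / ?x ^ 32 = 1 / ?x ^ 26"
        using X_pos[of j] power_divide_cancel[of ?x 6 12] power_divide_cancel[of ?x 6 32] by auto
      moreover have "(2 * ?x ^ 6) * (real j ^ 6 * b ^ 3 / ?x ^ 12 + real j ^ 21 / ?x ^ 32)
          = 2 * b ^ 3 * real j ^ 6 * (?x ^ 6 / ?x ^ 12) + 2 * real j ^ 21 * (?x ^ 6 / ?x ^ 32)"
        by (simp add: distrib_left mult_ac)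
      ultimately show ?thesis by simp
    qed
    also have "\<dots> \<le> 1/4 + 1/4"
      using elim le6[of 6] le6[of 26] X_pos[of j] by (intro add_mono) (auto simp: divide_le_eq)
    finally have "real (k j) * defect_sum b j (real (j ^ 4)) \<le> 1/2" by simp
    then have "exp (real (k j) * defect_sum b j (real (j ^ 4))) \<le> exp (1/2)" by simp
    also have "\<dots> \<le> 2" using exp_bound_half[of "1/2 :: real"] by simp
    finally show ?case .
  qed
qed

text \<open>For \<open>z\<close> of order \<open>n\<close> the exponent is still
  \<open>O(j ^ 3)\<close>, the main part coming from \<open>u \<le> 3\<close>. This is why the
  cut-off \<open>W\<close> is chosen as \<open>j ^ 4\<close>: then \<open>y ^ W\<close> wins for
  every fixed \<open>y > 1\<close>.\<close>

lemma defect_large: "eventually (\<lambda>j. exp (real (k j) * defect_sum b j (y * real (n j))) / y ^ (j ^ 4) \<le> 1) sequentially"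
proof -
  have "eventually (\<lambda>j. real (k j) \<le> 2 * X j ^ 6) sequentially" by (rule k_le) simp
  moreover have "eventually (\<lambda>j. (4 * b ^ 3) * real j ^ 2 \<le> X j) sequentially" by (rule poly_le_X)
  moreover have "eventually (\<lambda>j. 512 * real j ^ 9 \<le> X j) sequentially" by (rule poly_le_X)
  moreover have "eventually (\<lambda>j. real j \<ge> (8 * b ^ 3 + 1) / ln y) sequentially"
    using filterlim_real_sequentially unfolding filterlim_at_top by blast
  moreover have "eventually (\<lambda>j. j \<ge> 1) sequentially" by (rule eventually_ge_at_top)
  ultimately show ?thesis
  proof eventually_elim
    case (elim j)
    let ?x = "X j"
    have x1: "?x \<ge> 1" by (rule X_ge_1)
    have le6: "?x \<le> ?x ^ i" if "i \<ge> 1" for i using power_increasing[OF that x1] by simp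
    have b1: "b ^ 3 \<ge> 1" "b \<ge> 0" using b_gt_1 by auto
    have j1: "real j \<ge> 1" using elim by simp
    have z: "y * real (n j) \<le> 4 * real j * ?x ^ 6"
    proof -
      have "y * real (n j) \<le> 2 * (2 * ?x ^ 6 * real j)"
        unfolding n_def using elim y by (intro mult_mono) auto
      then show ?thesis by (simp add: mult_ac)
    qed
    have jz: "real j * (y * real (n j)) \<le> 4 * real j ^ 2 * ?x ^ 6"
    proof -
      have "real j * (y * real (n j)) \<le> real j * (4 * real j * ?x ^ 6)" using z by (intro mult_left_mono) auto
      then show ?thesis by (simp add: power2_eq_square)
    qed
    have z0: "0 \<le> y * real (n j)" using y by simp
    have A: "real j * (y * real (n j)) * b ^ 3 / ?x ^ 12 \<le> 4 * b ^ 3 * real j ^ 2 / ?x ^ 6"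
    proof -
      have "real j * (y * real (n j)) * b ^ 3 / ?x ^ 12 \<le> (4 * real j ^ 2 * ?x ^ 6) * b ^ 3 / ?x ^ 12"
        using jz b1 X_pos[of j] by (intro divide_right_mono mult_right_mono) auto
      also have "\<dots> = 4 * b ^ 3 * real j ^ 2 * (?x ^ 6 / ?x ^ 12)" by simp
      also have "?x ^ 6 / ?x ^ 12 = 1 / ?x ^ 6" using X_pos[of j] power_divide_cancel[of ?x 6 12] by auto
      finally show ?thesis by simp
    qed
    have B: "real j * (y * real (n j)) / ?x ^ 8 \<le> 4 * real j ^ 2 / ?x ^ 2"
    proof -
      have "real j * (y * real (n j)) / ?x ^ 8 \<le> (4 * real j ^ 2 * ?x ^ 6) / ?x ^ 8"
        using jz X_pos[of j] by (intro divide_right_mono) auto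
      also have "\<dots> = 4 * real j ^ 2 * (?x ^ 6 / ?x ^ 8)" by simp
      also have "?x ^ 6 / ?x ^ 8 = 1 / ?x ^ 2" using X_pos[of j] power_divide_cancel[of ?x 6 8] by auto
      finally show ?thesis by simp
    qed
    have "4 * real j ^ 2 \<le> 4 * b ^ 3 * real j ^ 2" using b1 by (intro mult_right_mono) auto
    then have j2: "4 * real j ^ 2 \<le> ?x" using elim by linarith
    have A1: "4 * b ^ 3 * real j ^ 2 / ?x ^ 6 \<le> 1" and B1: "4 * real j ^ 2 / ?x ^ 2 \<le> 1"
      using elim le6[of 6] le6[of 2] j2 X_pos[of j] by (auto simp: divide_le_eq)
    have "defect_sum b j (y * real (n j)) \<le> real j * (real j * (y * real (n j)) * b ^ 3 / ?x ^ 12 + (real j * (y * real (n j)) / ?x ^ 8) ^ 4)"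
      using A B A1 B1 z0 by (intro defect_sum_le) auto
    also have "\<dots> \<le> real j * (4 * b ^ 3 * real j ^ 2 / ?x ^ 6 + (4 * real j ^ 2 / ?x ^ 2) ^ 4)"
      using A B z0 X_pos[of j] by (intro mult_left_mono add_mono power_mono) auto
    finally have "real (k j) * defect_sum b j (y * real (n j))
        \<le> (2 * ?x ^ 6) * (real j * (4 * b ^ 3 * real j ^ 2 / ?x ^ 6 + (4 * real j ^ 2 / ?x ^ 2) ^ 4))"
      using elim defect_sum_nonneg[of b "y * real (n j)" j] b_gt_1 z0 by (intro mult_mono) auto
    also have "\<dots> = 8 * b ^ 3 * real j ^ 3 + 512 * real j ^ 9 / ?x ^ 2"
    proof -
      have "?x ^ 6 / ?x ^ 8 = 1 / ?x ^ 2" "?x ^ 6 / ?x ^ 6 = 1"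
        using X_pos[of j] power_divide_cancel[of ?x 6 8] by auto
      moreover have "(4 * real j ^ 2 / ?x ^ 2) ^ 4 = 256 * real j ^ 8 / ?x ^ 8"
        by (simp add: power_divide power_mult_distrib power_mult[symmetric])
      moreover have "(2 * ?x ^ 6) * (real j * (4 * b ^ 3 * real j ^ 2 / ?x ^ 6 + 256 * real j ^ 8 / ?x ^ 8))
          = 8 * b ^ 3 * (real j * real j ^ 2) * (?x ^ 6 / ?x ^ 6) + 512 * (real j * real j ^ 8) * (?x ^ 6 / ?x ^ 8)"
        by (simp add: distrib_left mult_ac)
      moreover have "real j * real j ^ 2 = real j ^ 3" "real j * real j ^ 8 = real j ^ 9"
        by (simp_all add: power_Suc[symmetric] del: power_Suc)
      ultimately show ?thesis by simp
    qed
    also have "512 * real j ^ 9 / ?x ^ 2 \<le> 1" using elim le6[of 2] X_pos[of j] by (simp add: divide_le_eq)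
    also have "1 \<le> real j ^ 3" using j1 by simp
    finally have 1: "real (k j) * defect_sum b j (y * real (n j)) \<le> (8 * b ^ 3 + 1) * real j ^ 3"
      by (simp add: distrib_right)
    have "(8 * b ^ 3 + 1) \<le> real j * ln y" using elim y by (simp add: field_simps)
    then have "(8 * b ^ 3 + 1) * real j ^ 3 \<le> (real j * ln y) * real j ^ 3" by (intro mult_right_mono) auto
    also have "\<dots> = real (j ^ 4) * ln y" by (simp add: power_Suc[symmetric] mult_ac)
    finally have "exp (real (k j) * defect_sum b j (y * real (n j))) \<le> exp (real (j ^ 4) * ln y)" using 1 by simp
    also have "\<dots> = y ^ (j ^ 4)" using y by (simp only: exp_of_nat_mult) simp
    finally show ?case using y by (simp add: divide_le_eq)
  qed
qed

text \<open>A multiple \<open>y * t\<close> is what \<open>K_cond\<close> asks for when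
  \<open>t\<close> is large. For small \<open>t\<close> the floor \<open>X ^ 5\<close> lies strictly
  between \<open>X ^ 4 = b powr (j/3)\<close>, which it must exceed for the sum over cell sizes to
  converge, and \<open>X ^ 6\<close>, the order of \<open>k\<close>, against which its
  \<open>j\<close>-th power must be negligible.\<close>

definition K :: "nat \<Rightarrow> nat \<Rightarrow> real" where
  "K j t = y * max (real t) (X j ^ 5)"

lemma K_pos: "K j t > 0"
  unfolding K_def using y zero_less_power[OF X_pos, of j 5] by (intro mult_pos_pos) linarith+

text \<open>The bound \<open>3 * (x + 1) \<le> 2 * j\<close> on cells makes
  \<open>b ^ (Suc x choose 2)\<close> at most \<open>X ^ (4 * x)\<close>. The terms are therefore
  dominated by a geometric series with ratio \<open>j * X ^ 4 / K \<le> j / X\<close>, whose sum is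
  at most \<open>y\<close>.\<close>

lemma K_cond: "eventually (\<lambda>j. \<forall>t. real t * (\<Sum>x<2 * j div 3. real (j choose x) * (b ^ (Suc x choose 2) / K j t ^ x)) \<le> K j t) sequentially"
proof -
  have "eventually (\<lambda>j. (y / (y - 1)) * real j ^ 1 \<le> X j) sequentially" by (rule poly_le_X)
  then show ?thesis
  proof eventually_elim
    case (elim j)
    show ?case
    proof
      fix t
      define r where "r = real j * X j ^ 4 / K j t"
      have K5: "K j t \<ge> X j ^ 5"
      proof -
        have "1 * X j ^ 5 \<le> y * max (real t) (X j ^ 5)" using y X_pos[of j] by (intro mult_mono) auto
        then show ?thesis by (simp add: K_def)
      qed
      have r0: "0 \<le> r" using K_pos[of j t] X_pos[of j] by (simp add: r_def)
      have "r \<le> real j * X j ^ 4 / X j ^ 5" unfolding r_def using K5 X_pos[of j] K_pos[of j t]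
        by (intro divide_left_mono mult_pos_pos) auto
      also have "\<dots> = real j / X j" using X_pos[of j] by (simp add: field_simps power_Suc[symmetric] del: power_Suc)
      also have "\<dots> \<le> (y - 1) / y" using elim y X_pos[of j] by (simp add: field_simps)
      finally have r1: "r \<le> (y - 1) / y" .
      have "(\<Sum>x<2 * j div 3. real (j choose x) * (b ^ (Suc x choose 2) / K j t ^ x)) \<le> (\<Sum>x<2 * j div 3. r ^ x)"
      proof (rule sum_mono)
        fix x assume "x \<in> {..<2 * j div 3}"
        then have x: "3 * (x + 1) \<le> 2 * j" by auto
        have c: "real (j choose x) \<le> real j ^ x"
          using of_nat_mono[OF binomial_le_pow[of x j], where 'a = real] x by simp
        have "12 * (Suc x choose 2) = 6 * (x * (x + 1))"
        proof -
          have "2 * (Suc x choose 2) = x * (x + 1)" by (induction x) (auto simp: numeral_2_eq_2)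
          then show ?thesis by simp
        qed
        also have "\<dots> \<le> 4 * j * x" using mult_right_mono[OF x, of "2 * x"] by (simp add: algebra_simps)
        finally have "w ^ (12 * (Suc x choose 2)) \<le> w ^ (4 * j * x)" using w by (intro power_increasing) auto
        then have "b ^ (Suc x choose 2) \<le> (X j ^ 4) ^ x"
          by (simp only: power_mult[of w] w(2)) (simp add: X_def power_mult[symmetric] mult_ac)
        then have "real (j choose x) * (b ^ (Suc x choose 2) / K j t ^ x) \<le> real j ^ x * ((X j ^ 4) ^ x / K j t ^ x)"
          using c K_pos[of j t] b_gt_1 by (intro mult_mono divide_right_mono) auto
        also have "\<dots> = r ^ x" by (simp add: r_def power_divide power_mult_distrib)
        finally show "real (j choose x) * (b ^ (Suc x choose 2) / K j t ^ x) \<le> r ^ x" .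
      qed
      also have "\<dots> \<le> y"
      proof -
        have r2: "r < 1" using r1 y by (smt (verit) divide_less_eq_1_pos)
        have "(\<Sum>x<2 * j div 3. r ^ x) \<le> (\<Sum>x. r ^ x)" using r0 r2 by (intro sum_le_suminf summable_geometric) auto
        also have "\<dots> = 1 / (1 - r)" using r0 r2 by (intro suminf_geometric) auto
        also have "\<dots> \<le> 1 / (1 / y)"
        proof (intro divide_left_mono)
          have "(y - 1) / y = 1 - 1 / y" using y by (simp add: field_simps)
          then show "1 / y \<le> 1 - r" using r1 by linarith
        qed (use r2 y in auto)
        finally show ?thesis by simp
      qed
      finally have "real t * (\<Sum>x<2 * j div 3. real (j choose x) * (b ^ (Suc x choose 2) / K j t ^ x)) \<le> real t * y"
        by (intro mult_left_mono) auto
      also have "\<dots> \<le> K j t" unfolding K_def using y by (simp add: mult.commute)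
      finally show "real t * (\<Sum>x<2 * j div 3. real (j choose x) * (b ^ (Suc x choose 2) / K j t ^ x)) \<le> K j t" .
    qed
  qed
qed

definition t1 :: "nat \<Rightarrow> nat" where "t1 j = nat \<lfloor>(1 - \<epsilon>) * real (k j)\<rfloor>"

lemma t1_le: "real (t1 j) \<le> (1 - \<epsilon>) * real (k j)" "t1 j \<le> k j"
proof -
  have 0: "0 \<le> (1 - \<epsilon>) * real (k j)" using \<epsilon> by simp
  then show 1: "real (t1 j) \<le> (1 - \<epsilon>) * real (k j)" unfolding t1_def by simp
  have "(1 - \<epsilon>) * real (k j) \<le> 1 * real (k j)" using \<epsilon> by (intro mult_right_mono) auto
  then show "t1 j \<le> k j" using 1 by simp
qed

lemma b_choose_two: "b ^ (j choose 2) = (X j ^ 6) ^ (j - 1)"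
proof -
  have "b ^ (j choose 2) = w ^ (12 * (j choose 2))" by (simp add: power_mult w(2))
  also have "\<dots> = (X j ^ 6) ^ (j - 1)"
    unfolding twelve_choose_two X_def by (simp add: power_mult[symmetric] mult_ac)
  finally show ?thesis .
qed

text \<open>Since \<open>b ^ (j choose 2)\<close> is about \<open>k ^ (j - 1)\<close>, it is enough
  to bound the \<open>t\<close>-th root. For \<open>t \<ge> X ^ 5\<close> Stirling reduces it to
  \<open>exp 2 * y ^ (3 * j) * (t / k) ^ (j - 2)\<close>, which is small because
  \<open>t \<le> (1 - \<epsilon>) * k\<close> and \<open>y ^ 3 * (1 - \<epsilon>) < 1\<close>. For
  smaller \<open>t\<close> it is at most \<open>k ^ 2 * (y ^ 3 * X ^ 5 / k) ^ j\<close>, of order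
  \<open>X ^ 12 * (16 / X) ^ j\<close>; this explains the requirement
  \<open>j \<ge> 13\<close>.\<close>

lemma unmatched_term:
  "eventually (\<lambda>j. \<forall>t\<le>t1 j. real (k j choose t) / fact t * ((y * K j t) ^ j / b ^ (j choose 2)) ^ t \<le> (1/2) ^ t) sequentially"
proof -
  let ?r = "y ^ 3 * (1 - \<epsilon>)"
  have "(\<lambda>j. exp 2 * y ^ 6 * (real j ^ 0 * ?r ^ j)) \<longlonglongrightarrow> exp 2 * y ^ 6 * 0"
    using y\<epsilon> y \<epsilon> by (intro tendsto_mult tendsto_const power_mult_geometric_tendsto_0) auto
  then have "eventually (\<lambda>j. exp 2 * y ^ 6 * ?r ^ j < 1/2) sequentially"
    by (intro order_tendstoD) auto
  then have ev1: "eventually (\<lambda>j. exp 2 * y ^ 6 * ?r ^ (j - 2) < 1/2) sequentially"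
    by (rule eventually_compose_filterlim[OF _ filterlim_minus_const_nat_at_top])
  have "eventually (\<lambda>j. real (k j) \<le> y * X j ^ 6) sequentially" by (rule k_le) (use y in simp)
  moreover have "eventually (\<lambda>j. X j ^ 6 \<le> 2 * real (k j)) sequentially" by (rule k_ge) simp
  moreover have "eventually (\<lambda>j. (8 * 16 ^ 13) * real j ^ 0 \<le> X j) sequentially" by (rule poly_le_X)
  moreover have "eventually (\<lambda>j. real (k j) \<ge> 1) sequentially" by (rule k_ge_const)
  moreover have "eventually (\<lambda>j. j \<ge> 13) sequentially" by (rule eventually_ge_at_top)
  ultimately show ?thesis using ev1
  proof eventually_elim
    case (elim j)
    show ?case
    proof (intro allI impI)
      fix t assume t: "t \<le> t1 j"
      let ?k = "real (k j)" and ?t = "real t"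
      have X0: "X j > 0" by (rule X_pos)
      have k0: "?k > 0" using elim by linarith
      show "real (k j choose t) / fact t * ((y * K j t) ^ j / b ^ (j choose 2)) ^ t \<le> (1/2) ^ t"
      proof (cases "t = 0")
        case False
        then have t0: "?t > 0" by simp
        have c1: "real (k j choose t) / fact t \<le> ?k ^ t / (fact t)\<^sup>2"
        proof -
          have "real (k j choose t) * fact t \<le> ?k ^ t"
            using of_nat_mono[OF binomial_fact_pow[of "k j" t], where 'a = real] by simp
          then show ?thesis by (simp add: power2_eq_square field_simps)
        qed
        have bX: "1 / b ^ (j choose 2) \<le> (y / ?k) ^ (j - 1)"
        proof -
          have "(?k / y) ^ (j - 1) \<le> (X j ^ 6) ^ (j - 1)" using elim y by (intro power_mono) (auto simp: divide_le_eq mult.commute)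
          then have "1 / b ^ (j choose 2) \<le> 1 / (?k / y) ^ (j - 1)"
            unfolding b_choose_two using k0 y X0 by (intro divide_left_mono mult_pos_pos) auto
          then show ?thesis by (simp add: power_divide)
        qed
        have A: "(y * K j t) ^ j / b ^ (j choose 2) \<le> y ^ (2 * j) * K j t ^ j / ?k ^ (j - 1)"
        proof -
          have "(y * K j t) ^ j * (1 / b ^ (j choose 2)) \<le> (y * K j t) ^ j * (y / ?k) ^ (j - 1)"
            using bX y K_pos[of j t] by (intro mult_left_mono) auto
          also have "\<dots> = (y ^ j * y ^ (j - 1)) * K j t ^ j / ?k ^ (j - 1)"
            by (simp add: power_mult_distrib power_divide)
          also have "y ^ j * y ^ (j - 1) \<le> y ^ (2 * j)"
            using y unfolding power_add[symmetric] by (intro power_increasing) auto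
          finally show ?thesis using K_pos[of j t] k0 by (simp add: divide_right_mono mult_right_mono)
        qed
        have A0: "0 \<le> (y * K j t) ^ j / b ^ (j choose 2)" using y K_pos[of j t] b_gt_1 by simp
        have jj: "j = Suc (j - 1)" "j - 1 = Suc (j - 2)" using elim by auto
        consider "X j ^ 5 \<le> ?t" | "?t < X j ^ 5" by linarith
        then show ?thesis
        proof cases
          case 1
          have K: "K j t = y * ?t" using 1 by (simp add: K_def)
          have f: "1 / (fact t :: real) \<le> (exp 1 / ?t) ^ t"
          proof -
            have "1 / (fact t :: real) \<le> 1 / (?t / exp 1) ^ t"
              using fact_ge_power[of t] t0 by (intro divide_left_mono mult_pos_pos) auto
            then show ?thesis by (simp add: power_divide)
          qed
          have "real (k j choose t) / fact t \<le> ?k ^ t * (1 / (fact t :: real)) ^ 2"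
            using c1 by (simp add: power_divide)
          also have "\<dots> \<le> ?k ^ t * ((exp 1 / ?t) ^ t) ^ 2" using f by (intro mult_left_mono power_mono) auto
          also have "\<dots> = (?k * (exp 1 / ?t) ^ 2) ^ t" by (simp add: power_mult_distrib power_mult[symmetric] mult.commute)
          finally have c2: "real (k j choose t) / fact t \<le> (?k * (exp 1 / ?t) ^ 2) ^ t" .
          have "real (k j choose t) / fact t * ((y * K j t) ^ j / b ^ (j choose 2)) ^ t
              \<le> (?k * (exp 1 / ?t) ^ 2) ^ t * (y ^ (2 * j) * K j t ^ j / ?k ^ (j - 1)) ^ t"
            using c2 A A0 k0 by (intro mult_mono power_mono) auto
          also have "\<dots> = (?k * (exp 1 / ?t) ^ 2 * (y ^ (2 * j) * K j t ^ j / ?k ^ (j - 1))) ^ t"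
            by (simp only: power_mult_distrib)
          finally have le: "real (k j choose t) / fact t * ((y * K j t) ^ j / b ^ (j choose 2)) ^ t
              \<le> (?k * (exp 1 / ?t) ^ 2 * (y ^ (2 * j) * K j t ^ j / ?k ^ (j - 1))) ^ t" .
          have "?k * (exp 1 / ?t) ^ 2 * (y ^ (2 * j) * K j t ^ j / ?k ^ (j - 1))
              = exp 2 * y ^ (3 * j) * (?t / ?k) ^ (j - 2)"
          proof -
            have e: "(exp 1)\<^sup>2 = (exp 2 :: real)" by (simp add: power2_eq_square exp_add[symmetric])
            have "j = 2 + (j - 2)" using elim by simp
            then have tj: "?t ^ j = ?t\<^sup>2 * ?t ^ (j - 2)" by (metis power_add)
            have kj: "?k ^ (j - 1) = ?k * ?k ^ (j - 2)" by (subst jj(2)) simp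
            have yj: "y ^ (3 * j) = y ^ (2 * j) * y ^ j" by (simp add: power_add[symmetric])
            show ?thesis unfolding K power_mult_distrib power_divide e tj kj yj using t0 k0 by simp
          qed
          also have "\<dots> \<le> exp 2 * y ^ (3 * j) * (1 - \<epsilon>) ^ (j - 2)"
          proof -
            have "?t \<le> (1 - \<epsilon>) * ?k" using t t1_le(1)[of j] by (meson of_nat_mono order_trans)
            then have "?t / ?k \<le> 1 - \<epsilon>" using k0 by (simp add: divide_le_eq)
            then show ?thesis using y k0 by (intro mult_left_mono power_mono) auto
          qed
          also have "\<dots> = exp 2 * y ^ 6 * ?r ^ (j - 2)"
          proof -
            have "3 * j = 6 + 3 * (j - 2)" using elim by simp
            then show ?thesis by (simp add: power_add power_mult power_mult_distrib)
          qed
          also have "\<dots> \<le> 1/2" using elim by simp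
          finally have "?k * (exp 1 / ?t) ^ 2 * (y ^ (2 * j) * K j t ^ j / ?k ^ (j - 1)) \<le> 1/2" .
          moreover have "0 \<le> ?k * (exp 1 / ?t) ^ 2 * (y ^ (2 * j) * K j t ^ j / ?k ^ (j - 1))"
            using y k0 K_pos[of j t] by auto
          ultimately show ?thesis using le power_mono order_trans by blast
        next
          case 2
          have K: "K j t = y * X j ^ 5" using 2 by (simp add: K_def)
          have "real (k j choose t) / fact t \<le> ?k ^ t / 1"
            by (rule order_trans[OF c1], intro divide_left_mono) (auto simp: fact_ge_1)
          then have "real (k j choose t) / fact t * ((y * K j t) ^ j / b ^ (j choose 2)) ^ t
              \<le> ?k ^ t * (y ^ (2 * j) * K j t ^ j / ?k ^ (j - 1)) ^ t"
            using A A0 k0 by (intro mult_mono power_mono) auto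
          also have "\<dots> = (?k * (y ^ (2 * j) * K j t ^ j / ?k ^ (j - 1))) ^ t"
            by (simp only: power_mult_distrib)
          finally have le: "real (k j choose t) / fact t * ((y * K j t) ^ j / b ^ (j choose 2)) ^ t
              \<le> (?k * (y ^ (2 * j) * K j t ^ j / ?k ^ (j - 1))) ^ t" .
          have "?k * (y ^ (2 * j) * K j t ^ j / ?k ^ (j - 1)) = ?k\<^sup>2 * (y ^ 3 * X j ^ 5 / ?k) ^ j"
          proof -
            have kj: "?k ^ j = ?k * ?k ^ (j - 1)" by (subst jj(1)) simp
            have yj: "y ^ (3 * j) = y ^ (2 * j) * y ^ j" by (simp add: power_add[symmetric])
            have "(y ^ 3) ^ j = y ^ (2 * j) * y ^ j" unfolding yj[symmetric] by (simp add: power_mult)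
            then show ?thesis unfolding K power_mult_distrib power_divide kj using k0
              by (simp add: power2_eq_square)
          qed
          also have "\<dots> \<le> (2 * X j ^ 6)\<^sup>2 * (16 / X j) ^ j"
          proof (intro mult_mono power_mono)
            have "y * X j ^ 6 \<le> 2 * X j ^ 6" using y X0 by (intro mult_right_mono) auto
            then show "?k \<le> 2 * X j ^ 6" using elim by linarith
            have "y ^ 3 \<le> 2 ^ 3" using y by (intro power_mono) auto
            then have "y ^ 3 * X j ^ 5 / ?k \<le> 8 * X j ^ 5 / ?k" using X0 k0 by (intro divide_right_mono mult_right_mono) auto
            also have "\<dots> \<le> 8 * X j ^ 5 / (X j ^ 6 / 2)" using elim X0 k0 by (intro divide_left_mono mult_pos_pos) auto
            also have "\<dots> = 16 * (X j ^ 5 / X j ^ 6)" by simp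
            also have "X j ^ 5 / X j ^ 6 = 1 / X j" using X0 power_divide_cancel[of "X j" 5 6] by auto
            finally show "y ^ 3 * X j ^ 5 / ?k \<le> 16 / X j" by simp
          qed (use k0 X0 y in auto)
          also have "\<dots> \<le> (2 * X j ^ 6)\<^sup>2 * (16 / X j) ^ 13"
          proof (intro mult_left_mono power_decreasing)
            have "(16 :: real) ^ 13 * 8 \<ge> 16" by simp
            then show "16 / X j \<le> 1" using elim X0 by (simp add: divide_le_eq)
          qed (use elim X0 in auto)
          also have "\<dots> = 4 * 16 ^ 13 * (X j ^ 12 / X j ^ 13)"
            by (simp add: power_mult_distrib power_divide power_mult[symmetric])
          also have "X j ^ 12 / X j ^ 13 = 1 / X j" using X0 power_divide_cancel[of "X j" 12 13] by auto
          also have "4 * 16 ^ 13 * (1 / X j) \<le> 1/2" using elim X0 by (simp add: divide_le_eq)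
          finally have "?k * (y ^ (2 * j) * K j t ^ j / ?k ^ (j - 1)) \<le> 1/2" .
          moreover have "0 \<le> ?k * (y ^ (2 * j) * K j t ^ j / ?k ^ (j - 1))"
            using y k0 K_pos[of j t] by auto
          ultimately show ?thesis using le power_mono order_trans by blast
        qed
      qed simp
    qed
  qed
qed

text \<open>The term \<open>t = 0\<close> already has size at least \<open>fact k * b ^ F\<close>,
  the exact contribution of the relabellings of \<open>f\<close>, so only the constant is lost:
  \<open>2 + 1\<close> from \<open>defect_small\<close> and \<open>defect_large\<close>, and a
  factor 2 from the geometric series in \<open>t\<close>.\<close>

lemma unmatched_sum:
  "eventually (\<lambda>j. (\<Sum>t\<le>t1 j. real (k j choose t) * (fact (k j) / fact t) * (K j t ^ (t * j) *
      (b ^ ((k j - t) * (j choose 2)) * (exp (real (k j) * defect_sum b j (real (j ^ 4)))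
       + y ^ (t * j) / y ^ (j ^ 4) * exp (real (k j) * defect_sum b j (y * real (n j)))))))
     \<le> 6 * fact (k j) * b ^ F j) sequentially"
  using unmatched_term defect_small defect_large
proof eventually_elim
  case (elim j)
  let ?e1 = "exp (real (k j) * defect_sum b j (real (j ^ 4)))"
  let ?e2 = "exp (real (k j) * defect_sum b j (y * real (n j)))"
  let ?C = "j choose 2"
  have b0: "b > 0" using b_gt_1 by simp
  have "real (k j choose t) * (fact (k j) / fact t) * (K j t ^ (t * j) *
      (b ^ ((k j - t) * ?C) * (?e1 + y ^ (t * j) / y ^ (j ^ 4) * ?e2))) \<le> 3 * fact (k j) * b ^ F j * (1/2) ^ t"
    if t: "t \<le> t1 j" for t
  proof -
    have tk: "t \<le> k j" using t t1_le(2)[of j] by simp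
    have yt: "y ^ (t * j) \<ge> 1" using y by simp
    have "?e1 + y ^ (t * j) / y ^ (j ^ 4) * ?e2 \<le> 2 * y ^ (t * j) + y ^ (t * j) * 1"
    proof (rule add_mono)
      show "?e1 \<le> 2 * y ^ (t * j)" using elim yt by linarith
      have "y ^ (t * j) * (?e2 / y ^ (j ^ 4)) \<le> y ^ (t * j) * 1" using elim yt by (intro mult_left_mono) auto
      then show "y ^ (t * j) / y ^ (j ^ 4) * ?e2 \<le> y ^ (t * j) * 1" by simp
    qed
    then have br: "?e1 + y ^ (t * j) / y ^ (j ^ 4) * ?e2 \<le> 3 * y ^ (t * j)" by simp
    have bF: "b ^ ((k j - t) * ?C) = b ^ F j / b ^ (t * ?C)"
    proof -
      have "F j = (k j - t) * ?C + t * ?C" using tk by (simp add: F_def distrib_right[symmetric])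
      then show ?thesis using b0 by (simp add: power_add)
    qed
    have "real (k j choose t) * (fact (k j) / fact t) * (K j t ^ (t * j) *
      (b ^ ((k j - t) * ?C) * (?e1 + y ^ (t * j) / y ^ (j ^ 4) * ?e2)))
      \<le> real (k j choose t) * (fact (k j) / fact t) * (K j t ^ (t * j) * (b ^ F j / b ^ (t * ?C) * (3 * y ^ (t * j))))"
      unfolding bF using br b0 K_pos[of j t] by (intro mult_left_mono) auto
    also have "\<dots> = 3 * fact (k j) * b ^ F j * (real (k j choose t) / fact t * ((y * K j t) ^ j / b ^ ?C) ^ t)"
    proof -
      have "((y * K j t) ^ j / b ^ ?C) ^ t = y ^ (t * j) * K j t ^ (t * j) / b ^ (t * ?C)"
        by (simp add: power_divide power_mult_distrib power_mult[symmetric] mult.commute)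
      then show ?thesis by (simp add: mult_ac)
    qed
    also have "\<dots> \<le> 3 * fact (k j) * b ^ F j * (1/2) ^ t" using elim t b0 by (intro mult_left_mono) auto
    finally show ?thesis .
  qed
  then have "(\<Sum>t\<le>t1 j. real (k j choose t) * (fact (k j) / fact t) * (K j t ^ (t * j) *
      (b ^ ((k j - t) * ?C) * (?e1 + y ^ (t * j) / y ^ (j ^ 4) * ?e2))))
     \<le> (\<Sum>t\<le>t1 j. 3 * fact (k j) * b ^ F j * (1/2) ^ t)" by (intro sum_mono) auto
  also have "\<dots> = 3 * fact (k j) * b ^ F j * (\<Sum>t\<le>t1 j. (1/2) ^ t)" by (simp add: sum_distrib_left)
  also have "(\<Sum>t\<le>t1 j. (1/2 :: real) ^ t) \<le> (\<Sum>t. (1/2) ^ t)" by (intro sum_le_suminf summable_geometric) auto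
  also have "(\<Sum>t. (1/2 :: real) ^ t) = 2" using suminf_geometric[of "1/2 :: real"] by simp
  finally show ?case using b0 by simp
qed

section \<open>Estimates for few matched classes: cores by size\<close>

definition B :: "nat \<Rightarrow> real" where
  "B j = real (N j - 2 * F j) / real (N j - 2 * F j - m j)"

definition \<kappa> :: "nat \<Rightarrow> real" where
  "\<kappa> j = exp (2 * real (j ^ 3) / real (n j)) / (1 - \<epsilon>)"

text \<open>The summand of \<open>S\<close> in \<open>few_matched_sum\<close>, with the rate for
  large cores taken from \<open>inverse_ffact_le\<close> for \<open>M0 = j ^ 3\<close>. Multiplied
  by the number \<open>k ^ 2\<close> of cells it bounds the expected weight of cores of size
  \<open>z\<close>.\<close>

definition core_term :: "nat \<Rightarrow> real \<Rightarrow> nat \<Rightarrow> real" where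
  "core_term j \<delta> z = real (j choose z) *
     (core_weight (B j) z * ffact j z * (if 2 * j < 3 * z then \<kappa> j / real (n j) else \<delta>) ^ z)"

lemma k_ge_poly: "eventually (\<lambda>j. C * real j ^ a \<le> real (k j)) sequentially"
proof -
  have "eventually (\<lambda>j. X j ^ 6 \<le> 2 * real (k j)) sequentially" by (rule k_ge) simp
  moreover have "eventually (\<lambda>j. (2 * \<bar>C\<bar>) * real j ^ a \<le> X j) sequentially" by (rule poly_le_X)
  ultimately show ?thesis
  proof eventually_elim
    case (elim j)
    have "X j ^ 1 \<le> X j ^ 6" using X_ge_1 by (intro power_increasing) auto
    moreover have "C * real j ^ a \<le> \<bar>C\<bar> * real j ^ a" by (intro mult_right_mono) auto
    ultimately show ?case using elim by simp
  qed
qed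

text \<open>\<open>B\<close> exceeds \<open>b\<close> by a relative error of order
  \<open>F / N\<close>, at most \<open>1 / k\<close>. As \<open>k\<close> is at least a large
  multiple of \<open>j ^ 2\<close>, even the power \<open>j choose 2\<close> costs no more than a
  factor 2.\<close>

lemma B_facts: "eventually (\<lambda>j. 1 \<le> B j \<and> B j - 1 = real (m j) / (real (N j) - 2 * real (F j) - real (m j))
    \<and> B j - 1 \<le> 2 / q \<and> (\<forall>z\<le>j. B j ^ (z choose 2) \<le> 2 * b ^ (z choose 2))) sequentially"
proof -
  have "eventually (\<lambda>j. (8 / q) * real j ^ 2 \<le> real (k j)) sequentially" by (rule k_ge_poly)
  then show ?thesis using sizes_ok
  proof eventually_elim
    case (elim j)
    let ?N = "real (N j)" and ?F = "real (F j)" and ?m = "real (m j)"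
    let ?D = "?N - 2 * ?F - ?m"
    have j: "j \<ge> 1" "real j \<ge> 1" using elim by auto
    have D: "?D > 0" using elim by linarith
    have N0: "?N > 0" using D of_nat_0_le_iff[of "F j", where 'a = real] of_nat_0_le_iff[of "m j", where 'a = real] by linarith
    have Bj: "B j = (?N - 2 * ?F) / ?D" unfolding B_def using elim by (simp add: of_nat_diff)
    have 1: "1 \<le> B j" unfolding Bj using D by (simp add: le_divide_eq)
    have 2: "B j - 1 = ?m / ?D" unfolding Bj using D by (simp add: field_simps)
    have 3: "B j - 1 \<le> 2 / q"
    proof -
      have "?m / ?D \<le> ?N / (?N * q / 2)"
        using elim N0 q_bounds D by (intro frac_le) auto
      also have "\<dots> = 2 / q" using N0 by simp
      finally show ?thesis using 2 by simp
    qed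
    define x where "x = 2 * ?F / (q * ?N)"
    have C1: "8 / q * real j ^ 2 \<ge> 1"
    proof -
      have "1 * 1 \<le> 8 / q * real j ^ 2" using q_bounds j by (intro mult_mono) (auto simp: field_simps)
      then show ?thesis by simp
    qed
    have "8 / q * real j ^ 2 * ?F \<le> ?N" using elim C1 j by (intro F_le_N) auto
    then have x1: "x * (4 * real j ^ 2) \<le> 1" unfolding x_def using q_bounds N0 by (simp add: field_simps)
    have x0: "0 \<le> x" using q_bounds N0 by (simp add: x_def)
    have x2: "x \<le> 1/4"
    proof -
      have "x * 4 \<le> x * (4 * real j ^ 2)" using x0 j by (intro mult_left_mono) auto
      then show ?thesis using x1 by linarith
    qed
    have "B j \<le> b * exp (2 * x)"
    proof -
      have "q * ?N * (1 - x) = q * ?N - 2 * ?F" using q_bounds N0 by (simp add: x_def field_simps)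
      also have "\<dots> \<le> ?D" using elim by (simp add: q algebra_simps)
      finally have D2: "q * ?N * (1 - x) \<le> ?D" .
      have pos: "q * ?N * (1 - x) > 0" using q_bounds N0 x2 by auto
      have "B j \<le> ?N / (q * ?N * (1 - x))" unfolding Bj using D2 pos D N0 by (intro frac_le) auto
      also have "\<dots> = b * (1 / (1 - x))" using N0 by (simp add: b)
      also have "1 / (1 - x) \<le> 1 + 2 * x"
      proof -
        have "0 \<le> x * (1 - 2 * x)" using x0 x2 by (intro mult_nonneg_nonneg) auto
        then have "1 \<le> (1 + 2 * x) * (1 - x)" by (simp add: algebra_simps)
        then show ?thesis using x2 by (simp add: divide_le_eq)
      qed
      also have "1 + 2 * x \<le> exp (2 * x)" by (rule exp_ge_add_one_self)
      finally show ?thesis using b_gt_1 by simp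
    qed
    have 4: "B j ^ (z choose 2) \<le> 2 * b ^ (z choose 2)" if "z \<le> j" for z
    proof -
      have "real (z choose 2) \<le> real j ^ 2"
      proof -
        have "real (z choose 2) \<le> real (j choose 2)" using that by (intro of_nat_mono binomial_right_mono)
        also have "\<dots> \<le> real j ^ 2" using j by (simp add: real_choose_two power2_eq_square field_simps)
        finally show ?thesis .
      qed
      then have "real (z choose 2) * (2 * x) \<le> real j ^ 2 * (2 * x)" using x0 by (intro mult_right_mono) auto
      also have "\<dots> \<le> 1/2" using x1 by (simp add: mult_ac)
      finally have "exp (real (z choose 2) * (2 * x)) \<le> exp (1/2)" by simp
      also have "\<dots> \<le> 2" using exp_bound_half[of "1/2 :: real"] by simp
      finally have e: "exp (2 * x) ^ (z choose 2) \<le> 2" by (simp only: exp_of_nat_mult)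
      have "B j ^ (z choose 2) \<le> (b * exp (2 * x)) ^ (z choose 2)" using \<open>B j \<le> _\<close> 1 by (intro power_mono) auto
      also have "\<dots> = b ^ (z choose 2) * exp (2 * x) ^ (z choose 2)" by (simp add: power_mult_distrib)
      also have "\<dots> \<le> b ^ (z choose 2) * 2" using e b_gt_1 by (intro mult_left_mono) auto
      finally show ?thesis by simp
    qed
    show ?case using 1 2 3 4 by auto
  qed
qed

lemma kappa_facts: "eventually (\<lambda>j. 1 \<le> \<kappa> j \<and> \<kappa> j \<le> y / (1 - \<epsilon>)) sequentially"
proof -
  have "eventually (\<lambda>j. (2 / ln y) * real j ^ 2 \<le> real (k j)) sequentially" by (rule k_ge_poly)
  then show ?thesis using eventually_ge_at_top[of 1] k_ge_const[of 1]
  proof eventually_elim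
    case (elim j)
    have n0: "real (n j) > 0" using elim by (simp add: n_def)
    have "2 * real (j ^ 3) = (2 / ln y) * real j ^ 2 * real j * ln y"
      using y by (simp add: power2_eq_square power3_eq_cube)
    also have "\<dots> \<le> real (k j) * real j * ln y" using elim y by (intro mult_right_mono) auto
    finally have "2 * real (j ^ 3) / real (n j) \<le> ln y" using n0 by (simp add: divide_le_eq n_def mult.commute)
    then have "exp (2 * real (j ^ 3) / real (n j)) \<le> exp (ln y)" by simp
    then have 1: "exp (2 * real (j ^ 3) / real (n j)) \<le> y" using y by simp
    have "1 \<le> exp (2 * real (j ^ 3) / real (n j))" using n0 by simp
    then have "1 / (1 - \<epsilon>) \<le> \<kappa> j" unfolding \<kappa>_def using \<epsilon> by (intro divide_right_mono) auto
    moreover have "1 \<le> 1 / (1 - \<epsilon>)" using \<epsilon> by (simp add: field_simps)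
    moreover have "\<kappa> j \<le> y / (1 - \<epsilon>)" unfolding \<kappa>_def using 1 \<epsilon> by (intro divide_right_mono) auto
    ultimately show ?case by linarith
  qed
qed

text \<open>The term is at most \<open>2 * x ^ z\<close> with
  \<open>x = 8 * j * b powr ((z - 1) / 2) / k\<close>. For \<open>z \<le> 6\<close> the power of
  \<open>b\<close> is a constant, at most \<open>w ^ 30\<close>, so \<open>x\<close> is about
  \<open>X ^ (-6)\<close> and the third power already beats \<open>k ^ 2\<close>, of order
  \<open>X ^ 12\<close>. For larger \<open>z\<close> only \<open>x\<close> of order
  \<open>j / X ^ 2\<close> is available, and seven is the first exponent that suffices.\<close>

lemma small_core_term:
  "eventually (\<lambda>j. \<forall>z \<delta>. 3 \<le> z \<and> 3 * z \<le> 2 * j \<and> 0 \<le> \<delta> \<and> \<delta> \<le> 8 / real (n j) \<longrightarrow>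
     real (k j) ^ 2 * core_term j \<delta> z \<le> 8 * (16 * w ^ 30) ^ 7 * real j ^ 7 / X j ^ 2) sequentially"
proof -
  have "eventually (\<lambda>j. real (k j) \<le> 2 * X j ^ 6) sequentially" by (rule k_le) simp
  moreover have "eventually (\<lambda>j. X j ^ 6 \<le> 2 * real (k j)) sequentially" by (rule k_ge) simp
  moreover have "eventually (\<lambda>j. (16 * w ^ 30) * real j ^ 1 \<le> X j) sequentially" by (rule poly_le_X)
  moreover have "eventually (\<lambda>j. 1 \<le> real (k j)) sequentially" by (rule k_ge_const)
  ultimately show ?thesis using B_facts
  proof eventually_elim
    case (elim j)
    show ?case
    proof (intro allI impI)
      fix z \<delta> assume z: "3 \<le> z \<and> 3 * z \<le> 2 * j \<and> 0 \<le> \<delta> \<and> \<delta> \<le> 8 / real (n j)"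
      let ?k = "real (k j)" and ?X = "X j" and ?Q = "16 * w ^ 30"
      have zj: "z \<le> j" and j1: "real j \<ge> 1" using z by auto
      have X1: "?X \<ge> 1" "?X > 0" by (rule X_ge_1, rule X_pos)
      have w1: "w ^ i \<ge> 1" for i using w by simp
      have k0: "?k > 0" using elim by linarith
      define x where "x = 8 * real j * w ^ (6 * (z - 1)) / ?k"
      have x0: "0 \<le> x" using k0 w by (simp add: x_def)
      have n0: "real (n j) = ?k * real j" by (simp add: n_def)
      have T: "core_term j \<delta> z \<le> 2 * x ^ z"
      proof -
        have cw: "core_weight (B j) z \<le> 2 * b ^ (z choose 2)" using elim zj z by (simp add: core_weight_def)
        have ff: "ffact j z \<le> real j ^ z"
        proof -
          have "ffact j z \<le> (\<Prod>x<z. real j)" unfolding ffact_def by (intro prod_mono) auto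
          then show ?thesis by simp
        qed
        have ch: "real (j choose z) \<le> real j ^ z" using of_nat_mono[OF binomial_le_pow[OF zj], where 'a = real] by simp
        have d: "\<delta> ^ z \<le> (8 / (?k * real j)) ^ z" using z n0 by (intro power_mono) auto
        have nb: "\<not> 2 * j < 3 * z" using z by simp
        have cw0: "0 \<le> core_weight (B j) z" using elim by (intro core_weight_nonneg) auto
        have "core_term j \<delta> z = real (j choose z) * (core_weight (B j) z * ffact j z * \<delta> ^ z)"
          using nb by (simp add: core_term_def)
        also have "\<dots> \<le> real j ^ z * (2 * b ^ (z choose 2) * real j ^ z * (8 / (?k * real j)) ^ z)"
          using ch cw ff d cw0 z b_gt_1 by (intro mult_mono) auto
        also have "\<dots> = 2 * b ^ (z choose 2) * (8 * real j / ?k) ^ z"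
        proof -
          have "real j ^ z * (real j ^ z * (8 / (?k * real j)) ^ z) = (8 * real j / ?k) ^ z"
            unfolding power_mult_distrib[symmetric] using j1 by (simp add: field_simps)
          then show ?thesis by (simp add: mult_ac)
        qed
        also have "b ^ (z choose 2) = (w ^ (6 * (z - 1))) ^ z"
        proof -
          have "b ^ (z choose 2) = w ^ (12 * (z choose 2))" by (simp add: power_mult w(2))
          then show ?thesis unfolding twelve_choose_two by (simp add: power_mult[symmetric] mult_ac)
        qed
        also have "2 * (w ^ (6 * (z - 1))) ^ z * (8 * real j / ?k) ^ z = 2 * x ^ z"
          by (simp add: x_def power_mult_distrib[symmetric] power_divide[symmetric] mult_ac)
        finally show ?thesis .
      qed
      have kx: "1 / ?k \<le> 2 / ?X ^ 6" using elim k0 X1 by (simp add: field_simps)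
      have xle: "x \<le> 16 * real j * w ^ (6 * (z - 1)) / ?X ^ 6"
      proof -
        have "x = 8 * real j * w ^ (6 * (z - 1)) * (1 / ?k)" by (simp add: x_def)
        also have "\<dots> \<le> 8 * real j * w ^ (6 * (z - 1)) * (2 / ?X ^ 6)" using kx w by (intro mult_left_mono) auto
        finally show ?thesis by simp
      qed
      have Qj: "?Q * real j \<le> ?X" using elim by simp
      have Q16: "16 * real j \<le> ?Q * real j" using w1[of 30] by (intro mult_right_mono) auto
      have XX: "?X \<le> ?X ^ i" if "i \<ge> 1" for i using power_increasing[OF that X1(1)] by simp
      have "?k ^ 2 * (2 * x ^ z) \<le> 8 * (?Q * real j) ^ 7 / ?X ^ 2"
      proof (cases "z \<le> 6")
        case True
        have "w ^ (6 * (z - 1)) \<le> w ^ 30" using True w by (intro power_increasing) auto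
        then have "16 * real j * w ^ (6 * (z - 1)) / ?X ^ 6 \<le> 16 * real j * w ^ 30 / ?X ^ 6"
          using X1 by (intro divide_right_mono mult_left_mono) auto
        then have x': "x \<le> ?Q * real j / ?X ^ 6" using xle by (simp add: mult_ac)
        also have "\<dots> \<le> 1" using Qj XX[of 6] X1 by (simp add: divide_le_eq)
        finally have "x \<le> 1" .
        have "x ^ z \<le> x ^ 3" using x0 \<open>x \<le> 1\<close> z by (intro power_decreasing) auto
        also have "\<dots> \<le> (?Q * real j / ?X ^ 6) ^ 3" using x' x0 by (intro power_mono) auto
        finally have "?k ^ 2 * (2 * x ^ z) \<le> (2 * ?X ^ 6) ^ 2 * (2 * (?Q * real j / ?X ^ 6) ^ 3)"
          using elim x0 by (intro mult_mono power_mono) auto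
        also have "\<dots> = 8 * (?Q * real j) ^ 3 * (?X ^ 12 / ?X ^ 18)"
          by (simp add: power_mult_distrib power_divide power_mult[symmetric])
        also have "?X ^ 12 / ?X ^ 18 = 1 / ?X ^ 6" using X1 power_divide_cancel[of ?X 12 18] by auto
        also have "8 * (?Q * real j) ^ 3 * (1 / ?X ^ 6) \<le> 8 * (?Q * real j) ^ 7 * (1 / ?X ^ 2)"
        proof (intro mult_mono divide_left_mono)
          have "1 \<le> ?Q * real j" using Q16 j1 by linarith
          then show "(?Q * real j) ^ 3 \<le> (?Q * real j) ^ 7" by (intro power_increasing) auto
          show "?X ^ 2 \<le> ?X ^ 6" using X1 by (intro power_increasing) auto
        qed (use X1 w in auto)
        finally show ?thesis by simp
      next
        case False
        have "w ^ (6 * (z - 1)) \<le> w ^ (4 * j)" using z w by (intro power_increasing) auto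
        also have "\<dots> = ?X ^ 4" by (simp add: X_def power_mult[symmetric] mult.commute)
        finally have "16 * real j * w ^ (6 * (z - 1)) / ?X ^ 6 \<le> 16 * real j * ?X ^ 4 / ?X ^ 6"
          using X1 by (intro divide_right_mono mult_left_mono) auto
        also have "\<dots> = 16 * real j * (?X ^ 4 / ?X ^ 6)" by simp
        also have "?X ^ 4 / ?X ^ 6 = 1 / ?X ^ 2" using X1 power_divide_cancel[of ?X 4 6] by auto
        also have "16 * real j * (1 / ?X ^ 2) \<le> ?Q * real j * (1 / ?X ^ 2)" using Q16 X1 w1[of 30] by (intro mult_right_mono) auto
        finally have x': "x \<le> ?Q * real j / ?X ^ 2" using xle by simp
        also have "\<dots> \<le> 1" using Qj XX[of 2] X1 by (simp add: divide_le_eq)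
        finally have "x \<le> 1" .
        have "x ^ z \<le> x ^ 7" using x0 \<open>x \<le> 1\<close> False by (intro power_decreasing) auto
        also have "\<dots> \<le> (?Q * real j / ?X ^ 2) ^ 7" using x' x0 by (intro power_mono) auto
        finally have "?k ^ 2 * (2 * x ^ z) \<le> (2 * ?X ^ 6) ^ 2 * (2 * (?Q * real j / ?X ^ 2) ^ 7)"
          using elim x0 by (intro mult_mono power_mono) auto
        also have "\<dots> = 8 * (?Q * real j) ^ 7 * (?X ^ 12 / ?X ^ 14)"
          by (simp add: power_mult_distrib power_divide power_mult[symmetric])
        also have "?X ^ 12 / ?X ^ 14 = 1 / ?X ^ 2" using X1 power_divide_cancel[of ?X 12 14] by auto
        finally show ?thesis by simp
      qed
      moreover have "?k ^ 2 * core_term j \<delta> z \<le> ?k ^ 2 * (2 * x ^ z)" using T by (intro mult_left_mono) auto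
      ultimately show "?k ^ 2 * core_term j \<delta> z \<le> 8 * ?Q ^ 7 * real j ^ 7 / ?X ^ 2"
        by (simp add: power_mult_distrib)
    qed
  qed
qed

text \<open>The entire class dominates: leaving out \<open>u\<close> of its vertices multiplies the
  bound by \<open>(j * n * w ^ 6 / X ^ 10) ^ u \<le> 1\<close>. For the entire class Stirling turns
  \<open>k ^ 2 * b ^ (j choose 2) * fact j * (\<kappa> / n) ^ j\<close> into \<open>j\<close> times
  the \<open>j\<close>-th power of \<open>sqrt b / exp 1\<close>, enlarged by the slack factors
  \<open>y ^ 2 / (1 - \<epsilon>)\<close>; here \<open>sqrt b = w ^ 6\<close>.\<close>

lemma big_core_term:
  "eventually (\<lambda>j. \<forall>z \<delta>. z \<le> j \<and> 2 * j < 3 * z \<longrightarrow>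
     real (k j) ^ 2 * core_term j \<delta> z \<le> 12 * real j * (y\<^sup>2 * w ^ 6 / (exp 1 * (1 - \<epsilon>))) ^ j) sequentially"
proof -
  have "eventually (\<lambda>j. real (k j) \<le> 2 * X j ^ 6) sequentially" by (rule k_le) simp
  moreover have "eventually (\<lambda>j. X j ^ 6 \<le> y * real (k j)) sequentially" by (rule k_ge) (use y in simp)
  moreover have "eventually (\<lambda>j. (2 * w ^ 6) * real j ^ 2 \<le> X j) sequentially" by (rule poly_le_X)
  moreover have "eventually (\<lambda>j. 1 \<le> real (k j)) sequentially" by (rule k_ge_const)
  moreover have "eventually (\<lambda>j. j \<ge> 5) sequentially" by (rule eventually_ge_at_top)
  ultimately show ?thesis using B_facts kappa_facts
  proof eventually_elim
    case (elim j)
    show ?case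
    proof (intro allI impI)
      fix z and \<delta> :: real assume z: "z \<le> j \<and> 2 * j < 3 * z"
      let ?k = "real (k j)" and ?X = "X j" and ?n = "real (n j)"
      define u where "u = j - z"
      have zu: "j = z + u" "2 * u \<le> z" using z by (auto simp: u_def)
      have z3: "z \<ge> 3" using z elim by linarith
      have j1: "real j \<ge> 1" "j > 0" using elim by auto
      have X1: "?X \<ge> 1" "?X > 0" by (rule X_ge_1, rule X_pos)
      have k0: "?k > 0" using elim by linarith
      have n0: "?n = ?k * real j" "?n > 0" using k0 j1 by (auto simp: n_def)
      have \<kappa>: "1 \<le> \<kappa> j" "\<kappa> j \<le> y / (1 - \<epsilon>)" using elim by auto
      have cw: "core_weight (B j) z \<le> 2 * b ^ (z choose 2)" using elim z z3 by (simp add: core_weight_def)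
      have cw0: "0 \<le> core_weight (B j) z" using elim by (intro core_weight_nonneg) auto
      have ff: "ffact j z \<le> fact j"
      proof -
        have "ffact j z * 1 \<le> ffact j z * fact (j - z)" by (intro mult_left_mono) (auto simp: fact_ge_1)
        then show ?thesis using ffact_mult_fact[of z j] z by simp
      qed
      have ch: "real (j choose z) \<le> real j ^ u"
      proof -
        have "j choose z = j choose u" unfolding u_def using z by (intro binomial_symmetric) auto
        then show ?thesis using of_nat_mono[OF binomial_le_pow[of u j], where 'a = real] zu by simp
      qed
      have \<alpha>: "(\<kappa> j / ?n) ^ z \<le> (\<kappa> j / ?n) ^ j * ?n ^ u"
      proof -
        have "(\<kappa> j / ?n) ^ z * 1 \<le> (\<kappa> j / ?n) ^ z * \<kappa> j ^ u" using \<kappa> n0 by (intro mult_left_mono) auto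
        also have "\<kappa> j ^ u = (\<kappa> j / ?n) ^ u * ?n ^ u" unfolding power_mult_distrib[symmetric] using n0(2) by simp
        finally show ?thesis by (simp add: zu(1) power_add mult.assoc)
      qed
      \<comment> \<open>As fewer than a third of the vertices are missing, each of them removes more
        than \<open>5 * j / 6\<close> pairs on average, up to a bounded number; in powers of
        \<open>w\<close> this is the factor \<open>X ^ 10\<close>, with \<open>w ^ 6\<close> for the
        rounding.\<close>
      have bz: "b ^ (z choose 2) \<le> (?X ^ 6) ^ (j - 1) * (w ^ 6 / ?X ^ 10) ^ u"
      proof -
        have "10 * j * u + 6 * (z * (z - 1)) \<le> 6 * (j * (j - 1)) + 6 * u"
        proof -
          obtain z' where z': "z = Suc z'" using z3 by (cases z) auto
          have "2 * u * u \<le> z * u" using zu(2) by (intro mult_right_mono) auto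
          then show ?thesis using zu(1) z' by (simp add: algebra_simps)
        qed
        then have "w ^ (10 * j * u + 6 * (z * (z - 1))) \<le> w ^ (6 * (j * (j - 1)) + 6 * u)"
          using w by (intro power_increasing) auto
        moreover have "w ^ (10 * j * u + 6 * (z * (z - 1))) = (?X ^ 10) ^ u * b ^ (z choose 2)"
        proof -
          have "w ^ (10 * j * u) = (?X ^ 10) ^ u" by (simp only: X_def power_mult[symmetric] mult_ac)
          moreover have "w ^ (6 * (z * (z - 1))) = b ^ (z choose 2)"
            unfolding twelve_choose_two[symmetric] by (simp only: power_mult w(2))
          ultimately show ?thesis by (simp only: power_add)
        qed
        moreover have "w ^ (6 * (j * (j - 1)) + 6 * u) = (?X ^ 6) ^ (j - 1) * (w ^ 6) ^ u"
          unfolding power_add by (simp only: X_def power_mult[symmetric] mult_ac)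
        ultimately show ?thesis using X1 by (simp add: power_divide field_simps)
      qed
      have "core_term j \<delta> z = real (j choose z) * (core_weight (B j) z * ffact j z * (\<kappa> j / ?n) ^ z)"
        using z by (simp add: core_term_def)
      also have "\<dots> \<le> real j ^ u * (2 * ((?X ^ 6) ^ (j - 1) * (w ^ 6 / ?X ^ 10) ^ u) * fact j * ((\<kappa> j / ?n) ^ j * ?n ^ u))"
      proof (intro mult_mono)
        show "core_weight (B j) z \<le> 2 * ((?X ^ 6) ^ (j - 1) * (w ^ 6 / ?X ^ 10) ^ u)" using cw bz by linarith
      qed (use ch ff \<alpha> cw0 X1 w \<kappa> n0 in auto)
      also have "\<dots> = 2 * (fact j * (?X ^ 6) ^ (j - 1) * (\<kappa> j / ?n) ^ j) * (real j * ?n * (w ^ 6 / ?X ^ 10)) ^ u"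
        by (simp only: power_mult_distrib mult_ac)
      also have "\<dots> \<le> 2 * (fact j * (?X ^ 6) ^ (j - 1) * (\<kappa> j / ?n) ^ j) * 1 ^ u"
      proof (intro mult_left_mono power_mono)
        have "real j * ?n * (w ^ 6 / ?X ^ 10) \<le> real j * (2 * ?X ^ 6 * real j) * (w ^ 6 / ?X ^ 10)"
          unfolding n0(1) using elim w X1 by (intro mult_right_mono mult_left_mono) auto
        also have "\<dots> = 2 * w ^ 6 * real j ^ 2 * (?X ^ 6 / ?X ^ 10)" by (simp add: power2_eq_square)
        also have "?X ^ 6 / ?X ^ 10 = 1 / ?X ^ 4" using X1 power_divide_cancel[of ?X 6 10] by auto
        also have "2 * w ^ 6 * real j ^ 2 * (1 / ?X ^ 4) \<le> 1"
          using elim power_increasing[of 1 4 ?X] X1 by (simp add: divide_le_eq)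
        finally show "real j * ?n * (w ^ 6 / ?X ^ 10) \<le> 1" .
      qed (use X1 w \<kappa> n0 in auto)
      finally have T: "core_term j \<delta> z \<le> 2 * (fact j * (?X ^ 6) ^ (j - 1) * (\<kappa> j / ?n) ^ j)" by simp
      have "fact j * (?X ^ 6) ^ (j - 1) * (\<kappa> j / ?n) ^ j
          \<le> (exp 1 * real j * (real j / exp 1) ^ j) * (y * ?k) ^ (j - 1) * (y / (1 - \<epsilon>) / ?n) ^ j"
        using fact_le_exp_power[OF j1(2)] elim \<kappa> n0 X1 y \<epsilon> k0
        by (intro mult_mono power_mono divide_right_mono) auto
      also have "\<dots> = exp 1 * real j * ((real j / exp 1) ^ j * (y / (1 - \<epsilon>) / ?n) ^ j) * (y * ?k) ^ (j - 1)"
        by simp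
      also have "(real j / exp 1) ^ j * (y / (1 - \<epsilon>) / ?n) ^ j = (y / (exp 1 * (1 - \<epsilon>)) / ?k) ^ j"
        unfolding power_mult_distrib[symmetric] n0(1) using j1 k0 by (intro arg_cong[of _ _ "\<lambda>x. x ^ j"]) simp
      also have "exp 1 * real j * (y / (exp 1 * (1 - \<epsilon>)) / ?k) ^ j * (y * ?k) ^ (j - 1)
          \<le> exp 1 * real j * (y\<^sup>2 / (exp 1 * (1 - \<epsilon>))) ^ j / ?k"
      proof -
        have kj: "?k ^ j = ?k ^ (j - 1) * ?k" using j1 by (metis power_minus_mult)
        have yj: "y ^ (j - 1) \<le> y ^ j" using y by (intro power_increasing) auto
        have "(y / (exp 1 * (1 - \<epsilon>)) / ?k) ^ j * (y * ?k) ^ (j - 1)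
            = (y / (exp 1 * (1 - \<epsilon>))) ^ j * y ^ (j - 1) * (?k ^ (j - 1) / ?k ^ j)"
          unfolding power_divide[of _ ?k] power_mult_distrib by simp
        also have "?k ^ (j - 1) / ?k ^ j = 1 / ?k" unfolding kj using k0 by simp
        also have "(y / (exp 1 * (1 - \<epsilon>))) ^ j * y ^ (j - 1) * (1 / ?k) \<le> (y / (exp 1 * (1 - \<epsilon>))) ^ j * y ^ j * (1 / ?k)"
          using yj y \<epsilon> k0 by (intro mult_right_mono mult_left_mono) auto
        also have "\<dots> = (y\<^sup>2 / (exp 1 * (1 - \<epsilon>))) ^ j / ?k"
          unfolding power_mult_distrib[symmetric] by (simp add: power2_eq_square)
        finally have "exp 1 * real j * ((y / (exp 1 * (1 - \<epsilon>)) / ?k) ^ j * (y * ?k) ^ (j - 1))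
            \<le> exp 1 * real j * ((y\<^sup>2 / (exp 1 * (1 - \<epsilon>))) ^ j / ?k)" by (intro mult_left_mono) auto
        then show ?thesis by (simp add: mult.assoc)
      qed
      finally have f: "fact j * (?X ^ 6) ^ (j - 1) * (\<kappa> j / ?n) ^ j
          \<le> exp 1 * real j * (y\<^sup>2 / (exp 1 * (1 - \<epsilon>))) ^ j / ?k" .
      let ?s = "(y\<^sup>2 / (exp 1 * (1 - \<epsilon>))) ^ j"
      have s0: "0 \<le> ?s" using \<epsilon> by auto
      have "?k ^ 2 * core_term j \<delta> z \<le> ?k ^ 2 * (2 * (exp 1 * real j * ?s / ?k))"
        using T f by (intro mult_left_mono) (linarith, simp)
      also have "\<dots> = 2 * exp 1 * real j * ?s * ?k" using k0 by (simp add: power2_eq_square)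
      also have "\<dots> \<le> 2 * 3 * real j * ?s * (2 * ?X ^ 6)"
        using elim s0 exp_le k0 by (intro mult_mono) auto
      also have "\<dots> = 12 * real j * (?s * (w ^ 6) ^ j)"
        by (simp add: X_def power_mult[symmetric] mult.commute)
      also have "?s * (w ^ 6) ^ j = (y\<^sup>2 * w ^ 6 / (exp 1 * (1 - \<epsilon>))) ^ j"
        unfolding power_mult_distrib[symmetric] by simp
      finally show "?k ^ 2 * core_term j \<delta> z \<le> 12 * real j * (y\<^sup>2 * w ^ 6 / (exp 1 * (1 - \<epsilon>))) ^ j" .
    qed
  qed
qed

text \<open>Only size two survives, and its contribution is computed exactly because it has to
  cancel against \<open>avoid_prob_superadditive\<close>. The scale \<open>c\<close> takes the
  values 1 and 8, the two rates of \<open>inverse_ffact_le\<close>.\<close>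

lemma core_sum_le:
  assumes "\<eta> > 0"
  shows "eventually (\<lambda>j. \<forall>c. 0 \<le> c \<and> c \<le> 8 \<longrightarrow>
     real (k j) ^ 2 * (\<Sum>z=2..j. core_term j (c / real (n j)) z) \<le> c\<^sup>2 * ((B j - 1) * (real j - 1)\<^sup>2 / 2) + \<eta>) sequentially"
proof -
  let ?Q = "8 * (16 * w ^ 30) ^ 7"
  let ?r = "y\<^sup>2 * w ^ 6 / (exp 1 * (1 - \<epsilon>))"
  have r0: "0 \<le> ?r" using w \<epsilon> by simp
  have "(\<lambda>j. 12 * (real j ^ 2 * ?r ^ j)) \<longlonglongrightarrow> 12 * 0"
    using r0 y\<epsilon> by (intro tendsto_mult tendsto_const power_mult_geometric_tendsto_0) auto
  from order_tendstoD(2)[OF this, of "\<eta> / 2"]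
  have "eventually (\<lambda>j. 12 * (real j ^ 2 * ?r ^ j) < \<eta> / 2) sequentially" using assms by simp
  moreover have "eventually (\<lambda>j. (2 * ?Q / \<eta>) * real j ^ 8 \<le> X j) sequentially" by (rule poly_le_X)
  moreover have "eventually (\<lambda>j. 1 \<le> real (k j)) sequentially" by (rule k_ge_const)
  moreover have "eventually (\<lambda>j. j \<ge> 5) sequentially" by (rule eventually_ge_at_top)
  ultimately show ?thesis using small_core_term big_core_term
  proof eventually_elim
    case (elim j)
    let ?k = "real (k j)" and ?X = "X j"
    show ?case
    proof (intro allI impI)
      fix c :: real assume c: "0 \<le> c \<and> c \<le> 8"
      let ?\<delta> = "c / real (n j)"
      have X1: "?X \<ge> 1" "?X > 0" by (rule X_ge_1, rule X_pos)
      have k0: "?k > 0" using elim by linarith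
      have \<delta>: "0 \<le> ?\<delta>" "?\<delta> \<le> 8 / real (n j)" using c by (auto intro: divide_right_mono)
      have each: "?k ^ 2 * core_term j ?\<delta> z \<le> ?Q * real j ^ 7 / ?X ^ 2 + 12 * real j * ?r ^ j" if "z \<in> {3..j}" for z
      proof (cases "2 * j < 3 * z")
        case True
        then have "?k ^ 2 * core_term j ?\<delta> z \<le> 12 * real j * ?r ^ j" using elim that by auto
        moreover have "0 \<le> ?Q * real j ^ 7 / ?X ^ 2" using X1 w by simp
        ultimately show ?thesis by linarith
      next
        case False
        then have "?k ^ 2 * core_term j ?\<delta> z \<le> ?Q * real j ^ 7 / ?X ^ 2" using elim that \<delta> by auto
        moreover have "0 \<le> 12 * real j * ?r ^ j" using r0 by simp
        ultimately show ?thesis by linarith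
      qed
      have two: "?k ^ 2 * core_term j ?\<delta> 2 = c\<^sup>2 * ((B j - 1) * (real j - 1)\<^sup>2 / 2)"
      proof -
        have "\<not> 2 * j < 3 * 2" using elim by simp
        moreover have "ffact j 2 = real j * (real j - 1)" using elim by (simp add: ffact_def numeral_2_eq_2 of_nat_diff)
        ultimately have "core_term j ?\<delta> 2 = real j * (real j - 1) / 2 * ((B j - 1) * (real j * (real j - 1)) * ?\<delta>\<^sup>2)"
          by (simp add: core_term_def core_weight_def real_choose_two)
        moreover have "real j > 0" using elim by simp
        ultimately show ?thesis using k0 by (simp add: n_def power_divide power_mult_distrib power2_eq_square)
      qed
      have split: "?k ^ 2 * (\<Sum>z=2..j. core_term j ?\<delta> z)
          = ?k ^ 2 * core_term j ?\<delta> 2 + (\<Sum>z=3..j. ?k ^ 2 * core_term j ?\<delta> z)"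
      proof -
        have "{2..j} = insert 2 {3..j}" using elim by auto
        then have "(\<Sum>z=2..j. core_term j ?\<delta> z) = core_term j ?\<delta> 2 + (\<Sum>z=3..j. core_term j ?\<delta> z)" by simp
        then show ?thesis by (simp add: distrib_left sum_distrib_left)
      qed
      define A where "A = ?Q * real j ^ 7 / ?X ^ 2"
      define D where "D = 12 * real j * ?r ^ j"
      have AD: "0 \<le> A" "0 \<le> D" using X1 w r0 by (auto simp: A_def D_def)
      have "(\<Sum>z=3..j. ?k ^ 2 * core_term j ?\<delta> z) \<le> (\<Sum>z=3..j. A + D)"
        unfolding A_def D_def by (rule sum_mono[OF each])
      also have "\<dots> \<le> (\<Sum>z=1..j. A + D)" using AD by (intro sum_mono2) auto
      finally have tail: "(\<Sum>z=3..j. ?k ^ 2 * core_term j ?\<delta> z) \<le> real j * A + real j * D" by (simp add: distrib_left)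
      have "real j * A \<le> \<eta> / 2"
      proof -
        have "2 * ?Q / \<eta> * real j ^ 8 \<le> ?X" using elim by blast
        also have "\<dots> \<le> ?X ^ 2" using power_increasing[of 1 2 ?X] X1 by simp
        finally have "?Q * real j ^ 8 \<le> \<eta> / 2 * ?X ^ 2" using assms by (simp add: field_simps)
        moreover have "real j * (?Q * real j ^ 7) = ?Q * (real j * real j ^ 7)" by (rule mult.left_commute)
        moreover have "real j * real j ^ 7 = real j ^ 8" by (simp add: power_Suc[symmetric] del: power_Suc)
        ultimately have "real j * (?Q * real j ^ 7) \<le> \<eta> / 2 * ?X ^ 2" by (simp only:)
        then show ?thesis unfolding A_def times_divide_eq_right using X1 by (simp only: pos_divide_le_eq zero_less_power)
      qed
      moreover have "real j * D \<le> \<eta> / 2"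
      proof -
        have "real j * D = 12 * (real j ^ 2 * ?r ^ j)" unfolding D_def by (simp only: power2_eq_square mult_ac)
        also have "\<dots> < \<eta> / 2" using elim by blast
        finally show ?thesis by (rule less_imp_le)
      qed
      ultimately show "?k ^ 2 * (\<Sum>z=2..j. core_term j ?\<delta> z) \<le> c\<^sup>2 * ((B j - 1) * (real j - 1)\<^sup>2 / 2) + \<eta>"
        using tail unfolding split two by linarith
    qed
  qed
qed

text \<open>The expected number of unordered partitions into independent classes in the uniform
  model; \<open>fact (k j)\<close> removes the labels of the classes.\<close>

definition E :: "nat \<Rightarrow> real" where
  "E j = fact (n j) / (fact j ^ k j * fact (k j)) * avoid_prob (N j) (m j) (F j)"

definition \<Lambda> :: "nat \<Rightarrow> real" where
  "\<Lambda> j = (B j - 1) * (real j - 1)\<^sup>2 / 2"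

lemma F_square_div_N:
  assumes "n j \<ge> 2"
  shows "real (F j) ^ 2 / real (N j) = real (n j) * (real j - 1)\<^sup>2 / (2 * (real (n j) - 1))"
    and "(real j - 1)\<^sup>2 / 2 \<le> real (F j) ^ 2 / real (N j)"
proof -
  let ?n = "real (n j)"
  have n2: "?n \<ge> 2" using assms by simp
  show lam: "real (F j) ^ 2 / real (N j) = ?n * (real j - 1)\<^sup>2 / (2 * (?n - 1))"
    unfolding N_real F_real using n2 by (simp add: power2_eq_square field_simps)
  have "(real j - 1)\<^sup>2 * (?n - 1) \<le> (real j - 1)\<^sup>2 * ?n" by (intro mult_left_mono) auto
  then show "(real j - 1)\<^sup>2 / 2 \<le> real (F j) ^ 2 / real (N j)" unfolding lam using n2 by (simp add: field_simps)
qed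

text \<open>Both coefficients of \<open>F ^ 2 / N\<close> are close to \<open>p / q\<close>; they
  differ by \<open>O(F / N)\<close>, which is at most \<open>1 / (C * j ^ 2)\<close> with
  \<open>C\<close> as large as desired, whereas \<open>F ^ 2 / N\<close> is at most
  \<open>j ^ 2\<close>. So the gain from cells of size two and the loss from fixing the edge number
  cancel in the limit.\<close>

lemma exponent_gap:
  assumes "\<eta> > 0"
  shows "eventually (\<lambda>j. \<Lambda> j - real (m j) / (real (N j) - real (m j)) * (real (F j) ^ 2 / real (N j)) \<le> \<eta>) sequentially"
proof -
  define C where "C = max 1 (8 / (q\<^sup>2 * \<eta>))"
  have "eventually (\<lambda>j. C * real j ^ 2 \<le> real (k j)) sequentially" by (rule k_ge_poly)
  moreover have "eventually (\<lambda>j. j \<ge> 2) sequentially" by (rule eventually_ge_at_top)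
  ultimately show ?thesis using sizes_ok B_facts
  proof eventually_elim
    case (elim j)
    let ?N = "real (N j)" and ?F = "real (F j)" and ?m = "real (m j)" and ?n = "real (n j)"
    let ?D = "?N - 2 * ?F - ?m"
    define \<theta> where "\<theta> = ?F ^ 2 / ?N"
    have n2: "?n \<ge> 2" using elim mult_mono[of 1 "real (k j)" 2 "real j"] by (simp add: n_def)
    have N: "?N = ?n * (?n - 1) / 2" by (rule N_real)
    have N0: "?N > 0" unfolding N using n2 by simp
    have D: "?D \<ge> ?N * q / 2" "?D > 0" using elim by auto
    have Nm: "?N - ?m \<ge> ?N * q / 2" "?N - ?m > 0" using D by auto
    have "n j \<ge> 2" using n2 by simp
    from F_square_div_N[OF this, folded \<theta>_def]
    have lam: "\<theta> = ?n * (real j - 1)\<^sup>2 / (2 * (?n - 1))" and lam1: "(real j - 1)\<^sup>2 / 2 \<le> \<theta>" .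
    have lam2: "\<theta> \<le> real j ^ 2"
    proof -
      have "?n * (real j - 1)\<^sup>2 \<le> (2 * (?n - 1)) * (real j - 1)\<^sup>2" using n2 by (intro mult_right_mono) auto
      also have "\<dots> \<le> (2 * (?n - 1)) * (real j)\<^sup>2" using n2 elim by (intro mult_left_mono power_mono) auto
      finally show ?thesis unfolding lam using n2 by (simp add: field_simps)
    qed
    have lam0: "0 \<le> \<theta>" unfolding \<theta>_def by simp
    have B: "B j - 1 = ?m / ?D" "0 \<le> B j - 1" using elim by auto
    have "\<Lambda> j - ?m / (?N - ?m) * \<theta> \<le> ?m / ?D * \<theta> - ?m / (?N - ?m) * \<theta>"
    proof -
      have "\<Lambda> j = (B j - 1) * ((real j - 1)\<^sup>2 / 2)" by (simp add: \<Lambda>_def)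
      also have "\<dots> \<le> (B j - 1) * \<theta>" using lam1 B by (intro mult_left_mono) auto
      finally show ?thesis using B by simp
    qed
    also have "\<dots> = \<theta> * (?m * (2 * ?F)) / (?D * (?N - ?m))"
    proof -
      have "?m / ?D - ?m / (?N - ?m) = (?m * (2 * ?F)) / (?D * (?N - ?m))"
        using D(2) Nm(2) by (simp add: diff_frac_eq algebra_simps)
      moreover have "?m / ?D * \<theta> - ?m / (?N - ?m) * \<theta> = (?m / ?D - ?m / (?N - ?m)) * \<theta>"
        by (rule left_diff_distrib[symmetric])
      ultimately show ?thesis by (simp only: mult.commute[of _ \<theta>] times_divide_eq_right)
    qed
    also have "\<dots> \<le> \<theta> * (?N * (2 * ?F)) / ((?N * q / 2) * (?N * q / 2))"
      using D Nm N0 q_bounds lam0 by (intro frac_le mult_left_mono mult_right_mono mult_mono) auto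
    also have "\<dots> = 8 / q\<^sup>2 * \<theta> * (?F / ?N)" using N0 q_bounds by (simp add: power2_eq_square field_simps)
    also have "\<dots> \<le> 8 / q\<^sup>2 * real j ^ 2 * (1 / (C * real j ^ 2))"
    proof (intro mult_mono)
      have Cj: "C * real j ^ 2 \<ge> 1" using elim mult_mono[of 1 C 1 "real j ^ 2"] by (simp add: C_def)
      have "C * real j ^ 2 * ?F \<le> ?N" using elim Cj by (intro F_le_N) auto
      then show "?F / ?N \<le> 1 / (C * real j ^ 2)" using N0 Cj by (simp add: field_simps)
    qed (use lam2 lam0 q_bounds N0 in auto)
    also have "\<dots> = 8 / q\<^sup>2 / C" using elim by simp
    also have "\<dots> \<le> \<eta>"
    proof -
      have "8 / (q\<^sup>2 * \<eta>) \<le> C" "C > 0" by (auto simp: C_def)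
      then show ?thesis using q_bounds assms by (simp add: field_simps)
    qed
    finally show ?case unfolding \<theta>_def .
  qed
qed

text \<open>With the rate 8 the cells of size two give \<open>exp (64 * \<Lambda>)\<close>, where
  \<open>\<Lambda>\<close> is \<open>O(j ^ 2)\<close>. The cut-off \<open>M0 = j ^ 3\<close> is
  chosen so that \<open>(1/2) ^ M0\<close> outweighs it.\<close>

lemma tail_factor:
  assumes "\<eta> > 0"
  shows "eventually (\<lambda>j. (1/2) ^ (j ^ 3) * exp (64 * \<Lambda> j + 1) \<le> \<eta>) sequentially"
proof -
  define c where "c = (64 / q + 1 + \<bar>ln \<eta>\<bar>) / ln 2"
  have "eventually (\<lambda>j. real j \<ge> c) sequentially"
    using filterlim_real_sequentially unfolding filterlim_at_top by blast
  then show ?thesis using B_facts eventually_ge_at_top[of 1]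
  proof eventually_elim
    case (elim j)
    have j1: "real j \<ge> 1" using elim by simp
    have j2: "real j ^ 2 \<ge> 1" using j1 by simp
    have "\<Lambda> j \<le> (2 / q) * (real j)\<^sup>2 / 2"
      unfolding \<Lambda>_def using elim j1 q_bounds by (intro divide_right_mono mult_mono power_mono) auto
    then have "64 * \<Lambda> j + 1 - ln \<eta> \<le> 64 / q * real j ^ 2 + 1 + \<bar>ln \<eta>\<bar>" by simp
    also have "\<dots> \<le> 64 / q * real j ^ 2 + (1 + \<bar>ln \<eta>\<bar>) * real j ^ 2"
      using mult_left_mono[OF j2, of "1 + \<bar>ln \<eta>\<bar>"] by simp
    also have "\<dots> = c * ln 2 * real j ^ 2"
    proof -
      have "c * ln 2 = 64 / q + 1 + \<bar>ln \<eta>\<bar>" by (simp add: c_def)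
      then show ?thesis by (simp add: algebra_simps)
    qed
    also have "\<dots> \<le> real j * ln 2 * real j ^ 2" using elim by (intro mult_right_mono) auto
    finally have "64 * \<Lambda> j + 1 \<le> real (j ^ 3) * ln 2 + ln \<eta>" by (simp add: power2_eq_square power3_eq_cube mult_ac)
    then have "exp (64 * \<Lambda> j + 1) \<le> exp (real (j ^ 3) * ln 2 + ln \<eta>)" by simp
    also have "\<dots> = 2 ^ (j ^ 3) * \<eta>" using assms by (simp only: exp_add exp_of_nat_mult) simp
    finally have "exp (64 * \<Lambda> j + 1) \<le> 2 ^ (j ^ 3) * \<eta>" .
    then have "(1/2) ^ (j ^ 3) * exp (64 * \<Lambda> j + 1) \<le> (1/2) ^ (j ^ 3) * (2 ^ (j ^ 3) * \<eta>)" by (intro mult_left_mono) auto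
    also have "\<dots> = \<eta>" by (simp add: mult.assoc[symmetric] power_mult_distrib[symmetric])
    finally show ?case .
  qed
qed

lemma E_pos: "eventually (\<lambda>j. E j > 0) sequentially"
  using sizes_ok
proof eventually_elim
  case (elim j)
  then have "avoid_prob (N j) (m j) (F j) > 0" by (intro avoid_prob_pos) auto
  then show ?case unfolding E_def by simp
qed

text \<open>The three factors \<open>exp \<eta>\<close> come from \<open>e1\<close>, from cores of
  size at least three, and from \<open>exponent_gap\<close>. The summand \<open>\<eta>\<close> is
  the crude part of \<open>inverse_ffact_le\<close>, and \<open>6 / E j\<close> is the contribution
  of many matched classes, rewritten by means of \<open>E j * fact (k j) = card (balanced (k j) j) *
  avoid_prob (N j) (m j) (F j)\<close>.\<close>

lemma pair_sum_asymptotic: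
  assumes \<eta>: "0 < \<eta>" "\<eta> \<le> 1"
  shows "eventually (\<lambda>j. \<forall>f\<in>balanced (k j) j.
     (\<Sum>g\<in>balanced (k j) j. avoid_prob (N j) (m j) (2 * F j - cell_pairs {..<k j} {..<k j} f g {0..<n j}))
     \<le> (exp (3 * \<eta>) + \<eta> + 6 / E j) * real (card (balanced (k j) j)) * (avoid_prob (N j) (m j) (F j))\<^sup>2) sequentially"
proof -
  have "eventually (\<lambda>j. 4 * real j ^ 2 \<le> real (k j)) sequentially" by (rule k_ge_poly)
  moreover have "eventually (\<lambda>j. (2 / \<eta>) * real j ^ 6 \<le> real (k j)) sequentially" by (rule k_ge_poly)
  ultimately show ?thesis
    using sizes_ok B_facts K_cond unmatched_sum core_sum_le[OF \<eta>(1)] exponent_gap[OF \<eta>(1)] tail_factor[OF \<eta>(1)] E_pos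
  proof eventually_elim
    case (elim j)
    let ?N = "real (N j)" and ?F = "real (F j)" and ?m = "real (m j)" and ?n = "real (n j)" and ?k = "real (k j)"
    let ?FF = "balanced (k j) j"
    let ?H = "avoid_prob (N j) (m j) (F j)"
    define M1 where "M1 = nat \<lfloor>\<epsilon> * ?n\<rfloor>"
    define e1 where "e1 = exp (2 * real (j ^ 3) ^ 2 / ?n)"
    define e2 where "e2 = (1/2 :: real) ^ (j ^ 3)"
    define G where "G = ?m / (?N - ?m) * (?F ^ 2 / ?N)"
    define S where "S c = (\<Sum>z=2..j. core_term j (c / ?n) z)" for c
    define Z where "Z = (\<Sum>t\<le>t1 j. real (k j choose t) * (fact (k j) / fact t) * (K j t ^ (t * j) *
      (b ^ ((k j - t) * (j choose 2)) * (exp (real (k j) * defect_sum b j (real (j ^ 4)))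
       + y ^ (t * j) / y ^ (j ^ 4) * exp (real (k j) * defect_sum b j (y * real (n j)))))))"
    have j0: "j > 0" and k1: "?k \<ge> 1" using elim by auto
    have n0: "n j > 0" "?n > 0" using j0 k1 by (auto simp: n_def)
    have M1: "real M1 \<le> \<epsilon> * ?n" unfolding M1_def using \<epsilon> by simp
    have \<kappa>0: "0 \<le> \<kappa> j" unfolding \<kappa>_def using \<epsilon> by simp
    have H0: "0 < ?H" using elim by (intro avoid_prob_pos) auto
    have n4: "4 * real (j ^ 3) \<le> ?n"
    proof -
      have "4 * real (j ^ 3) = 4 * real j ^ 2 * real j" by (simp add: power2_eq_square power3_eq_cube)
      also have "\<dots> \<le> ?k * real j" using elim by (intro mult_right_mono) auto
      finally show ?thesis by (simp add: n_def)
    qed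
    have e1: "e1 \<le> exp \<eta>"
    proof -
      have "2 * real (j ^ 3) ^ 2 = \<eta> * ((2 / \<eta>) * real j ^ 6)" using \<eta> by (simp add: power_mult[symmetric])
      also have "\<dots> \<le> \<eta> * ?k" using elim \<eta> by (intro mult_left_mono) auto
      also have "\<dots> \<le> \<eta> * ?n" using \<eta> j0 mult_left_mono[of 1 "real j" ?k] by (intro mult_left_mono) (auto simp: n_def)
      finally show ?thesis unfolding e1_def using n0 by (simp add: divide_le_eq)
    qed
    have main: "(\<Sum>g\<in>?FF. avoid_prob (N j) (m j) (2 * F j - cell_pairs {..<k j} {..<k j} f g {0..<n j}))
        \<le> ?H\<^sup>2 * exp (- G) * (real (card ?FF) * (e1 * exp (?k ^ 2 * S 1) + e2 * exp (?k ^ 2 * S 8)))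
          + ?H * q ^ F j * Z" if f: "f \<in> ?FF" for f
    proof -
      have bound: "1 / ffact (n j) (Mb + Ms) \<le> e1 * ((\<kappa> j / ?n) ^ Mb * (1 / ?n) ^ Ms) + e2 * ((\<kappa> j / ?n) ^ Mb * (8 / ?n) ^ Ms)"
        if "Mb \<le> M1" "Mb + Ms \<le> n j" for Mb Ms
      proof -
        have "real Mb \<le> \<epsilon> * ?n" using that(1) M1 by (meson of_nat_mono order_trans)
        then show ?thesis unfolding e1_def e2_def \<kappa>_def
          using inverse_ffact_le[of "n j" \<epsilon> "j ^ 3" Mb Ms] n0(1) \<epsilon> n4 that(2) by simp
      qed
      \<comment> \<open>\<open>M1\<close> and \<open>t1\<close> are the roundings of
        \<open>\<epsilon> * n\<close> and \<open>(1 - \<epsilon>) * k\<close>: more than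
        \<open>\<epsilon> * k\<close> matched rows leave fewer than
        \<open>(1 - \<epsilon>) * k\<close> unmatched ones.\<close>
      have cover: "L * j \<le> M1 \<or> k j - L \<le> t1 j" if "L \<le> k j" for L
      proof (rule ccontr)
        assume "\<not> ?thesis"
        then have 1: "M1 < L * j" and 2: "t1 j < k j - L" by auto
        have "\<epsilon> * ?n < real (L * j)" using 1 unfolding M1_def by linarith
        then have "\<epsilon> * ?k * real j < real L * real j" by (simp add: n_def)
        then have "\<epsilon> * ?k < real L" using j0 by simp
        then have "real (k j - L) \<le> (1 - \<epsilon>) * ?k" using that by (simp add: of_nat_diff algebra_simps)
        then have "k j - L \<le> t1 j" unfolding t1_def by (rule le_nat_floor)
        with 2 show False by simp
      qed
      have b1: "b \<ge> 1" using b_gt_1 by simp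
      have qb: "q = 1 / b" using q_bounds by (simp add: b)
      have y1: "y \<ge> 1" using y by simp
      have e0: "0 \<le> e1" "0 \<le> e2" by (auto simp: e1_def e2_def)
      show ?thesis
        unfolding G_def Z_def S_def core_term_def B_def N_def F_def n_def
        by (rule pair_sum_le[where ?M1.0 = M1], fold n_def, fold N_def F_def)
          (use j0 elim(3,5) b1 qb y1 t1_le(2)[of j] K_pos[of j] \<kappa>0 n0 e0 bound cover f[folded n_def] in auto)
    qed
    have c1: "?k ^ 2 * S 1 \<le> \<Lambda> j + \<eta>" and c8: "?k ^ 2 * S 8 \<le> 64 * \<Lambda> j + \<eta>"
    proof -
      have *: "?k ^ 2 * (\<Sum>z=2..j. core_term j (c / real (n j)) z) \<le> c\<^sup>2 * ((B j - 1) * (real j - 1)\<^sup>2 / 2) + \<eta>"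
        if "0 \<le> c" "c \<le> 8" for c using elim that by blast
      show "?k ^ 2 * S 1 \<le> \<Lambda> j + \<eta>" using *[of 1] by (simp add: S_def \<Lambda>_def)
      show "?k ^ 2 * S 8 \<le> 64 * \<Lambda> j + \<eta>" using *[of 8] by (simp add: S_def \<Lambda>_def)
    qed
    have gap: "\<Lambda> j - G \<le> \<eta>" unfolding G_def using elim by blast
    have G0: "0 \<le> G"
    proof -
      have "?m \<le> ?N" using elim by linarith
      then show ?thesis unfolding G_def by simp
    qed
    have first: "exp (- G) * (e1 * exp (?k ^ 2 * S 1) + e2 * exp (?k ^ 2 * S 8)) \<le> exp (3 * \<eta>) + \<eta>"
    proof -
      have "exp (- G) * (e1 * exp (?k ^ 2 * S 1)) \<le> exp (- G) * (exp \<eta> * exp (\<Lambda> j + \<eta>))"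
        using e1 c1 by (intro mult_left_mono mult_mono) auto
      also have "\<dots> = exp (\<Lambda> j - G + 2 * \<eta>)" by (simp add: exp_add[symmetric] algebra_simps)
      also have "\<dots> \<le> exp (3 * \<eta>)" using gap by simp
      finally have 1: "exp (- G) * (e1 * exp (?k ^ 2 * S 1)) \<le> exp (3 * \<eta>)" .
      have "exp (- G) * (e2 * exp (?k ^ 2 * S 8)) \<le> 1 * (e2 * exp (64 * \<Lambda> j + 1))"
        using G0 c8 \<eta> by (intro mult_mono) (auto simp: e2_def)
      also have "\<dots> \<le> \<eta>" unfolding e2_def using elim by simp
      finally show ?thesis using 1 by (simp add: distrib_left)
    qed
    have FF: "real (card ?FF) = fact (n j) / fact j ^ k j" by (simp add: card_balanced n_def)
    have EH: "E j * fact (k j) = real (card ?FF) * ?H" unfolding E_def FF by simp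
    have second: "?H * q ^ F j * Z \<le> 6 / E j * real (card ?FF) * ?H\<^sup>2"
    proof -
      have "Z \<le> 6 * fact (k j) * b ^ F j" unfolding Z_def using elim by blast
      then have "?H * q ^ F j * Z \<le> ?H * q ^ F j * (6 * fact (k j) * b ^ F j)" using H0 q_bounds by (intro mult_left_mono) auto
      also have "\<dots> = 6 * fact (k j) * ?H * (q ^ F j * b ^ F j)" by simp
      also have "q ^ F j * b ^ F j = 1" unfolding power_mult_distrib[symmetric] using q_bounds by (simp add: b)
      also have "6 * fact (k j) * ?H * 1 = 6 / E j * (E j * fact (k j)) * ?H" using elim by simp
      also have "\<dots> = 6 / E j * real (card ?FF) * ?H\<^sup>2" unfolding EH by (simp add: power2_eq_square)
      finally show ?thesis .
    qed
    show ?case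
    proof
      fix f assume f: "f \<in> ?FF"
      have "?H\<^sup>2 * exp (- G) * (real (card ?FF) * (e1 * exp (?k ^ 2 * S 1) + e2 * exp (?k ^ 2 * S 8)))
          = (real (card ?FF) * ?H\<^sup>2) * (exp (- G) * (e1 * exp (?k ^ 2 * S 1) + e2 * exp (?k ^ 2 * S 8)))" by simp
      also have "\<dots> \<le> (real (card ?FF) * ?H\<^sup>2) * (exp (3 * \<eta>) + \<eta>)" using first by (intro mult_left_mono) auto
      finally have "(\<Sum>g\<in>?FF. avoid_prob (N j) (m j) (2 * F j - cell_pairs {..<k j} {..<k j} f g {0..<n j}))
          \<le> (real (card ?FF) * ?H\<^sup>2) * (exp (3 * \<eta>) + \<eta>) + 6 / E j * real (card ?FF) * ?H\<^sup>2"
        using main[OF f] second by linarith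
      then show "(\<Sum>g\<in>?FF. avoid_prob (N j) (m j) (2 * F j - cell_pairs {..<k j} {..<k j} f g {0..<n j}))
          \<le> (exp (3 * \<eta>) + \<eta> + 6 / E j) * real (card ?FF) * ?H\<^sup>2" by (simp add: algebra_simps)
    qed
  qed
qed

text \<open>The factor paid for each colour saved in \<open>first_moment_bound\<close>. Once
  \<open>k\<close> is close to \<open>X ^ 6\<close> it is at most \<open>4 * (2 / j) ^ j\<close>, so
  the sum over all smaller numbers of colours is a geometric series.\<close>

definition \<rho> :: "nat \<Rightarrow> real" where
  "\<rho> j = (real (k j) ^ (j + 1) / (real j + 1) ^ j + 2 ^ j * real (k j)) * q ^ (Suc j choose 2)"

lemma prob_lower_bound:
  assumes \<eta>: "0 < \<eta>" "\<eta> \<le> 1" and \<rho>: "eventually (\<lambda>j. \<rho> j \<le> 1/2) sequentially"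
  shows "eventually (\<lambda>j. prob_Gnm (n j) (m j) (\<lambda>G. real (eq_chromatic (n j) G) = real (n j) / real j)
     \<ge> 1 / (exp (3 * \<eta>) + \<eta> + 6 / E j) - 2 * E j * \<rho> j) sequentially"
  using pair_sum_asymptotic[OF \<eta>] sizes_ok E_pos \<rho>
proof eventually_elim
  case (elim j)
  define d where "d = exp (3 * \<eta>) + \<eta> + 6 / E j - 1"
  have 3: "1 + d = exp (3 * \<eta>) + \<eta> + 6 / E j" by (simp add: d_def)
  have j0: "j > 0" and k0: "k j > 0" using elim by auto
  have mN: "m j \<le> N j" using elim by auto
  have d0: "d \<ge> 0"
  proof -
    have "1 \<le> exp (3 * \<eta>)" "0 \<le> 6 / E j" using \<eta> elim by auto
    then show ?thesis using \<eta> unfolding d_def by linarith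
  qed
  have 1: "prob_Gnm (n j) (m j) (\<lambda>G. \<exists>f\<in>balanced (k j) j. G \<inter> mono_edges (n j) f = {}) \<ge> 1 / (1 + d)"
    unfolding n_def
  proof (rule second_moment_bound)
    show "m j \<le> k j * j choose 2" using mN by (simp add: N_def n_def)
    show "k j * (j choose 2) + m j \<le> k j * j choose 2" using elim by (simp add: N_def n_def F_def)
    fix f assume "f \<in> balanced (k j) j"
    then show "(\<Sum>g\<in>balanced (k j) j. avoid_prob (k j * j choose 2) (m j)
          (2 * (k j * (j choose 2)) - cell_pairs {..<k j} {..<k j} f g {0..<k j * j}))
       \<le> (1 + d) * real (card (balanced (k j) j)) * (avoid_prob (k j * j choose 2) (m j) (k j * (j choose 2)))\<^sup>2"
      using elim(1) unfolding 3 N_def n_def F_def by blast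
  qed (rule d0)
  have \<rho>0: "0 \<le> \<rho> j" unfolding \<rho>_def using q_bounds by (intro mult_nonneg_nonneg add_nonneg_nonneg) auto
  have E0: "0 < E j" using elim by blast
  have "(\<Sum>k'\<in>{1..<k j}. prob_Gnm (n j) (m j) (\<lambda>G. \<exists>f. equitable_colouring (n j) G k' f))
      \<le> (\<Sum>k'\<in>{1..<k j}. E j * \<rho> j ^ (k j - k'))"
  proof (rule sum_mono)
    fix k' assume k': "k' \<in> {1..<k j}"
    then show "prob_Gnm (n j) (m j) (\<lambda>G. \<exists>f. equitable_colouring (n j) G k' f) \<le> E j * \<rho> j ^ (k j - k')"
      unfolding E_def \<rho>_def
      using first_moment_bound[of j k' "k j" "m j" q, folded n_def F_def, folded N_def] elim mN q_bounds j0 by simp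
  qed
  also have "\<dots> = E j * (\<Sum>e\<in>{1..<k j}. \<rho> j ^ e)"
    unfolding sum_distrib_left[symmetric]
    by (rule arg_cong[of _ _ "\<lambda>x. E j * x"], rule sum.reindex_bij_witness[of _ "\<lambda>e. k j - e" "\<lambda>e. k j - e"]) auto
  also have "\<dots> \<le> E j * (2 * \<rho> j)"
  proof (rule mult_left_mono)
    have "(\<Sum>e\<in>{1..<k j}. \<rho> j ^ e) \<le> (\<Sum>e\<in>{1..<k j}. \<rho> j * (1/2) ^ (e - 1))"
    proof (rule sum_mono)
      fix e assume e: "e \<in> {1..<k j}"
      then have "\<rho> j ^ e = \<rho> j * \<rho> j ^ (e - 1)" by (cases e) auto
      also have "\<dots> \<le> \<rho> j * (1/2) ^ (e - 1)" using \<rho>0 elim by (intro mult_left_mono power_mono) auto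
      finally show "\<rho> j ^ e \<le> \<rho> j * (1/2) ^ (e - 1)" .
    qed
    also have "\<dots> = \<rho> j * (\<Sum>i<k j - 1. (1/2) ^ i)"
      unfolding sum_distrib_left[symmetric]
      by (rule arg_cong[of _ _ "\<lambda>x. \<rho> j * x"], rule sum.reindex_bij_witness[of _ Suc "\<lambda>e. e - 1"]) auto
    also have "\<dots> \<le> \<rho> j * 2"
    proof (intro mult_left_mono \<rho>0)
      have "(\<Sum>i<k j - 1. (1/2 :: real) ^ i) \<le> (\<Sum>i. (1/2) ^ i)" by (intro sum_le_suminf summable_geometric) auto
      also have "(\<Sum>i. (1/2 :: real) ^ i) = 2" using suminf_geometric[of "1/2 :: real"] by simp
      finally show "(\<Sum>i<k j - 1. (1/2 :: real) ^ i) \<le> 2" .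
    qed
    finally show "(\<Sum>e\<in>{1..<k j}. \<rho> j ^ e) \<le> 2 * \<rho> j" by simp
  qed (use E0 in simp)
  finally have 2: "(\<Sum>k'\<in>{1..<k j}. prob_Gnm (n j) (m j) (\<lambda>G. \<exists>f. equitable_colouring (n j) G k' f)) \<le> 2 * E j * \<rho> j"
    using E0 by simp
  show ?case
    using prob_equitable_ge[OF j0 k0 mN[unfolded N_def n_def]] 1 2 unfolding 3 n_def by linarith
qed

lemma prob_tendsto_1:
  assumes Etop: "filterlim E at_top sequentially" and E\<rho>: "(\<lambda>j. E j * \<rho> j) \<longlonglongrightarrow> 0"
  shows "(\<lambda>j. prob_Gnm (n j) (m j) (\<lambda>G. real (eq_chromatic (n j) G) = real (n j) / real j)) \<longlonglongrightarrow> 1"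
proof (rule order_tendstoI)
  let ?p = "\<lambda>j. prob_Gnm (n j) (m j) (\<lambda>G. real (eq_chromatic (n j) G) = real (n j) / real j)"
  have "eventually (\<lambda>j. E j \<ge> 1) sequentially" using Etop unfolding filterlim_at_top by blast
  moreover have "eventually (\<lambda>j. E j * \<rho> j < 1/2) sequentially" using E\<rho> by (intro order_tendstoD) auto
  ultimately have \<rho>: "eventually (\<lambda>j. \<rho> j \<le> 1/2) sequentially"
  proof eventually_elim
    case (elim j)
    have "0 \<le> \<rho> j" unfolding \<rho>_def using q_bounds by (intro mult_nonneg_nonneg add_nonneg_nonneg) auto
    then have "1 * \<rho> j \<le> E j * \<rho> j" using elim by (intro mult_right_mono) auto
    then show ?case using elim by linarith
  qed
  fix a :: real assume a: "a < 1"
  \<comment> \<open>By continuity at 0 some fixed \<open>\<eta>\<close> brings the bound above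
    \<open>a\<close>; the summand 0 anticipates the limit of \<open>6 / E j\<close>, which is taken
    afterwards with \<open>\<eta>\<close> fixed.\<close>
  have "((\<lambda>\<eta>. 1 / (exp (3 * \<eta>) + \<eta> + 0)) \<longlongrightarrow> 1 / (exp (3 * 0) + 0 + 0)) (at_right (0::real))"
    by (intro tendsto_intros) auto
  then have "eventually (\<lambda>\<eta>. 1 / (exp (3 * \<eta>) + \<eta> + 0) > a) (at_right (0::real))"
    using a by (intro order_tendstoD) auto
  moreover have "eventually (\<lambda>\<eta>. \<eta> \<in> {0<..<1}) (at_right (0::real))" by (rule eventually_at_right_real) simp
  ultimately have "eventually (\<lambda>\<eta>. \<eta> \<in> {0<..<1} \<and> 1 / (exp (3 * \<eta>) + \<eta> + 0) > a) (at_right (0::real))"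
    by eventually_elim simp
  then obtain \<eta> where \<eta>: "0 < \<eta>" "\<eta> \<le> 1" and a\<eta>: "1 / (exp (3 * \<eta>) + \<eta> + 0) > a"
    by (metis (mono_tags, lifting) eventually_happens' greaterThanLessThan_iff less_imp_le trivial_limit_at_right_real)
  have "((\<lambda>j. 6 / E j) \<longlonglongrightarrow> 0)" using Etop by (intro tendsto_divide_0[OF tendsto_const] filterlim_at_top_imp_at_infinity)
  then have "(\<lambda>j. 1 / (exp (3 * \<eta>) + \<eta> + 6 / E j) - 2 * (E j * \<rho> j)) \<longlonglongrightarrow> 1 / (exp (3 * \<eta>) + \<eta> + 0) - 2 * 0"
    using \<eta> E\<rho> by (intro tendsto_intros) (auto simp: add_pos_pos less_imp_neq[symmetric])
  then have "eventually (\<lambda>j. 1 / (exp (3 * \<eta>) + \<eta> + 6 / E j) - 2 * (E j * \<rho> j) > a) sequentially"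
    using a\<eta> by (intro order_tendstoD) auto
  then show "eventually (\<lambda>j. a < ?p j) sequentially"
    using prob_lower_bound[OF \<eta> \<rho>] by eventually_elim (simp add: mult.assoc)
next
  fix a :: real assume "1 < a"
  moreover have "prob_Gnm N' M P \<le> 1" for N' M P unfolding prob_Gnm_def by simp
  ultimately show "eventually (\<lambda>j. prob_Gnm (n j) (m j) (\<lambda>G. real (eq_chromatic (n j) G) = real (n j) / real j) < a) sequentially"
    by (intro always_eventually allI) (meson le_less_trans)
qed

end

section \<open>The number of colours\<close>

text \<open>The expectation in the binomial model with edge probability \<open>1 - 1 / b\<close>.
  Choosing the number of colours by means of it keeps the rounded edge number out of the
  definition.\<close>

definition expected_count :: "real \<Rightarrow> nat \<Rightarrow> nat \<Rightarrow> real" where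
  "expected_count b j k = fact (k * j) / (fact j ^ k * fact k) / b ^ (k * (j choose 2))"

lemma expected_count_pos: "b > 0 \<Longrightarrow> expected_count b j k > 0"
  unfolding expected_count_def by auto

text \<open>Up to a bounded factor, the ratio of the expected number of colourings in the uniform model to that in
  the binomial model, which is \<^const>\<open>expected_count\<close>.\<close>
definition corr :: "real \<Rightarrow> nat \<Rightarrow> real" where
  "corr b j = exp (- ((b - 1) * (real j - 1)\<^sup>2 / 4))"

text \<open>The threshold \<open>sqrt j ^ j\<close> is unbounded, so that the second moment argument applies, yet small compared
  to \<open>j ^ j\<close>, up to an exponential factor the price of using one colour less.\<close>
definition opt_colours :: "real \<Rightarrow> nat \<Rightarrow> nat" where
  "opt_colours b j = (LEAST k. 0 < k \<and> sqrt (real j) ^ j \<le> expected_count b j k * corr b j)"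

context
  fixes b w :: real
  assumes w: "w > 1" "w ^ 12 = b"
begin

lemma b_gt: "b > 1" using w one_less_power[of w 12] by simp

lemma b_pow_choose: "b ^ (k * (j choose 2)) = (((w ^ j) ^ 6) ^ (j - 1)) ^ k"
proof -
  have "b ^ (k * (j choose 2)) = w ^ (12 * (j choose 2) * k)" by (simp add: w(2)[symmetric] power_mult[symmetric] mult_ac)
  also have "\<dots> = (((w ^ j) ^ 6) ^ (j - 1)) ^ k"
    unfolding twelve_choose_two by (simp only: power_mult[symmetric] mult_ac)
  finally show ?thesis .
qed

text \<open>Stirling leaves a factor \<open>(k / b powr (j/2)) ^ (j - 1)\<close> per class, up to
  \<open>exp 1 * j\<close> here and \<open>exp 1\<close> in the upper bound below. For fixed ratios
  other than 1 this factor overrides the errors, so the expectation passes from small to huge around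
  \<open>k = b powr (j/2)\<close>.\<close>

lemma expected_count_ge:
  assumes "j > 0" "k > 0"
  shows "expected_count b j k \<ge> ((real k / (w ^ j) ^ 6) ^ (j - 1) / (exp 1 * real j)) ^ k"
proof -
  let ?Y = "(w ^ j) ^ 6"
  have Y: "?Y > 0" using w by simp
  have kj: "real k ^ j = real k * real k ^ (j - 1)" using assms by (metis power_minus_mult mult.commute)
  have "((real k / ?Y) ^ (j - 1) / (exp 1 * real j)) ^ k
      = (real k ^ j / (exp 1 * real j * real k * ?Y ^ (j - 1))) ^ k"
    unfolding kj using assms by (simp add: power_divide mult_ac)
  also have "\<dots> = (real (k * j) / exp 1) ^ (k * j) / ((exp 1 * real j * (real j / exp 1) ^ j) ^ k * real k ^ k * (?Y ^ (j - 1)) ^ k)"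
  proof -
    have "(real (k * j) / exp 1) ^ (k * j) = ((real k ^ j) * (real j / exp 1) ^ j) ^ k"
      unfolding power_mult_distrib[symmetric] by (simp add: power_mult[symmetric] mult.commute)
    then show ?thesis using assms by (simp add: power_mult_distrib power_divide)
  qed
  also have "\<dots> \<le> fact (k * j) / (fact j ^ k * fact k * (?Y ^ (j - 1)) ^ k)"
  proof (rule frac_le)
    show "(real (k * j) / exp 1) ^ (k * j) \<le> fact (k * j)" by (rule fact_ge_power)
    have "fact k \<le> real k ^ k" using fact_le_power[of k, where 'a = real] by simp
    then show "fact j ^ k * fact k * (?Y ^ (j - 1)) ^ k \<le> (exp 1 * real j * (real j / exp 1) ^ j) ^ k * real k ^ k * (?Y ^ (j - 1)) ^ k"
      using fact_le_exp_power[OF assms(1)] Y w by (intro mult_mono power_mono) auto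
  qed (use Y in auto)
  also have "\<dots> = expected_count b j k" unfolding expected_count_def b_pow_choose by simp
  finally show ?thesis .
qed

lemma expected_count_le:
  assumes "j > 0" "k > 0"
  shows "expected_count b j k \<le> exp 1 * real (k * j) * (exp 1 * (real k / (w ^ j) ^ 6) ^ (j - 1)) ^ k"
proof -
  let ?Y = "(w ^ j) ^ 6"
  have Y: "?Y > 0" using w by simp
  have kj: "real k ^ j = real k * real k ^ (j - 1)" using assms by (metis power_minus_mult mult.commute)
  have "expected_count b j k = fact (k * j) / (fact j ^ k * fact k * (?Y ^ (j - 1)) ^ k)"
    unfolding expected_count_def b_pow_choose by simp
  also have "\<dots> \<le> (exp 1 * real (k * j) * (real (k * j) / exp 1) ^ (k * j)) / (((real j / exp 1) ^ j) ^ k * (real k / exp 1) ^ k * (?Y ^ (j - 1)) ^ k)"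
  proof (rule frac_le)
    show "fact (k * j) \<le> exp 1 * real (k * j) * (real (k * j) / exp 1) ^ (k * j)" using assms by (intro fact_le_exp_power) auto
    show "((real j / exp 1) ^ j) ^ k * (real k / exp 1) ^ k * (?Y ^ (j - 1)) ^ k \<le> fact j ^ k * fact k * (?Y ^ (j - 1)) ^ k"
      using fact_ge_power Y w by (intro mult_mono power_mono) auto
  qed (use Y assms in auto)
  also have "\<dots> = exp 1 * real (k * j) * ((real (k * j) / exp 1) ^ (k * j) / (((real j / exp 1) ^ j) ^ k * (real k / exp 1) ^ k * (?Y ^ (j - 1)) ^ k))"
    by simp
  also have "(real (k * j) / exp 1) ^ (k * j) / (((real j / exp 1) ^ j) ^ k * (real k / exp 1) ^ k * (?Y ^ (j - 1)) ^ k)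
      = (exp 1 * (real k / ?Y) ^ (j - 1)) ^ k"
  proof -
    have "(real (k * j) / exp 1) ^ (k * j) = ((real k * real k ^ (j - 1)) * (real j / exp 1) ^ j) ^ k"
      unfolding kj[symmetric] power_mult_distrib[symmetric] by (simp add: power_mult[symmetric] mult.commute)
    then show ?thesis using assms by (simp add: power_mult_distrib power_divide)
  qed
  finally show ?thesis .
qed

text \<open>For \<open>k\<close> of order \<open>b powr (j/2)\<close> one more class raises the
  expectation by a factor at most exponential in \<open>j\<close>, so the least admissible
  \<open>k\<close> cannot overshoot the threshold by much.\<close>

lemma expected_count_step:
  assumes "j > 0" "k > 0"
  shows "expected_count b j (Suc k) \<le> expected_count b j k * (exp 1 ^ j * (real (Suc k) / (w ^ j) ^ 6) ^ (j - 1))"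
proof -
  let ?Y = "(w ^ j) ^ 6"
  have Y: "?Y > 0" using w by simp
  let ?K = "real (Suc k)"
  have kj: "?K ^ j = ?K * ?K ^ (j - 1)" using assms by (metis power_minus_mult mult.commute)
  have "fact (Suc k * j) = ffact (Suc k * j) j * fact (k * j)" using ffact_mult_fact[of j "Suc k * j"] by simp
  also have "\<dots> \<le> real (Suc k * j) ^ j * fact (k * j)"
  proof (rule mult_right_mono)
    have "ffact (Suc k * j) j \<le> (\<Prod>x<j. real (Suc k * j))"
      unfolding ffact_def by (intro prod_mono conjI of_nat_0_le_iff of_nat_mono diff_le_self)
    then show "ffact (Suc k * j) j \<le> real (Suc k * j) ^ j" by simp
  qed simp
  finally have f: "fact (Suc k * j) \<le> real (Suc k * j) ^ j * fact (k * j)" .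
  have bb: "b ^ (Suc k * (j choose 2)) = b ^ (k * (j choose 2)) * ?Y ^ (j - 1)"
    unfolding b_pow_choose by (simp add: mult.commute)
  have "expected_count b j (Suc k) = fact (Suc k * j) / (fact j ^ k * fact k * b ^ (k * (j choose 2))) / (fact j * ?K * ?Y ^ (j - 1))"
    unfolding expected_count_def bb by (simp add: mult_ac)
  also have "\<dots> \<le> (real (Suc k * j) ^ j * fact (k * j)) / (fact j ^ k * fact k * b ^ (k * (j choose 2))) / ((real j / exp 1) ^ j * ?K * ?Y ^ (j - 1))"
    using f fact_ge_power[of j] Y b_gt assms by (intro frac_le divide_right_mono mult_right_mono mult_pos_pos) auto
  also have "\<dots> = expected_count b j k * (real (Suc k * j) ^ j / ((real j / exp 1) ^ j * ?K * ?Y ^ (j - 1)))"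
    unfolding expected_count_def by simp
  also have "real (Suc k * j) ^ j / ((real j / exp 1) ^ j * ?K * ?Y ^ (j - 1)) = exp 1 ^ j * (?K / ?Y) ^ (j - 1)"
  proof -
    have "real (Suc k * j) ^ j = (?K * ?K ^ (j - 1)) * real j ^ j" unfolding kj[symmetric] by (simp only: of_nat_mult power_mult_distrib)
    then show ?thesis using assms by (simp add: power_divide del: of_nat_Suc)
  qed
  finally show ?thesis .
qed

lemma w6_ge: "w ^ j \<le> (w ^ j) ^ 6"
  using power_increasing[of 1 6 "w ^ j"] w by simp

text \<open>A constant factor \<open>c > 1\<close> makes each class contribute at least
  \<open>exp 1\<close>, so the expectation is at least \<open>exp k\<close>. This is doubly
  exponential in \<open>j\<close>, while the threshold divided by \<open>corr\<close> is only
  \<open>exp (O(j ^ 2))\<close>.\<close>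

lemma expected_count_large:
  assumes c: "c > 1"
  shows "eventually (\<lambda>j. \<forall>k. c * (w ^ j) ^ 6 \<le> real k \<longrightarrow>
     0 < k \<and> sqrt (real j) ^ j \<le> expected_count b j k * corr b j) sequentially"
proof -
  have "(\<lambda>j. (exp 1)\<^sup>2 * c * (real j ^ 1 * (1 / c) ^ j)) \<longlonglongrightarrow> (exp 1)\<^sup>2 * c * 0"
    using c by (intro tendsto_mult tendsto_const power_mult_geometric_tendsto_0) auto
  then have "eventually (\<lambda>j. (exp 1)\<^sup>2 * c * (real j ^ 1 * (1 / c) ^ j) < 1) sequentially"
    by (intro order_tendstoD) auto
  moreover have "eventually (\<lambda>j. (1 + (b - 1) / 4) * real j ^ 2 \<le> w ^ j) sequentially" by (rule poly_le_power[OF w(1)])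
  moreover have "eventually (\<lambda>j. j \<ge> 1) sequentially" by (rule eventually_ge_at_top)
  ultimately show ?thesis
  proof eventually_elim
    case (elim j)
    show ?case
    proof (intro allI impI conjI)
      fix k assume k: "c * (w ^ j) ^ 6 \<le> real k"
      let ?Y = "(w ^ j) ^ 6"
      have Y: "?Y > 0" using w by simp
      have "1 * ?Y \<le> c * ?Y" using c Y by (intro mult_right_mono) auto
      then have Y1: "?Y \<le> real k" using k by linarith
      show k0: "0 < k" using Y Y1 by (cases k) auto
      have j1: "real j \<ge> 1" "j > 0" using elim by auto
      have "exp 1 \<le> (real k / ?Y) ^ (j - 1) / (exp 1 * real j)"
      proof -
        have cj: "c ^ j = c * c ^ (j - 1)" using j1 by (metis power_minus_mult mult.commute)
        have "(exp 1)\<^sup>2 * real j * c < c ^ j" using elim c by (simp add: power_divide field_simps)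
        then have "(exp 1)\<^sup>2 * real j \<le> c ^ (j - 1)" unfolding cj using c by (simp add: mult.commute)
        also have "\<dots> \<le> (real k / ?Y) ^ (j - 1)" using k c Y by (intro power_mono) (auto simp: le_divide_eq)
        finally show ?thesis using j1 by (simp add: le_divide_eq power2_eq_square mult_ac)
      qed
      then have "exp 1 ^ k \<le> ((real k / ?Y) ^ (j - 1) / (exp 1 * real j)) ^ k" by (intro power_mono) auto
      also have "\<dots> \<le> expected_count b j k" using j1 k0 by (intro expected_count_ge)
      finally have 1: "exp (real k) \<le> expected_count b j k" by (simp add: exp_of_nat_mult[symmetric])
      have "sqrt (real j) ^ j \<le> exp (real j) ^ j"
      proof (intro power_mono)
        have "sqrt (real j) \<le> real j" using j1 by (intro real_le_lsqrt) (auto simp: power2_eq_square)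
        also have "real j \<le> exp (real j)" using exp_ge_add_one_self[of "real j"] by linarith
        finally show "sqrt (real j) \<le> exp (real j)" .
      qed simp
      also have "\<dots> = exp (real j ^ 2)" by (simp add: exp_of_nat_mult[symmetric] power2_eq_square)
      also have "\<dots> \<le> exp (real k) * corr b j"
      proof -
        have "(b - 1) * (real j - 1)\<^sup>2 / 4 \<le> (b - 1) * (real j)\<^sup>2 / 4"
          using b_gt j1 by (intro divide_right_mono mult_left_mono power_mono) auto
        then have "real j ^ 2 + (b - 1) * (real j - 1)\<^sup>2 / 4 \<le> (1 + (b - 1) / 4) * real j ^ 2" by (simp add: algebra_simps)
        also have "\<dots> \<le> real k" using elim w6_ge[of j] Y1 by linarith
        finally show ?thesis unfolding corr_def by (simp add: exp_add[symmetric])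
      qed
      also have "\<dots> \<le> expected_count b j k * corr b j" using 1 by (intro mult_right_mono) (auto simp: corr_def)
      finally show "sqrt (real j) ^ j \<le> expected_count b j k * corr b j" .
    qed
  qed
qed

lemma expected_count_small:
  assumes c: "0 < c" "c < 1"
  shows "eventually (\<lambda>j. \<forall>k>0. real k \<le> c * (w ^ j) ^ 6 \<longrightarrow> expected_count b j k * corr b j < sqrt (real j) ^ j) sequentially"
proof -
  have "(\<lambda>j. 2 * exp 1 / c * (real j ^ 0 * c ^ j)) \<longlonglongrightarrow> 2 * exp 1 / c * 0"
    using c by (intro tendsto_mult tendsto_const power_mult_geometric_tendsto_0) auto
  then have "eventually (\<lambda>j. 2 * exp 1 / c * (real j ^ 0 * c ^ j) < 1) sequentially"
    by (intro order_tendstoD) auto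
  moreover have "eventually (\<lambda>j. j \<ge> 16) sequentially" by (rule eventually_ge_at_top)
  ultimately show ?thesis
  proof eventually_elim
    case (elim j)
    show ?case
    proof (intro allI impI)
      fix k assume k0: "k > 0" and k: "real k \<le> c * (w ^ j) ^ 6"
      let ?Y = "(w ^ j) ^ 6"
      have Y: "?Y > 0" using w by simp
      have j1: "real j \<ge> 16" "j > 0" using elim by auto
      have cj: "c ^ j = c * c ^ (j - 1)" using j1 by (metis power_minus_mult mult.commute)
      have "exp 1 * c ^ (j - 1) \<le> 1/2" using elim c unfolding cj by simp
      moreover have "(real k / ?Y) ^ (j - 1) \<le> c ^ (j - 1)" using k c Y by (intro power_mono) (auto simp: divide_le_eq)
      then have "exp 1 * (real k / ?Y) ^ (j - 1) \<le> exp 1 * c ^ (j - 1)" by (intro mult_left_mono) auto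
      ultimately have h: "exp 1 * (real k / ?Y) ^ (j - 1) \<le> 1/2" by linarith
      have "expected_count b j k \<le> exp 1 * real (k * j) * (exp 1 * (real k / ?Y) ^ (j - 1)) ^ k"
        using j1 k0 by (intro expected_count_le)
      also have "\<dots> \<le> exp 1 * real (k * j) * (1/2) ^ k" using h Y by (intro mult_left_mono power_mono) auto
      also have "\<dots> = exp 1 * real j * (real k / 2 ^ k)" by (simp add: power_divide)
      also have "\<dots> \<le> 3 * real j * 1"
      proof (intro mult_mono)
        have "real k \<le> 2 ^ k" using of_nat_less_two_power[of k, where 'a = real] by simp
        then show "real k / 2 ^ k \<le> 1" by simp
      qed (use exp_le in auto)
      finally have 1: "expected_count b j k \<le> 3 * real j" by simp
      have "expected_count b j k * corr b j \<le> expected_count b j k * 1"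
        using expected_count_pos[of b j k] b_gt by (intro mult_left_mono) (auto simp: corr_def)
      also have "\<dots> \<le> 3 * real j" using 1 by simp
      also have "\<dots> < 4 ^ j"
      proof -
        have "3 * i < 4 ^ i" for i :: nat by (induction i) auto
        then have "3 * j < 4 ^ j" .
        then show ?thesis by (metis of_nat_less_iff of_nat_mult of_nat_numeral of_nat_power)
      qed
      also have "4 ^ j \<le> sqrt (real j) ^ j"
      proof (intro power_mono)
        show "4 \<le> sqrt (real j)" using j1 by (intro real_le_rsqrt) simp
      qed simp
      finally show "expected_count b j k * corr b j < sqrt (real j) ^ j" .
    qed
  qed
qed

lemma opt_colours_spec:
  assumes c: "c > 1"
  shows "eventually (\<lambda>j. 0 < opt_colours b j \<and> sqrt (real j) ^ j \<le> expected_count b j (opt_colours b j) * corr b j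
      \<and> real (opt_colours b j) \<le> c * (w ^ j) ^ 6 + 1) sequentially"
  using expected_count_large[OF c]
proof eventually_elim
  case (elim j)
  let ?P = "\<lambda>k. 0 < k \<and> sqrt (real j) ^ j \<le> expected_count b j k * corr b j"
  define k where "k = nat \<lceil>c * (w ^ j) ^ 6\<rceil>"
  have 0: "0 \<le> c * (w ^ j) ^ 6" using c w by simp
  have "c * (w ^ j) ^ 6 \<le> real k" unfolding k_def by (rule real_nat_ceiling_ge)
  then have P: "?P k" using elim by blast
  have "opt_colours b j \<le> k" unfolding opt_colours_def by (rule Least_le[of ?P, OF P])
  moreover have "real k \<le> c * (w ^ j) ^ 6 + 1" unfolding k_def using 0 by linarith
  ultimately have "real (opt_colours b j) \<le> c * (w ^ j) ^ 6 + 1" by linarith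
  moreover have "?P (opt_colours b j)" unfolding opt_colours_def by (rule LeastI[of ?P, OF P])
  ultimately show ?case by blast
qed

lemma opt_colours_lim: "(\<lambda>j. real (opt_colours b j) / (w ^ j) ^ 6) \<longlonglongrightarrow> 1"
proof (rule order_tendstoI)
  fix a :: real assume a: "a < 1"
  define c where "c = max a (1/2)"
  have c: "0 < c" "c < 1" "a \<le> c" using a by (auto simp: c_def)
  show "eventually (\<lambda>j. a < real (opt_colours b j) / (w ^ j) ^ 6) sequentially"
    using expected_count_small[OF c(1,2)] opt_colours_spec[of 2, simplified]
  proof eventually_elim
    case (elim j)
    have Y: "(w ^ j) ^ 6 > 0" using w by simp
    have "\<not> real (opt_colours b j) \<le> c * (w ^ j) ^ 6" using elim by (meson linorder_not_less)
    then have "c < real (opt_colours b j) / (w ^ j) ^ 6" using Y by (simp add: less_divide_eq)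
    then show ?case using c by linarith
  qed
next
  fix a :: real assume a: "1 < a"
  define c where "c = (1 + a) / 2"
  have c: "1 < c" "c < a" using a by (auto simp: c_def)
  have "eventually (\<lambda>j. (2 / (a - c)) * real j ^ 0 \<le> w ^ j) sequentially" by (rule poly_le_power[OF w(1)])
  then show "eventually (\<lambda>j. real (opt_colours b j) / (w ^ j) ^ 6 < a) sequentially"
    using opt_colours_spec[OF c(1)]
  proof eventually_elim
    case (elim j)
    have Y: "(w ^ j) ^ 6 > 0" using w by simp
    have "2 / (a - c) \<le> (w ^ j) ^ 6" using elim w6_ge[of j] by simp
    then have "2 \<le> (a - c) * (w ^ j) ^ 6" using c by (simp add: divide_le_eq mult.commute)
    then have "real (opt_colours b j) < a * (w ^ j) ^ 6" using elim by (simp add: algebra_simps)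
    then show ?case using Y by (simp add: divide_less_eq)
  qed
qed

text \<open>By minimality the predecessor misses the threshold, and one step multiplies by at most
  \<open>3 ^ j * 2 ^ (j - 1)\<close>: 3 bounds \<open>exp 1\<close>, and 2 bounds the ratio of the
  number of colours to \<open>b powr (j/2)\<close>.\<close>

lemma opt_colours_upper:
  "eventually (\<lambda>j. expected_count b j (opt_colours b j) * corr b j \<le> 6 ^ j * sqrt (real j) ^ j) sequentially"
proof -
  have "eventually (\<lambda>j. real (opt_colours b j) / (w ^ j) ^ 6 < 2) sequentially"
    using opt_colours_lim by (intro order_tendstoD) auto
  moreover have "eventually (\<lambda>j. real (opt_colours b j) / (w ^ j) ^ 6 > 1/2) sequentially"
    using opt_colours_lim by (intro order_tendstoD) auto
  moreover have "eventually (\<lambda>j. 4 * real j ^ 0 \<le> w ^ j) sequentially" by (rule poly_le_power[OF w(1)])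
  ultimately show ?thesis using eventually_ge_at_top[of 1]
  proof eventually_elim
    case (elim j)
    let ?Y = "(w ^ j) ^ 6"
    have Y: "?Y > 0" using w by simp
    have "real (opt_colours b j) > 1/2 * ?Y" using elim Y by (simp add: less_divide_eq)
    then have "real (opt_colours b j) > 1" using elim w6_ge[of j] by simp
    then obtain k where k: "opt_colours b j = Suc k" "k > 0" by (cases "opt_colours b j") auto
    have j0: "j > 0" using elim by simp
    have "\<not> (0 < k \<and> sqrt (real j) ^ j \<le> expected_count b j k * corr b j)"
      using not_less_Least[of k "\<lambda>k. 0 < k \<and> sqrt (real j) ^ j \<le> expected_count b j k * corr b j"] k
      by (simp add: opt_colours_def[symmetric])
    then have small: "expected_count b j k * corr b j < sqrt (real j) ^ j" using k by simp
    have c0: "0 < corr b j" by (simp add: corr_def)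
    have r: "exp 1 ^ j * (real (Suc k) / ?Y) ^ (j - 1) \<le> 6 ^ j"
    proof -
      have "exp 1 ^ j * (real (Suc k) / ?Y) ^ (j - 1) \<le> 3 ^ j * 2 ^ (j - 1)"
        using elim k Y exp_le by (intro mult_mono power_mono) auto
      also have "\<dots> \<le> 3 ^ j * 2 ^ j" by (intro mult_left_mono power_increasing) auto
      also have "\<dots> = (6 :: real) ^ j" by (simp add: power_mult_distrib[symmetric])
      finally show ?thesis .
    qed
    have "expected_count b j (Suc k) * corr b j
        \<le> expected_count b j k * (exp 1 ^ j * (real (Suc k) / ?Y) ^ (j - 1)) * corr b j"
      using expected_count_step[OF j0 k(2)] c0 by (intro mult_right_mono) auto
    also have "\<dots> = (expected_count b j k * corr b j) * (exp 1 ^ j * (real (Suc k) / ?Y) ^ (j - 1))" by simp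
    also have "\<dots> \<le> sqrt (real j) ^ j * 6 ^ j" using small r Y by (intro mult_mono) auto
    finally show ?case by (simp add: k mult.commute)
  qed
qed

end

section \<open>Expected counts in the uniform model compared with the binomial model\<close>

context colour_sequence
begin

text \<open>Multiplied by \<open>b\<close>, the conditional chance of avoiding pair number
  \<open>i\<close> is about \<open>1 - (b - 1) * i / N\<close>. Summed over \<open>i < F\<close> the
  exponent is \<open>(b - 1) * F ^ 2 / (2 * N)\<close>, and \<open>F ^ 2 / N\<close> is about
  \<open>(j - 1) ^ 2 / 2\<close>. The rounding of \<open>m\<close> costs \<open>b / (N - F)\<close>
  per factor, at most \<open>1/3\<close> altogether.\<close>

lemma correction_upper:
  "eventually (\<lambda>j. avoid_prob (N j) (m j) (F j) * b ^ F j \<le> 3 * corr b j) sequentially"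
proof -
  have "eventually (\<lambda>j. 4 * b \<le> real (k j)) sequentially" by (rule k_ge_const)
  moreover have "eventually (\<lambda>j. j \<ge> 2) sequentially" by (rule eventually_ge_at_top)
  ultimately show ?thesis using sizes_ok
  proof eventually_elim
    case (elim j)
    let ?N = "real (N j)" and ?F = "real (F j)" and ?m = "real (m j)"
    have b1: "b > 1" by (rule b_gt_1)
    have bq: "b * q = 1" using q_bounds by (simp add: b)
    have CF: "4 * b * ?F \<le> ?N" using elim b1 by (intro F_le_N) auto
    have lt: "2 * F j + m j < N j" using elim by blast
    then have N0: "?N > 0" by simp
    have F1: "?F \<le> b * ?F" using b1 mult_right_mono[of 1 b ?F] by simp
    have NF: "?N - ?F \<ge> 3 * (b * ?F)" "?N - ?F > 0" using CF F1 lt by (auto simp: algebra_simps)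
    have step: "b * (real (N j - i - m j) / real (N j - i)) \<le> exp (b / (?N - ?F) - (b - 1) * real i / ?N)" if i: "i < F j" for i
    proof -
      have iN: "real i < ?F" "real (N j - i - m j) = ?N - real i - ?m" "real (N j - i) = ?N - real i"
        using i lt by (auto simp: of_nat_diff)
      have "?N - ?m \<le> q * ?N + 1" using m_bounds(1)[of j] by (simp add: q algebra_simps)
      then have "b * (?N - real i - ?m) \<le> b * (q * ?N + 1 - real i)" using b1 by (intro mult_left_mono) auto
      also have "\<dots> = b * q * ?N + b - b * real i" by (simp add: algebra_simps)
      also have "\<dots> = (?N - real i) + (b - (b - 1) * real i)" using bq by (simp add: algebra_simps)
      finally have "b * ((?N - real i - ?m) / (?N - real i)) \<le> ((?N - real i) + (b - (b - 1) * real i)) / (?N - real i)"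
        using iN(1) NF by (simp add: divide_right_mono)
      also have "\<dots> = 1 + b / (?N - real i) - (b - 1) * real i / (?N - real i)"
        using iN(1) NF by (simp add: add_divide_distrib diff_divide_distrib)
      also have "\<dots> \<le> 1 + b / (?N - ?F) - (b - 1) * real i / ?N"
        using iN(1) NF b1 N0 by (intro diff_mono add_left_mono divide_left_mono mult_pos_pos) auto
      also have "\<dots> \<le> exp (b / (?N - ?F) - (b - 1) * real i / ?N)"
        using exp_ge_add_one_self[of "b / (?N - ?F) - (b - 1) * real i / ?N"] by linarith
      finally show ?thesis unfolding iN(2,3) .
    qed
    have ind: "avoid_prob (N j) (m j) x * b ^ x \<le> exp (real x * (b / (?N - ?F)) - (b - 1) * (real x * (real x - 1) / 2) / ?N)"
      if "x \<le> F j" for x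
      using that
    proof (induction x)
      case 0
      then show ?case using lt by (simp add: avoid_prob_0)
    next
      case (Suc x)
      have "avoid_prob (N j) (m j) (Suc x) * b ^ Suc x
          = (avoid_prob (N j) (m j) x * b ^ x) * (b * (real (N j - x - m j) / real (N j - x)))"
        using avoid_prob_Suc[of x "N j" "m j"] Suc.prems lt by simp
      also have "\<dots> \<le> exp (real x * (b / (?N - ?F)) - (b - 1) * (real x * (real x - 1) / 2) / ?N)
          * exp (b / (?N - ?F) - (b - 1) * real x / ?N)"
        using Suc b1 by (intro mult_mono step) auto
      also have "\<dots> = exp ((real x * (b / (?N - ?F)) + b / (?N - ?F))
          - ((b - 1) * (real x * (real x - 1) / 2) / ?N + (b - 1) * real x / ?N))"
        by (simp add: exp_add[symmetric])
      also have "real x * (b / (?N - ?F)) + b / (?N - ?F) = real (Suc x) * (b / (?N - ?F))"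
        by (simp only: of_nat_Suc distrib_right mult_1_left add.commute)
      also have "(b - 1) * (real x * (real x - 1) / 2) / ?N + (b - 1) * real x / ?N
          = (b - 1) * (real (Suc x) * (real (Suc x) - 1) / 2) / ?N"
      proof -
        have "real (Suc x) * (real (Suc x) - 1) / 2 = real x * (real x - 1) / 2 + real x" by (simp add: field_simps)
        then show ?thesis by (simp only: distrib_left add_divide_distrib)
      qed
      finally show ?case .
    qed
    have n2: "n j \<ge> 2" using elim mult_le_mono[of 1 "k j" 2 j] by (simp add: n_def)
    have "?F * (b / (?N - ?F)) - (b - 1) * (?F * (?F - 1) / 2) / ?N \<le> 1 - (b - 1) * (real j - 1)\<^sup>2 / 4"
    proof -
      have 1: "?F * (b / (?N - ?F)) \<le> 1/3" using NF by (simp add: divide_le_eq mult.commute)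
      have "(b - 1) * ?F \<le> b * ?F" by (simp add: algebra_simps)
      then have 2: "(b - 1) * (?F / 2) / ?N \<le> 1/8" using CF N0 by (simp add: divide_le_eq)
      have "(b - 1) * ((real j - 1)\<^sup>2 / 2) \<le> (b - 1) * (?F ^ 2 / ?N)"
        using F_square_div_N(2)[OF n2] b1 by (intro mult_left_mono) auto
      then have 3: "(b - 1) * (real j - 1)\<^sup>2 / 4 \<le> (b - 1) * (?F ^ 2 / 2) / ?N" by (simp add: mult_ac)
      have "(b - 1) * (?F * (?F - 1) / 2) / ?N = (b - 1) * (?F ^ 2 / 2) / ?N - (b - 1) * (?F / 2) / ?N"
        by (simp add: power2_eq_square right_diff_distrib diff_divide_distrib)
      then show ?thesis using 1 2 3 by linarith
    qed
    then have "exp (?F * (b / (?N - ?F)) - (b - 1) * (?F * (?F - 1) / 2) / ?N) \<le> exp (1 - (b - 1) * (real j - 1)\<^sup>2 / 4)" by simp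
    also have "\<dots> = exp 1 * corr b j" unfolding corr_def exp_add[symmetric] by simp
    also have "\<dots> \<le> 3 * corr b j" using exp_le by (intro mult_right_mono) (auto simp: corr_def)
    finally show ?case using ind[of "F j"] by simp
  qed
qed

lemma correction_lower:
  "eventually (\<lambda>j. avoid_prob (N j) (m j) (F j) * b ^ F j \<ge> corr b j / 3) sequentially"
proof -
  have "eventually (\<lambda>j. (8 * b\<^sup>2) * real j ^ 2 \<le> real (k j)) sequentially" by (rule k_ge_poly)
  moreover have "eventually (\<lambda>j. j \<ge> 2) sequentially" by (rule eventually_ge_at_top)
  ultimately show ?thesis using sizes_ok
  proof eventually_elim
    case (elim j)
    let ?N = "real (N j)" and ?F = "real (F j)" and ?m = "real (m j)" and ?n = "real (n j)"
    have b1: "b > 1" by (rule b_gt_1)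
    have bq: "b * q = 1" using q_bounds by (simp add: b)
    have j1: "real j ^ 2 \<ge> 1" using elim by simp
    have bb: "b\<^sup>2 \<ge> b" "b\<^sup>2 \<ge> 1" using b1 mult_left_mono[of 1 b b] mult_mono[of 1 b 1 b] by (auto simp: power2_eq_square)
    have bj: "b\<^sup>2 * real j ^ 2 \<ge> 1" using mult_mono[of 1 "b\<^sup>2" 1 "real j ^ 2"] bb j1 by simp
    have CF: "(8 * b\<^sup>2 * real j ^ 2) * ?F \<le> ?N" using elim bj by (intro F_le_N) auto
    have lt: "2 * F j + m j < N j" using elim by blast
    have N0: "?N > 0" using lt by simp
    have NF0: "?N - ?F > 0" using lt by auto
    \<comment> \<open>Since the exponent is itself of order \<open>j ^ 2\<close>, all relative
      errors must be \<open>O(1 / j ^ 2)\<close>. The quantity \<open>\<tau>\<close> bounds all of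
      them, and \<open>7 * \<tau>\<close> bounds the excess of the product of three factors
      \<open>1 + \<tau>\<close>, which changes the exponent by at most 1.\<close>
    define \<tau> where "\<tau> = 1 / (2 * b * real j ^ 2)"
    have \<tau>: "0 < \<tau>" "\<tau> \<le> 1"
    proof -
      show "0 < \<tau>" using b1 elim by (simp add: \<tau>_def)
      have "2 * b * real j ^ 2 \<ge> 1 * 1" using b1 j1 by (intro mult_mono) auto
      then show "\<tau> \<le> 1" by (simp add: \<tau>_def)
    qed
    have NF: "4 * b\<^sup>2 * real j ^ 2 * ?F \<le> ?N - ?F"
    proof -
      have "1 * ?F \<le> (4 * b\<^sup>2 * real j ^ 2) * ?F" using bj by (intro mult_right_mono) auto
      then show ?thesis using CF by simp
    qed
    have a: "2 * b * ?F / (?N - ?F) \<le> \<tau>"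
    proof -
      have "2 * b * ?F * (2 * b * real j ^ 2) \<le> ?N - ?F" using NF by (simp add: power2_eq_square mult_ac)
      then show ?thesis using NF0 b1 elim unfolding \<tau>_def by (simp add: field_simps)
    qed
    define V where "V = (b - 1) * ?F / (?N - ?F)"
    have V0: "0 \<le> V" using b1 NF0 by (simp add: V_def)
    have a1: "2 * V \<le> \<tau>"
    proof -
      have "2 * V \<le> 2 * b * ?F / (?N - ?F)" unfolding V_def using NF0 b1
        by (simp add: divide_right_mono mult_right_mono)
      then show ?thesis using a by linarith
    qed
    have V1: "V \<le> 1/2" using a1 \<tau> by linarith
    have a2: "?F / (?N - ?F) \<le> \<tau>"
    proof -
      have "1 * ?F \<le> 2 * b * ?F" using b1 by (intro mult_right_mono) auto
      then have "?F / (?N - ?F) \<le> 2 * b * ?F / (?N - ?F)" using NF0 by (intro divide_right_mono) auto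
      then show ?thesis using a by linarith
    qed
    have n2: "n j \<ge> 2" using elim mult_le_mono[of 1 "k j" 2 j] by (simp add: n_def)
    have a3: "1 / (?n - 1) \<le> \<tau>"
    proof -
      have "real (k j) * 1 \<le> real (k j) * real j" using elim by (intro mult_left_mono) auto
      moreover have "8 * b\<^sup>2 * real j ^ 2 \<le> real (k j)" using elim by blast
      moreover have "?n = real (k j) * real j" by (simp add: n_def)
      ultimately have "8 * b\<^sup>2 * real j ^ 2 \<le> ?n" by linarith
      moreover have "2 * b * real j ^ 2 \<le> 2 * b\<^sup>2 * real j ^ 2" using bb by (intro mult_right_mono) auto
      ultimately have "2 * b * real j ^ 2 \<le> ?n - 1" using bj by linarith
      moreover have "2 * b * real j ^ 2 > 0" using b1 elim by simp
      ultimately show ?thesis unfolding \<tau>_def by (intro divide_left_mono) auto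
    qed
    have step: "b * (real (N j - i - m j) / real (N j - i)) \<ge> exp (- ((1 + 2 * V) * (b - 1) / (?N - ?F) * real i))" if i: "i < F j" for i
    proof -
      have iN: "real i < ?F" "real (N j - i - m j) = ?N - real i - ?m" "real (N j - i) = ?N - real i"
        using i lt by (auto simp: of_nat_diff)
      define v where "v = (b - 1) * real i / (?N - ?F)"
      have v0: "0 \<le> v" using b1 NF0 by (simp add: v_def)
      have vV: "v \<le> V" unfolding v_def V_def using iN(1) b1 NF0 by (intro divide_right_mono mult_left_mono) auto
      have "- v - 2 * v\<^sup>2 \<le> ln (1 - v)" using v0 vV V1 by (intro ln_one_minus_pos_lower_bound) auto
      moreover have "v * v \<le> V * v" using vV v0 by (intro mult_right_mono) auto
      ultimately have "- ((1 + 2 * V) * v) \<le> ln (1 - v)" by (simp add: power2_eq_square algebra_simps)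
      then have "exp (- ((1 + 2 * V) * v)) \<le> exp (ln (1 - v))" by simp
      also have "\<dots> = 1 - v" using vV V1 by simp
      also have "\<dots> \<le> 1 - (b - 1) * real i / (?N - real i)"
        unfolding v_def using iN(1) NF0 b1 by (intro diff_left_mono divide_left_mono mult_pos_pos) auto
      also have "\<dots> = (?N - b * real i) / (?N - real i)"
      proof -
        have "?N - real i > 0" using iN(1) NF0 by linarith
        then show ?thesis by (simp add: field_simps)
      qed
      also have "\<dots> \<le> b * (?N - real i - ?m) / (?N - real i)"
      proof (rule divide_right_mono)
        have "b * (q * ?N - real i) \<le> b * (?N - real i - ?m)"
          using m_bounds(2)[of j] b1 by (intro mult_left_mono) (auto simp: q algebra_simps)
        moreover have "b * (q * ?N - real i) = b * q * ?N - b * real i" by (simp add: algebra_simps)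
        ultimately show "?N - b * real i \<le> b * (?N - real i - ?m)" using bq by simp
      qed (use iN(1) NF0 in linarith)
      finally show ?thesis unfolding iN(2,3) v_def by (simp add: mult_ac)
    qed
    have ind: "avoid_prob (N j) (m j) x * b ^ x \<ge> exp (- ((1 + 2 * V) * (b - 1) / (?N - ?F) * (real x * (real x - 1) / 2)))"
      if "x \<le> F j" for x
      using that
    proof (induction x)
      case 0
      then show ?case using lt by (simp add: avoid_prob_0)
    next
      case (Suc x)
      let ?c = "(1 + 2 * V) * (b - 1) / (?N - ?F)"
      have "real (Suc x) * (real (Suc x) - 1) / 2 = real x * (real x - 1) / 2 + real x" by (simp add: field_simps)
      then have "exp (- (?c * (real (Suc x) * (real (Suc x) - 1) / 2)))
          = exp (- (?c * (real x * (real x - 1) / 2))) * exp (- (?c * real x))"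
        by (simp only: exp_add[symmetric] distrib_left minus_add_distrib)
      also have "\<dots> \<le> (avoid_prob (N j) (m j) x * b ^ x) * (b * (real (N j - x - m j) / real (N j - x)))"
        using Suc b1 avoid_prob_nonneg[of "N j" "m j" x] by (intro mult_mono step) auto
      also have "\<dots> = avoid_prob (N j) (m j) (Suc x) * b ^ Suc x"
        using avoid_prob_Suc[of x "N j" "m j"] Suc.prems lt by simp
      finally show ?case .
    qed
    define s where "s = (real j - 1)\<^sup>2 / 2"
    have s: "0 \<le> s" "s \<le> real j ^ 2 / 2"
      unfolding s_def using elim by (auto intro!: divide_right_mono power_mono)
    have "(1 + 2 * V) * (b - 1) / (?N - ?F) * (?F * (?F - 1) / 2) \<le> (b - 1) * (real j - 1)\<^sup>2 / 4 + 1"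
    proof -
      have "?F * (?F - 1) \<le> ?F ^ 2" by (simp add: power2_eq_square algebra_simps)
      then have "(1 + 2 * V) * (b - 1) / (?N - ?F) * (?F * (?F - 1) / 2) \<le> (1 + 2 * V) * (b - 1) / (?N - ?F) * (?F ^ 2 / 2)"
        using V0 b1 NF0 by (intro mult_left_mono divide_right_mono) auto
      also have "\<dots> = (b - 1) / 2 * ((1 + 2 * V) * (?N / (?N - ?F)) * (?F ^ 2 / ?N))"
        using N0 by (simp add: mult_ac)
      also have "?N / (?N - ?F) = 1 + ?F / (?N - ?F)" using NF0 by (simp add: field_simps)
      also have "?F ^ 2 / ?N = s * (1 + 1 / (?n - 1))"
        unfolding F_square_div_N(1)[OF n2] s_def using n2 by (simp add: field_simps)
      also have "(b - 1) / 2 * ((1 + 2 * V) * (1 + ?F / (?N - ?F)) * (s * (1 + 1 / (?n - 1))))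
          \<le> (b - 1) / 2 * ((1 + \<tau>) * (1 + \<tau>) * (s * (1 + \<tau>)))"
        using a1 a2 a3 V0 NF0 s b1 n2 by (intro mult_left_mono mult_mono) auto
      also have "\<dots> \<le> (b - 1) / 2 * (s + 7 * \<tau> * s)"
      proof (rule mult_left_mono)
        have t2: "\<tau> * \<tau> \<le> \<tau>" using \<tau> mult_left_mono[of \<tau> 1 \<tau>] by simp
        moreover have "\<tau> * \<tau> * \<tau> \<le> \<tau>" using \<tau> t2 mult_right_mono[OF t2, of \<tau>] by linarith
        ultimately have "(1 + \<tau>) * (1 + \<tau>) * (1 + \<tau>) \<le> 1 + 7 * \<tau>" by (simp add: algebra_simps)
        then have "s * ((1 + \<tau>) * (1 + \<tau>) * (1 + \<tau>)) \<le> s * (1 + 7 * \<tau>)" using s by (intro mult_left_mono)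
        then show "(1 + \<tau>) * (1 + \<tau>) * (s * (1 + \<tau>)) \<le> s + 7 * \<tau> * s" by (simp add: algebra_simps)
      qed (use b1 in simp)
      also have "\<dots> \<le> (b - 1) / 2 * s + 1"
      proof -
        have "7 * \<tau> * s \<le> 7 * \<tau> * (real j ^ 2 / 2)" using s \<tau> by (intro mult_left_mono) auto
        also have "\<dots> = 7 / (4 * b)" using elim b1 by (simp add: \<tau>_def)
        finally have "(b - 1) / 2 * (7 * \<tau> * s) \<le> (b - 1) / 2 * (7 / (4 * b))" using b1 by (intro mult_left_mono) auto
        also have "\<dots> \<le> 1" using b1 by (simp add: field_simps)
        finally show ?thesis by (simp add: distrib_left)
      qed
      finally show ?thesis using b1 by (simp add: s_def)
    qed
    then have "exp (- ((b - 1) * (real j - 1)\<^sup>2 / 4 + 1)) \<le> exp (- ((1 + 2 * V) * (b - 1) / (?N - ?F) * (?F * (?F - 1) / 2)))" by simp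
    also have "\<dots> \<le> avoid_prob (N j) (m j) (F j) * b ^ F j" by (rule ind) simp
    finally have "corr b j / exp 1 \<le> avoid_prob (N j) (m j) (F j) * b ^ F j"
      by (simp add: corr_def exp_add[symmetric] exp_diff[symmetric])
    moreover have "corr b j / 3 \<le> corr b j / exp 1" using exp_le by (intro divide_left_mono) (auto simp: corr_def)
    ultimately show ?case by linarith
  qed
qed

lemma E_eq: "E j = expected_count b j (k j) * (avoid_prob (N j) (m j) (F j) * b ^ F j)"
  unfolding E_def expected_count_def using b_gt_1 by (simp add: n_def F_def)

lemma E_at_top:
  assumes "eventually (\<lambda>j. sqrt (real j) ^ j \<le> expected_count b j (k j) * corr b j) sequentially"
  shows "filterlim E at_top sequentially"
proof (rule filterlim_at_top_mono)
  show "filterlim (\<lambda>j. real j / 3) at_top sequentially"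
    using filterlim_tendsto_pos_mult_at_top[of "\<lambda>_. 1/3 :: real" "1/3" sequentially real, OF tendsto_const _ filterlim_real_sequentially]
    by simp
  show "eventually (\<lambda>j. real j / 3 \<le> E j) sequentially"
    using assms correction_lower eventually_ge_at_top[of 2]
  proof eventually_elim
    case (elim j)
    have "real j = sqrt (real j) ^ 2" by simp
    also have "\<dots> \<le> sqrt (real j) ^ j" using elim by (intro power_increasing) auto
    also have "\<dots> \<le> expected_count b j (k j) * corr b j" using elim by simp
    finally have "real j / 3 \<le> expected_count b j (k j) * (corr b j / 3)" by simp
    also have "\<dots> \<le> E j" unfolding E_eq using elim expected_count_pos[of b j "k j"] b_gt_1 by (intro mult_left_mono) auto
    finally show ?case .
  qed
qed

text \<open>Here \<open>E\<close> is at most \<open>3 * (6 * sqrt j) ^ j\<close> and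
  \<open>\<rho>\<close> at most \<open>4 * (2 / j) ^ j\<close>, so the product is at most
  \<open>12 * (12 / sqrt j) ^ j\<close>; from \<open>j = 24 ^ 2\<close> on the base is at most
  \<open>1/2\<close>.\<close>

lemma E_\<rho>_tendsto_0:
  assumes "eventually (\<lambda>j. expected_count b j (k j) * corr b j \<le> 6 ^ j * sqrt (real j) ^ j) sequentially"
  shows "(\<lambda>j. E j * \<rho> j) \<longlonglongrightarrow> 0"
proof (rule tendsto_sandwich[where f = "\<lambda>_. 0" and h = "\<lambda>j. 12 * (1/2) ^ j"])
  show "(\<lambda>_. 0 :: real) \<longlonglongrightarrow> 0" by simp
  have "(\<lambda>j. 12 * (1/2 :: real) ^ j) \<longlonglongrightarrow> 12 * 0" by (intro tendsto_mult tendsto_const LIMSEQ_realpow_zero) auto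
  then show "(\<lambda>j. 12 * (1/2 :: real) ^ j) \<longlonglongrightarrow> 0" by simp
  have \<rho>0: "0 \<le> \<rho> j" for j unfolding \<rho>_def using q_bounds by (intro mult_nonneg_nonneg add_nonneg_nonneg) auto
  show "eventually (\<lambda>j. 0 \<le> E j * \<rho> j) sequentially"
    using E_pos by eventually_elim (use \<rho>0 in auto)
  have "eventually (\<lambda>j. real (k j) \<le> 2 * X j ^ 6) sequentially" by (rule k_le) simp
  moreover have "eventually (\<lambda>j. 2 * real j ^ 1 \<le> X j) sequentially" by (rule poly_le_X)
  moreover have "eventually (\<lambda>j. j \<ge> 24 ^ 2) sequentially" by (rule eventually_ge_at_top)
  ultimately show "eventually (\<lambda>j. E j * \<rho> j \<le> 12 * (1/2) ^ j) sequentially"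
    using assms correction_upper
  proof eventually_elim
    case (elim j)
    let ?k = "real (k j)" and ?Y = "X j ^ 6"
    have Y: "?Y > 0" by (rule zero_less_power[OF X_pos])
    have j1: "real j \<ge> 24 ^ 2" using elim by (metis of_nat_le_iff of_nat_numeral of_nat_power)
    have qe: "q ^ (Suc j choose 2) = 1 / ?Y ^ (j + 1)"
    proof -
      have "b ^ (Suc j choose 2) = w ^ (12 * (Suc j choose 2))" by (simp add: power_mult w(2))
      also have "12 * (Suc j choose 2) = j * 6 * (j + 1)" using twelve_choose_two[of "Suc j"] by simp
      also have "w ^ (j * 6 * (j + 1)) = ?Y ^ (j + 1)" unfolding X_def by (simp only: power_mult)
      finally have "b ^ (Suc j choose 2) = ?Y ^ (j + 1)" .
      moreover have "q = 1 / b" using q_bounds by (simp add: b)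
      ultimately show ?thesis by (simp add: power_divide)
    qed
    have JY: "real j + 1 \<le> ?Y"
    proof -
      have "real j + 1 \<le> X j" using elim j1 by simp
      also have "\<dots> \<le> ?Y" using power_increasing[of 1 6 "X j"] X_ge_1[of j] by simp
      finally show ?thesis .
    qed
    have r1: "?k ^ (j + 1) / (real j + 1) ^ j * (1 / ?Y ^ (j + 1)) \<le> 2 ^ (j + 1) / (real j + 1) ^ j"
    proof -
      have "(?k / ?Y) ^ (j + 1) \<le> 2 ^ (j + 1)" using elim Y by (intro power_mono) (auto simp: divide_le_eq)
      then have "(?k / ?Y) ^ (j + 1) / (real j + 1) ^ j \<le> 2 ^ (j + 1) / (real j + 1) ^ j" by (intro divide_right_mono) auto
      then show ?thesis by (simp add: power_divide mult.commute)
    qed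
    have r2: "2 ^ j * ?k * (1 / ?Y ^ (j + 1)) \<le> 2 ^ (j + 1) / (real j + 1) ^ j"
    proof -
      have "2 ^ j * ?k * (1 / ?Y ^ (j + 1)) \<le> 2 ^ j * (2 * ?Y) * (1 / ?Y ^ (j + 1))"
        using elim Y by (intro mult_right_mono mult_left_mono) auto
      also have "\<dots> = 2 ^ (j + 1) / ?Y ^ j" using Y by simp
      also have "\<dots> \<le> 2 ^ (j + 1) / (real j + 1) ^ j" using JY Y by (intro divide_left_mono power_mono mult_pos_pos) auto
      finally show ?thesis .
    qed
    have "\<rho> j \<le> 2 * (2 ^ (j + 1) / (real j + 1) ^ j)" unfolding \<rho>_def qe distrib_right using r1 r2 by linarith
    also have "\<dots> \<le> 2 * (2 ^ (j + 1) / real j ^ j)" using j1 by (intro mult_left_mono divide_left_mono power_mono mult_pos_pos) auto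
    finally have rho: "\<rho> j \<le> 4 * (2 / real j) ^ j" by (simp add: power_divide)
    have "E j \<le> expected_count b j (k j) * (3 * corr b j)"
      unfolding E_eq using elim expected_count_pos[of b j "k j"] b_gt_1 by (intro mult_left_mono) auto
    also have "\<dots> \<le> 3 * (6 ^ j * sqrt (real j) ^ j)" using elim by simp
    finally have "E j \<le> 3 * (6 * sqrt (real j)) ^ j" by (simp add: power_mult_distrib)
    then have "E j * \<rho> j \<le> 3 * (6 * sqrt (real j)) ^ j * (4 * (2 / real j) ^ j)"
      using rho \<rho>0 by (intro mult_mono) auto
    also have "\<dots> = 12 * (6 * sqrt (real j) * (2 / real j)) ^ j" by (simp only: power_mult_distrib)
    also have "\<dots> \<le> 12 * (1/2) ^ j"
    proof (intro mult_left_mono power_mono)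
      have s24: "sqrt (real j) \<ge> 24" using j1 by (intro real_le_rsqrt) simp
      have "6 * sqrt (real j) * (2 / real j) = 12 * (sqrt (real j) / real j)" by simp
      also have "sqrt (real j) / real j = 1 / sqrt (real j)" 
      proof -
        have "sqrt (real j) * sqrt (real j) = real j" by simp
        then show ?thesis using s24 j1 by (simp add: frac_eq_eq)
      qed
      also have "12 * (1 / sqrt (real j)) \<le> 1/2" using s24 by (simp add: divide_le_eq)
      finally show "6 * sqrt (real j) * (2 / real j) \<le> 1/2" .
    qed auto
    finally show ?case .
  qed
qed

end

section \<open>Choice of the constants and conclusion\<close>

lemma exists_slack_constants:
  fixes c :: real
  assumes c: "0 < c" "c < 1"
  obtains \<epsilon> y :: real where "0 < \<epsilon>" "\<epsilon> \<le> 1/4" "1 < y" "y \<le> 2" "y ^ 3 * (1 - \<epsilon>) < 1" "y\<^sup>2 * c / (1 - \<epsilon>) < 1"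
proof -
  \<comment> \<open>\<open>\<epsilon>\<close> is fixed first with \<open>c < 1 - \<epsilon>\<close>.
    At \<open>y = 1\<close> both required inequalities are then strict, and by continuity they
    persist for some \<open>y > 1\<close>.\<close>
  define \<epsilon> where "\<epsilon> = min (1/4) ((1 - c) / 2)"
  have \<epsilon>: "0 < \<epsilon>" "\<epsilon> \<le> 1/4" "c < 1 - \<epsilon>" using c by (auto simp: \<epsilon>_def min_def field_simps)
  have "((\<lambda>y. y ^ 3 * (1 - \<epsilon>)) \<longlongrightarrow> 1 ^ 3 * (1 - \<epsilon>)) (at_right (1::real))" by (intro tendsto_intros)
  then have 1: "eventually (\<lambda>y. y ^ 3 * (1 - \<epsilon>) < 1) (at_right (1::real))" using \<epsilon> by (intro order_tendstoD) auto
  have "((\<lambda>y. y\<^sup>2 * c / (1 - \<epsilon>)) \<longlongrightarrow> 1\<^sup>2 * c / (1 - \<epsilon>)) (at_right (1::real))" using \<epsilon> by (intro tendsto_intros) auto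
  then have 2: "eventually (\<lambda>y. y\<^sup>2 * c / (1 - \<epsilon>) < 1) (at_right (1::real))" using \<epsilon> by (intro order_tendstoD) auto
  have 3: "eventually (\<lambda>y. y \<in> {1<..<2}) (at_right (1::real))" by (rule eventually_at_right_real) simp
  from 1 2 3 have "eventually (\<lambda>y. y \<in> {1<..<2} \<and> y ^ 3 * (1 - \<epsilon>) < 1 \<and> y\<^sup>2 * c / (1 - \<epsilon>) < 1) (at_right (1::real))"
    by eventually_elim simp
  then obtain y where "y \<in> {1<..<2} \<and> y ^ 3 * (1 - \<epsilon>) < 1 \<and> y\<^sup>2 * c / (1 - \<epsilon>) < 1"
    using eventually_happens'[OF trivial_limit_at_right_real] by blast
  then show ?thesis using that[of \<epsilon> y] \<epsilon> by auto
qed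

text \<open>With \<open>k\<close> asymptotic to \<open>b powr (j/2)\<close>, twice
  \<open>log b n\<close> is \<open>j + 2 * log b j + o(1)\<close>. The iterated logarithm is
  \<open>log b j - log b 2 + o(1)\<close>, so the terms \<open>log b j\<close>, due to the factor
  \<open>j\<close> in \<open>n = j * k\<close>, cancel.\<close>

lemma log_index_tendsto:
  fixes b w :: real and k :: "nat \<Rightarrow> nat"
  assumes w: "w > 1" "w ^ 12 = b" and lim: "(\<lambda>j. real (k j) / (w ^ j) ^ 6) \<longlonglongrightarrow> 1"
  shows "(\<lambda>j. (2 * log b (real (j * k j)) - 2 * log b (log b (real (j * k j))) - 2 * log b 2) - real j) \<longlonglongrightarrow> 0"
proof -
  have b1: "b > 1" using w one_less_power[of w 12] by simp
  define d where "d j = log b (real (k j) / (w ^ j) ^ 6)" for j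
  have d: "d \<longlonglongrightarrow> 0"
  proof -
    have "(\<lambda>j. log b (real (k j) / (w ^ j) ^ 6)) \<longlonglongrightarrow> log b 1"
      using b1 by (intro tendsto_log lim tendsto_const) auto
    then show ?thesis by (simp add: d_def[abs_def])
  qed
  define e where "e j = 2 * (log b (real j) / real j + d j / real j)" for j
  have e: "e \<longlonglongrightarrow> 0"
  proof -
    have "(\<lambda>j. (ln (real j) / real j) / ln b) \<longlonglongrightarrow> 0 / ln b"
      using b1 by (intro tendsto_intros lim_ln_over_n) auto
    then have 1: "(\<lambda>j. log b (real j) / real j) \<longlonglongrightarrow> 0" by (simp add: log_def mult.commute)
    have "(\<lambda>j. d j * (1 / real j)) \<longlonglongrightarrow> 0 * 0" by (intro tendsto_mult d lim_1_over_n)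
    then have 2: "(\<lambda>j. d j / real j) \<longlonglongrightarrow> 0" by simp
    have "(\<lambda>j. 2 * (log b (real j) / real j + d j / real j)) \<longlonglongrightarrow> 2 * (0 + 0)" by (intro tendsto_intros 1 2)
    then show ?thesis by (simp add: e_def[abs_def])
  qed
  have "(\<lambda>j. 2 * d j - 2 * log b (1 + e j)) \<longlonglongrightarrow> 2 * 0 - 2 * log b (1 + 0)"
    using b1 by (intro tendsto_intros d e) auto
  then have L: "(\<lambda>j. 2 * d j - 2 * log b (1 + e j)) \<longlonglongrightarrow> 0" by simp
  have "eventually (\<lambda>j. e j > -1) sequentially" using e by (intro order_tendstoD) auto
  moreover have "eventually (\<lambda>j. real (k j) / (w ^ j) ^ 6 > 0) sequentially" using lim by (intro order_tendstoD) auto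
  ultimately have "eventually (\<lambda>j. 2 * d j - 2 * log b (1 + e j)
      = (2 * log b (real (j * k j)) - 2 * log b (log b (real (j * k j))) - 2 * log b 2) - real j) sequentially"
    using eventually_gt_at_top[of 0]
  proof eventually_elim
    case (elim j)
    have Y: "(w ^ j) ^ 6 > 0" using w by simp
    have k0: "real (k j) > 0" using elim Y by (simp add: zero_less_divide_iff)
    have j0: "real j > 0" using elim by simp
    have "log b ((w ^ j) ^ 6) = real j / 2"
    proof -
      have "2 * log b ((w ^ j) ^ 6) = log b (((w ^ j) ^ 6)\<^sup>2)" by (simp only: log_nat_power[OF less_imp_le[OF Y]] of_nat_numeral)
      also have "((w ^ j) ^ 6)\<^sup>2 = b ^ j" unfolding w(2)[symmetric] by (simp add: power_mult[symmetric] mult_ac)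
      also have "log b (b ^ j) = real j" using b1 by (simp add: log_nat_power)
      finally show ?thesis by simp
    qed
    then have lk: "log b (real (k j)) = real j / 2 + d j" unfolding d_def using k0 Y b1 by (simp add: log_divide)
    then have ln': "log b (real (j * k j)) = real j / 2 * (1 + e j)"
      using k0 j0 b1 by (simp add: log_mult e_def field_simps)
    have "log b (real j / 2 * (1 + e j)) = log b (real j) - log b 2 + log b (1 + e j)"
      using elim j0 b1 by (simp add: log_mult log_divide)
    then have "log b (log b (real (j * k j))) = log b (real j) - log b 2 + log b (1 + e j)" by (simp only: ln')
    moreover have "2 * log b (real (j * k j)) = real j + 2 * log b (real j) + 2 * d j"
      unfolding ln' using j0 by (simp add: e_def field_simps)
    ultimately show ?case by linarith
  qed
  from Lim_transform_eventually[OF L this] show ?thesis .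
qed

theorem theorem1:
  fixes p b :: real
  assumes "0 < p" and "p < 1 - 1 / exp 2"
    and "b = 1 / (1 - p)"
  shows "\<exists>(n :: nat \<Rightarrow> nat) (j0 :: nat). j0 \<ge> 1 \<and>
     (\<forall>j\<ge>1. n j > 0) \<and> (\<forall>i j. 1 \<le> i \<longrightarrow> i < j \<longrightarrow> n i < n j) \<and>
     (\<forall>j\<ge>j0. j dvd n j) \<and>
     ((\<lambda>j. (2 * log b (real (n j)) - 2 * log b (log b (real (n j))) - 2 * log b 2) - real j)
        \<longlonglongrightarrow> 0) \<and>
     ((\<lambda>j. prob_Gnm (n j) (nat \<lfloor>p * real (n j choose 2)\<rfloor>)
              (\<lambda>E. real (eq_chromatic (n j) E) = real (n j) / real j)) \<longlonglongrightarrow> 1)"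
proof -
  define q where "q = 1 - p"
  have q: "1 / exp 2 < q" "q < 1" using assms by (auto simp: q_def)
  have q0: "q > 0" using q(1) by (rule less_trans[rotated]) simp
  have b: "b = 1 / q" using assms by (simp add: q_def)
  have b1: "b > 1" using q q0 by (simp add: b)
  have b2: "b < exp 2" using q q0 by (simp add: b field_simps)
  define w where "w = root 12 b"
  have w: "w > 1" "w ^ 12 = b" using b1 by (auto simp: w_def)
  have we: "w ^ 6 < exp 1"
  proof -
    have "(w ^ 6)\<^sup>2 < (exp 1)\<^sup>2" using b2 w(2) by (simp add: power_mult[symmetric] power2_eq_square exp_add[symmetric])
    then show ?thesis by (rule power_less_imp_less_base) simp
  qed
  obtain \<epsilon> y :: real where \<epsilon>y: "0 < \<epsilon>" "\<epsilon> \<le> 1/4" "1 < y" "y \<le> 2" "y ^ 3 * (1 - \<epsilon>) < 1"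
      "y\<^sup>2 * (w ^ 6 / exp 1) / (1 - \<epsilon>) < 1"
    using exists_slack_constants[of "w ^ 6 / exp 1"] w we by (auto simp: field_simps)
  define k where "k = opt_colours b"
  have lim: "(\<lambda>j. real (k j) / (w ^ j) ^ 6) \<longlonglongrightarrow> 1" unfolding k_def by (rule opt_colours_lim[OF w])
  interpret colour_sequence p q b w \<epsilon> y k
    using assms(1) q0 q_def b w lim \<epsilon>y by unfold_locales auto
  have spec: "eventually (\<lambda>j. 0 < k j \<and> sqrt (real j) ^ j \<le> expected_count b j (k j) * corr b j) sequentially"
    using opt_colours_spec[OF w, of 2] unfolding k_def by (auto elim: eventually_mono)
  have Etop: "filterlim E at_top sequentially"
    using spec by (intro E_at_top) (auto elim: eventually_mono)
  have E\<rho>: "(\<lambda>j. E j * \<rho> j) \<longlonglongrightarrow> 0"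
    using opt_colours_upper[OF w] by (intro E_\<rho>_tendsto_0) (simp add: k_def)
  note prob = prob_tendsto_1[OF Etop E\<rho>]
  \<comment> \<open>The ratio of consecutive values of \<open>k\<close> tends to
    \<open>w ^ 6\<close>; splitting it as \<open>w ^ 3 * w ^ 3\<close> gives slack on both sides of
    the comparison.\<close>
  have w3: "w ^ 3 > 1" using w by simp
  have "eventually (\<lambda>j. k j \<le> k (Suc j)) sequentially"
  proof -
    have "eventually (\<lambda>j. X (Suc j) ^ 6 \<le> w ^ 3 * real (k (Suc j))) sequentially"
      using k_ge[OF w3] by (rule eventually_compose_filterlim[OF _ filterlim_Suc])
    then show ?thesis using k_le[OF w3]
    proof eventually_elim
      case (elim j)
      have "w ^ 3 * (w ^ 3 * X j ^ 6) = X (Suc j) ^ 6" by (simp add: X_def power_mult_distrib power_add[symmetric] mult.assoc[symmetric])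
      then have "w ^ 3 * (w ^ 3 * X j ^ 6) \<le> w ^ 3 * real (k (Suc j))" using elim by simp
      then have "w ^ 3 * X j ^ 6 \<le> real (k (Suc j))" by (rule mult_left_le_imp_le) (use w in simp)
      then show ?case using elim by linarith
    qed
  qed
  with spec have "eventually (\<lambda>j. 0 < k j \<and> k j \<le> k (Suc j)) sequentially" by eventually_elim simp
  then obtain J where J: "\<And>j. j \<ge> J \<Longrightarrow> 0 < k j \<and> k j \<le> k (Suc j)" unfolding eventually_sequentially by blast
  \<comment> \<open>Below \<open>J\<close> the number of classes is replaced by 1, so that it is
    positive and nondecreasing from the start. Then \<open>j * K' j\<close> is strictly increasing
    and divisible by \<open>j\<close> for every \<open>j\<close>, and \<open>j0 = 1\<close> serves
    as the witness.\<close>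
  define K' where "K' j = (if j \<ge> J then k j else 1)" for j
  define n' where "n' j = j * K' j" for j
  have K'pos: "K' j > 0" for j using J[of j] by (simp add: K'_def)
  have "n' j < n' (Suc j)" for j
  proof -
    have "K' j \<le> K' (Suc j)"
    proof (cases "j \<ge> J")
      case False
      then show ?thesis using K'pos[of "Suc j"] by (simp add: K'_def)
    qed (use J in \<open>simp add: K'_def\<close>)
    then have "j * K' j \<le> j * K' (Suc j)" by (rule mult_le_mono2)
    then show ?thesis using K'pos[of "Suc j"] unfolding n'_def mult_Suc by linarith
  qed
  then have mono: "strict_mono n'" by (simp add: strict_mono_Suc_iff)
  have ev: "eventually (\<lambda>j. n' j = j * k j) sequentially"
    using eventually_ge_at_top[of J] by eventually_elim (simp add: n'_def K'_def)
  show ?thesis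
  proof (intro exI[of _ n'] exI[of _ "1 :: nat"] conjI allI impI)
    show "n' j > 0" if "1 \<le> j" for j using that K'pos[of j] by (simp add: n'_def)
    show "n' i < n' j" if "i < j" for i j using strict_monoD[OF mono that] .
    show "j dvd n' j" for j by (simp add: n'_def)
    show "(\<lambda>j. (2 * log b (real (n' j)) - 2 * log b (log b (real (n' j))) - 2 * log b 2) - real j) \<longlonglongrightarrow> 0"
      by (rule Lim_transform_eventually[OF log_index_tendsto[OF w lim]]) (use ev in eventually_elim, simp)
    show "(\<lambda>j. prob_Gnm (n' j) (nat \<lfloor>p * real (n' j choose 2)\<rfloor>)
              (\<lambda>E. real (eq_chromatic (n' j) E) = real (n' j) / real j)) \<longlonglongrightarrow> 1"
      by (rule Lim_transform_eventually[OF prob])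
        (use ev in eventually_elim, simp add: m_def N_def n_def mult.commute)
  qed simp
qed

end
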